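(* For every integer $M$, the set $\Psi_M\cap\mathcal{O}_\infty$ has full Haar measure in $\mathcal{O}_\infty$ (its complement in $\mathcal{O}_\infty$ has Haar measure zero). Furthermore, there exists a set $\Sigma\subseteq\mathcal{O}_\infty$ of full Haar measure in $\mathcal{O}_\infty$ such that every $\alpha\in\Sigma$ is the limit of a sequence $\left\{\frac{f_n}{g_n}\right\}_n$, with $f_n,g_n\in A$, $g_n\neq 0$, satisfying $$\lim_{n\rightarrow\infty}\left|\alpha-\frac{f_n}{g_n}\right|_\infty|g_n|_\infty^2=0.$$
   Context: Let $\mathbb{F}=\mathbb{F}_q$ be a finite field and $X$ a smooth irreducible projective curve over $\mathbb{F}$ with function field $K$. Let $P_\infty$ be a closed point of $X$, $K_\infty$ the completion of $K$ at $P_\infty$, $\nu_\infty$ the normalized discrete valuation of $K_\infty$ (with $\nu_\infty(0)=\infty$), $|x|_\infty=q^{-\nu_\infty(x)}$, $\mathcal{O}_\infty=\{x\in K_\infty:|x|_\infty\le 1\}$, and $\pi$ a fixed uniformizing parameter. Let $A$ be the ring of rational functions on $X$ that are regular at every closed point other than $P_\infty$. For $\alpha\in K_\infty$ and an integer $M$, an $M$-approximation of $\alpha$ is a quotient $\frac fg$ with $f,g\in A$, $g\neq 0$, such that $fA+gA=A$ and $\left|\alpha-\frac fg\right|_\infty<\frac{|\pi|_\infty^M}{|g|_\infty^2}$. An element $\alpha$ is $M$-approximable if there is a sequence of $M$-approximations of $\alpha$ converging to $\alpha$ in $K_\infty$; $\Psi_M$ denotes the set of $M$-approximable elements of $K_\infty$.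 Haar measure refers to the (additive) Haar measure of $K_\infty$, restricted to $\mathcal{O}_\infty$. *)

theory Defs
  imports
    "HOL-Analysis.Analysis"
    "HOL-Library.Poly_Mapping"
    "HOL-Algebra.Ideal"
    "Jordan_Normal_Form.Determinant"
begin

section \<open>Polynomials in finitely many variables\<close>

text \<open>A monomial is its exponent vector, a finitely supported map from variable indices to
  exponents; a polynomial is a finitely supported map from monomials to coefficients.\<close>

type_synonym 'a mpoly = "(nat \<Rightarrow>\<^sub>0 nat) \<Rightarrow>\<^sub>0 'a"

definition polys :: "nat \<Rightarrow> 'a::zero mpoly set" where
  "polys N = {p. \<forall>m \<in> Poly_Mapping.keys p. Poly_Mapping.keys m \<subseteq> {..<N}}"

definition poly_ring :: "nat \<Rightarrow> 'a::comm_ring_1 mpoly ring" where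
  "poly_ring N = \<lparr>carrier = polys N, mult = (*), one = 1, zero = 0, add = (+)\<rparr>"

definition var :: "nat \<Rightarrow> 'a::comm_ring_1 mpoly" where
  "var i = Poly_Mapping.single (Poly_Mapping.single i 1) 1"

definition mdeg :: "(nat \<Rightarrow>\<^sub>0 nat) \<Rightarrow> nat" where
  "mdeg m = (\<Sum>i \<in> Poly_Mapping.keys m. Poly_Mapping.lookup m i)"

definition homogeneous :: "nat \<Rightarrow> 'a::zero mpoly \<Rightarrow> bool" where
  "homogeneous d p \<longleftrightarrow> (\<forall>m \<in> Poly_Mapping.keys p. mdeg m = d)"

definition hom_part :: "nat \<Rightarrow> 'a::comm_monoid_add mpoly \<Rightarrow> 'a mpoly" where
  "hom_part d p = (\<Sum>m \<in> {m \<in> Poly_Mapping.keys p. mdeg m = d}. Poly_Mapping.single m (Poly_Mapping.lookup p m))"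

definition pdiff :: "nat \<Rightarrow> 'a::comm_ring_1 mpoly \<Rightarrow> 'a mpoly" where
  "pdiff i p = (\<Sum>m \<in> Poly_Mapping.keys p.
     Poly_Mapping.single (m - Poly_Mapping.single i 1) (of_nat (Poly_Mapping.lookup m i) * Poly_Mapping.lookup p m))"

definition peval :: "('a::zero \<Rightarrow> 'l::comm_ring_1) \<Rightarrow> (nat \<Rightarrow> 'l) \<Rightarrow> 'a mpoly \<Rightarrow> 'l" where
  "peval \<phi> x p = (\<Sum>m \<in> Poly_Mapping.keys p. \<phi> (Poly_Mapping.lookup p m) * (\<Prod>i \<in> Poly_Mapping.keys m. x i ^ Poly_Mapping.lookup m i))"


section \<open>Projective curves\<close>

text \<open>The closed subscheme of projective \<open>n\<close>-space cut out by \<open>I\<close> is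
  \<open>Proj (F[x\<^sub>0,\<dots>,x\<^sub>n] / I)\<close>; its points are the homogeneous primes that contain \<open>I\<close> and do not
  contain all of \<open>x\<^sub>0,\<dots>,x\<^sub>n\<close>. The closure of a point \<open>P\<close> consists of the points containing \<open>P\<close>,
  so the closed points are the maximal ones.\<close>

definition proj_points :: "nat \<Rightarrow> 'f::field mpoly set \<Rightarrow> 'f mpoly set set" where
  "proj_points n I = {P. primeideal P (poly_ring (Suc n)) \<and> (\<forall>p \<in> P. \<forall>d. hom_part d p \<in> P) \<and>
     I \<subseteq> P \<and> (\<exists>i \<le> n. var i \<notin> P)}"

definition closed_points :: "nat \<Rightarrow> 'f::field mpoly set \<Rightarrow> 'f mpoly set set" where
  "closed_points n I = {P \<in> proj_points n I. \<forall>Q \<in> proj_points n I. P \<subseteq> Q \<longrightarrow> Q = P}"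

text \<open>For a homogeneous prime \<open>I\<close>, the function field of \<open>Proj (F[x\<^sub>0,\<dots>,x\<^sub>n] / I)\<close> consists of the
  fractions \<open>a/b\<close> with \<open>a\<close>, \<open>b\<close> homogeneous of the same degree and \<open>b \<notin> I\<close>, where
  \<open>a/b = a'/b'\<close> iff \<open>a b' - a' b \<in> I\<close>. It is handled inside an ambient field \<open>'l\<close> (later its
  completion): \<open>\<xi>\<^sub>0,\<dots>,\<xi>\<^sub>n\<close> are homogeneous coordinates in \<open>'l\<close> of the generic point, meaning that
  the homogeneous polynomials vanishing at \<open>\<xi>\<close> are exactly those in \<open>I\<close>. Then \<open>a/b\<close> is
  identified with \<open>a(\<xi>)/b(\<xi>)\<close>, and every embedding of the function field in \<open>'l\<close> is of this
  form (take \<open>\<xi>\<^sub>i\<close> to be the image of \<open>x\<^sub>i/x\<^sub>j\<close> for some \<open>x\<^sub>j \<notin> I\<close>).\<close>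

definition generic_coordinates ::
  "nat \<Rightarrow> 'f::field mpoly set \<Rightarrow> ('f \<Rightarrow> 'l::field) \<Rightarrow> (nat \<Rightarrow> 'l) \<Rightarrow> bool" where
  "generic_coordinates n I \<phi> \<xi> \<longleftrightarrow> comm_ring_hom \<phi> \<and>
     (\<forall>d. \<forall>p \<in> polys (Suc n). homogeneous d p \<longrightarrow> (peval \<phi> \<xi> p = 0 \<longleftrightarrow> p \<in> I))"

definition local_ring ::
  "nat \<Rightarrow> ('f::field \<Rightarrow> 'l::field) \<Rightarrow> (nat \<Rightarrow> 'l) \<Rightarrow> 'f mpoly set \<Rightarrow> 'l set" where
  "local_ring n \<phi> \<xi> P = {peval \<phi> \<xi> a / peval \<phi> \<xi> b | a b d.
     a \<in> polys (Suc n) \<and> b \<in> polys (Suc n) \<and> homogeneous d a \<and> homogeneous d b \<and> b \<notin> P}"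

text \<open>The function field is the local ring at the generic point \<open>I\<close>.\<close>

definition function_field ::
  "nat \<Rightarrow> 'f::field mpoly set \<Rightarrow> ('f \<Rightarrow> 'l::field) \<Rightarrow> (nat \<Rightarrow> 'l) \<Rightarrow> 'l set" where
  "function_field n I \<phi> \<xi> = local_ring n \<phi> \<xi> I"

definition alg_independent :: "('f::field \<Rightarrow> 'l::field) \<Rightarrow> nat \<Rightarrow> (nat \<Rightarrow> 'l) \<Rightarrow> bool" where
  "alg_independent \<phi> d y \<longleftrightarrow> (\<forall>p \<in> polys d. peval \<phi> y p = 0 \<longrightarrow> p = 0)"

definition has_trdeg :: "('f::field \<Rightarrow> 'l::field) \<Rightarrow> 'l set \<Rightarrow> nat \<Rightarrow> bool" where
  "has_trdeg \<phi> K d \<longleftrightarrow>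
     (\<exists>y. (\<forall>i < d. y i \<in> K) \<and> alg_independent \<phi> d y) \<and>
     \<not> (\<exists>y. (\<forall>i < Suc d. y i \<in> K) \<and> alg_independent \<phi> (Suc d) y)"

text \<open>Jacobian criterion: at a point \<open>P\<close> of a curve in projective \<open>n\<close>-space the Jacobian matrix of
  the ideal has rank \<open>n - 1\<close> over the residue field, i.e. some minor of size \<open>n - 1\<close> does not
  vanish at \<open>P\<close>. (For \<open>n = 1\<close> this is the empty minor, which is \<open>1\<close>.)\<close>

definition smooth_at :: "nat \<Rightarrow> 'f::field mpoly set \<Rightarrow> 'f mpoly set \<Rightarrow> bool" where
  "smooth_at n I P \<longleftrightarrow> (\<exists>f v. (\<forall>j < n - 1. f j \<in> I) \<and> (\<forall>k < n - 1. v k \<le> n) \<and>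
     Determinant.det (Matrix.mat (n - 1) (n - 1) (\<lambda>(j, k). pdiff (v k) (f j))) \<notin> P)"

text \<open>\<open>X = Proj (F[x\<^sub>0,\<dots>,x\<^sub>n] / I)\<close> is a smooth irreducible projective curve. Smooth schemes are
  reduced, so irreducibility amounts to \<open>I\<close> being a homogeneous prime. The dimension is the
  transcendence degree of the function field.\<close>

definition smooth_projective_curve ::
  "nat \<Rightarrow> 'f::field mpoly set \<Rightarrow> ('f \<Rightarrow> 'l::field) \<Rightarrow> (nat \<Rightarrow> 'l) \<Rightarrow> bool" where
  "smooth_projective_curve n I \<phi> \<xi> \<longleftrightarrow>
     I \<in> proj_points n {0} \<and> generic_coordinates n I \<phi> \<xi> \<and>
     has_trdeg \<phi> (function_field n I \<phi> \<xi>) 1 \<and>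
     (\<forall>P \<in> proj_points n I. smooth_at n I P)"

definition regular_outside ::
  "nat \<Rightarrow> 'f::field mpoly set \<Rightarrow> ('f \<Rightarrow> 'l::field) \<Rightarrow> (nat \<Rightarrow> 'l) \<Rightarrow> 'f mpoly set \<Rightarrow> 'l set" where
  "regular_outside n I \<phi> \<xi> Pinf = {x \<in> function_field n I \<phi> \<xi>.
     \<forall>P \<in> closed_points n I. P \<noteq> Pinf \<longrightarrow> x \<in> local_ring n \<phi> \<xi> P}"


section \<open>The completion at a closed point\<close>

text \<open>A valuation is an integer-valued function whose value at \<open>0\<close> (mathematically \<open>\<infinity>\<close>)
  is never used.\<close>

definition normalized_valuation :: "('l::field \<Rightarrow> int) \<Rightarrow> bool" where
  "normalized_valuation \<nu> \<longleftrightarrow>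
     (\<forall>x y. x \<noteq> 0 \<longrightarrow> y \<noteq> 0 \<longrightarrow> \<nu> (x * y) = \<nu> x + \<nu> y) \<and>
     (\<forall>x y. x \<noteq> 0 \<longrightarrow> y \<noteq> 0 \<longrightarrow> x + y \<noteq> 0 \<longrightarrow> min (\<nu> x) (\<nu> y) \<le> \<nu> (x + y)) \<and>
     \<nu> ` (UNIV - {0}) = UNIV"

definition absval :: "nat \<Rightarrow> ('l::field \<Rightarrow> int) \<Rightarrow> 'l \<Rightarrow> real" where
  "absval q \<nu> x = (if x = 0 then 0 else real q powi (- \<nu> x))"

definition valuation_topology :: "('l::field \<Rightarrow> real) \<Rightarrow> 'l topology" where
  "valuation_topology absv = Metric_space.mtopology UNIV (\<lambda>x y. absv (x - y))"

text \<open>The whole type \<open>'l\<close> with the valuation \<open>\<nu>\<close> is the completion of the function field at \<open>Pinf\<close>: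
  \<open>\<nu>\<close> restricts to the valuation with valuation ring the local ring at \<open>Pinf\<close>, the function field is
  dense, and \<open>'l\<close> is complete. By density \<open>\<nu>\<close> has the same value group on both fields, so both
  valuations are normalized.\<close>

definition completion_at ::
  "nat \<Rightarrow> 'f::{finite,field} mpoly set \<Rightarrow> ('f \<Rightarrow> 'l::field) \<Rightarrow> (nat \<Rightarrow> 'l) \<Rightarrow>
   'f mpoly set \<Rightarrow> ('l \<Rightarrow> int) \<Rightarrow> bool" where
  "completion_at n I \<phi> \<xi> Pinf \<nu> \<longleftrightarrow>
     normalized_valuation \<nu> \<and>
     (\<forall>x \<in> function_field n I \<phi> \<xi>. x \<noteq> 0 \<longrightarrow> (0 \<le> \<nu> x \<longleftrightarrow> x \<in> local_ring n \<phi> \<xi> Pinf)) \<and>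
     (valuation_topology (absval CARD('f) \<nu>)) closure_of (function_field n I \<phi> \<xi>) = UNIV \<and>
     Metric_space.mcomplete UNIV (\<lambda>x y. absval CARD('f) \<nu> (x - y))"

definition valuation_integers :: "('l::field \<Rightarrow> real) \<Rightarrow> 'l set" where
  "valuation_integers absv = {x. absv x \<le> 1}"

definition uniformizer :: "('l::field \<Rightarrow> int) \<Rightarrow> 'l \<Rightarrow> bool" where
  "uniformizer \<nu> \<pi> \<longleftrightarrow> \<pi> \<noteq> 0 \<and> \<nu> \<pi> = 1"

text \<open>Regularity is not required: on the locally compact, second countable groups considered here
  it is automatic.\<close>

definition haar_measure :: "'l::ab_group_add topology \<Rightarrow> 'l measure \<Rightarrow> bool" where
  "haar_measure T \<mu> \<longleftrightarrow>
     space \<mu> = UNIV \<and> sets \<mu> = sigma_sets UNIV {U. openin T U} \<and>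
     (\<forall>a. \<forall>B \<in> sets \<mu>. emeasure \<mu> ((+) a ` B) = emeasure \<mu> B) \<and>
     (\<forall>C. compactin T C \<longrightarrow> emeasure \<mu> C < \<infinity>) \<and>
     (\<forall>U. openin T U \<longrightarrow> U \<noteq> {} \<longrightarrow> 0 < emeasure \<mu> U)"


section \<open>Approximation\<close>

definition is_approximation ::
  "'l::field set \<Rightarrow> ('l \<Rightarrow> real) \<Rightarrow> 'l \<Rightarrow> int \<Rightarrow> 'l \<Rightarrow> 'l \<Rightarrow> bool" where
  "is_approximation A absv \<pi> M \<alpha> x \<longleftrightarrow> (\<exists>f \<in> A. \<exists>g \<in> A. g \<noteq> 0 \<and> x = f / g \<and>
     {f * a + g * b | a b. a \<in> A \<and> b \<in> A} = A \<and>
     absv (\<alpha> - f / g) < absv \<pi> powi M / (absv g)\<^sup>2)"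

definition approximable :: "'l::field set \<Rightarrow> ('l \<Rightarrow> real) \<Rightarrow> 'l \<Rightarrow> int \<Rightarrow> 'l set" where
  "approximable A absv \<pi> M = {\<alpha>. \<exists>x. (\<forall>k. is_approximation A absv \<pi> M \<alpha> (x k)) \<and>
     limitin (valuation_topology absv) x \<alpha> sequentially}"

end

theory Submission
  imports Defs
begin

text \<open>
  The ring \<open>A\<close> is discrete in \<open>K\<^sub>\<infinity>\<close> (a nonzero element of \<open>A\<close> with no pole at \<open>P\<^sub>\<infinity>\<close> maps a finite space
  of forms into itself, hence is a root of unity) and cocompact. For the latter choose forms \<open>\<sigma>\<close>, \<open>\<tau>\<close>
  of equal degree without common zero such that \<open>\<sigma>\<close> vanishes at \<open>P\<^sub>\<infinity>\<close>; the chart ring of \<open>\<tau>\<close> is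
  finite modulo powers of \<open>u = \<sigma>/\<tau>\<close>, so powers of a single element that is \<open>1\<close> at \<open>P\<^sub>\<infinity>\<close> and \<open>0\<close> at the
  other zeros of \<open>\<sigma>\<close> become idempotent there and give simultaneous approximation at these points.

  Let \<open>Q\<close> be the size of the residue field at \<open>P\<^sub>\<infinity>\<close>. Counting in the discrete cocompact ring \<open>A\<close>
  shows that among the pairs \<open>(f, g)\<close> with \<open>\<nu> g = -k\<close> and \<open>f/g\<close> in a given ball a proportion bounded
  below is coprime. Distinct fractions with \<open>\<nu> g = -k\<close> have difference of valuation at most \<open>2k\<close>, so the
  neighbourhoods required of an \<open>M\<close>-approximation are disjoint and fill a fixed proportion of every
  ball, for suitable large \<open>k\<close>. Hence almost every point lies in infinitely many of them.
\<close>

section \<open>Discrete valuations\<close>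

text \<open>Riemann-Roch is replaced by one crude constant \<open>N\<close>, for which
  \<open>A + D (- N)\<close> is the whole field. Together with \<open>A \<inter> D 1 = {0}\<close>
  it fixes every count up to a power of \<open>Q\<close> depending on \<open>N\<close>, which
  suffices because only a positive proportion is wanted. \<open>A\<close> need not be a principal
  ideal domain, so coprimality is sieved over maximal ideals and their norms. A union bound over all
  of them could exceed 1; hence g is confined to the class of 1 modulo an element m lying in every
  ideal of norm up to \<open>Q ^ i0\<close>. This costs a fixed factor, and to main order the other
  ideals spoil only O(\<open>1 / Q ^ i0\<close>) of the pairs. The proportion obtained is uniform in
  the ball, but k must be large in terms of the ball, so the complement is worn down ball by ball.
  On the geometric side the constants are finite, so there may be no linear form that avoids the
  zeros of a given form; powers of the coordinates are combined instead. The same finiteness then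
  helps: quotients are finite, and the pigeonhole principle for powers of one element yields roots
  of unity, inverses and idempotents alike.\<close>

locale valued_field =
  fixes \<nu> :: "'l::field \<Rightarrow> int"
  assumes norm_val: "normalized_valuation \<nu>"
begin

text \<open>The fractional ideals of the valuation ring. Zero needs its own disjunct because
  \<open>\<nu> 0\<close> is an arbitrary integer.\<close>

definition D :: "int \<Rightarrow> 'l set" where
  "D j = {x. x = 0 \<or> j \<le> \<nu> x}"

lemma val_mult: "x \<noteq> 0 \<Longrightarrow> y \<noteq> 0 \<Longrightarrow> \<nu> (x * y) = \<nu> x + \<nu> y"
  and val_add: "x \<noteq> 0 \<Longrightarrow> y \<noteq> 0 \<Longrightarrow> x + y \<noteq> 0 \<Longrightarrow> min (\<nu> x) (\<nu> y) \<le> \<nu> (x + y)"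
  using norm_val unfolding normalized_valuation_def by blast+

lemma val_surj: "\<exists>x. x \<noteq> 0 \<and> \<nu> x = j"
proof -
  have "j \<in> \<nu> ` (UNIV - {0})" using norm_val unfolding normalized_valuation_def by simp
  then show ?thesis by auto
qed

lemma val_one [simp]: "\<nu> 1 = 0"
  using val_mult[of 1 1] by simp

lemma val_minus [simp]: "\<nu> (- x) = \<nu> x"
proof (cases "x = 0")
  case False
  have "\<nu> (-1) + \<nu> (-1) = 0" using val_mult[of "-1" "-1"] by simp
  then have "\<nu> (-1) = 0" by simp
  then show ?thesis using val_mult[of "-1" x] False by simp
qed simp

lemma val_inverse: "x \<noteq> 0 \<Longrightarrow> \<nu> (inverse x) = - \<nu> x"
  using val_mult[of x "inverse x"] by simp

lemma val_divide: "x \<noteq> 0 \<Longrightarrow> y \<noteq> 0 \<Longrightarrow> \<nu> (x / y) = \<nu> x - \<nu> y"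
  using val_mult[of x "inverse y"] val_inverse[of y] by (simp add: divide_inverse)

lemma val_power: "x \<noteq> 0 \<Longrightarrow> \<nu> (x ^ n) = int n * \<nu> x"
  by (induction n) (auto simp: val_mult algebra_simps)

lemma D_zero [simp]: "0 \<in> D j"
  by (simp add: D_def)

lemma D_one [simp]: "1 \<in> D 0"
  by (simp add: D_def)

lemma D_add: "x \<in> D j \<Longrightarrow> y \<in> D j \<Longrightarrow> x + y \<in> D j"
  using val_add[of x y] by (cases "x = 0"; cases "y = 0"; cases "x + y = 0") (auto simp: D_def)

lemma D_minus: "x \<in> D j \<Longrightarrow> - x \<in> D j"
  by (auto simp: D_def)

lemma D_diff: "x \<in> D j \<Longrightarrow> y \<in> D j \<Longrightarrow> x - y \<in> D j"
  using D_add[of x j "- y"] D_minus[of y j] by simp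

lemma D_diff_commute: "x - y \<in> D j \<longleftrightarrow> y - x \<in> D j"
  using D_minus[of "x - y" j] D_minus[of "y - x" j] by auto

lemma D_trans: "x - y \<in> D j \<Longrightarrow> y - z \<in> D j \<Longrightarrow> x - z \<in> D j"
  using D_add[of "x - y" j "y - z"] by simp

lemma D_mult: "x \<in> D i \<Longrightarrow> y \<in> D j \<Longrightarrow> x * y \<in> D (i + j)"
  by (cases "x = 0"; cases "y = 0") (auto simp: D_def val_mult)

lemma D_mono: "i \<le> j \<Longrightarrow> D j \<subseteq> D i"
  by (auto simp: D_def)

lemma D_scale: "c \<noteq> 0 \<Longrightarrow> c * x \<in> D j \<longleftrightarrow> x \<in> D (j - \<nu> c)"
  by (cases "x = 0") (auto simp: D_def val_mult)

lemma D_divide: "c \<noteq> 0 \<Longrightarrow> x / c \<in> D j \<longleftrightarrow> x \<in> D (j + \<nu> c)"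
  using D_scale[of c "x / c" "j + \<nu> c"] by simp

lemma D_power: "x \<in> D 0 \<Longrightarrow> x ^ n \<in> D 0"
  by (induction n) (use D_mult[of x 0 _ 0] in auto)

text \<open>In an ultrametric a perturbation of strictly higher order cannot change the order of
  \<open>x\<close>. This is how elements of prescribed order are found in dense or cocompact
  subsets.\<close>

lemma val_eq_of_diff:
  assumes "x \<noteq> 0" "x - y \<in> D (\<nu> x + 1)"
  shows "y \<noteq> 0 \<and> \<nu> y = \<nu> x"
proof -
  have y0: "y \<noteq> 0" using assms by (auto simp: D_def)
  moreover have "\<nu> y = \<nu> x"
  proof (cases "x = y")
    case False
    then have d1: "\<nu> (x - y) \<ge> \<nu> x + 1" using assms by (simp add: D_def)
    have "\<nu> (y - x) = \<nu> (x - y)" using val_minus[of "x - y"] unfolding minus_diff_eq .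
    note d = d1 d1[folded this]
    have "\<nu> y \<ge> \<nu> x" using val_add[of x "y - x"] d y0 assms False by auto
    moreover have "\<nu> x \<ge> min (\<nu> y) (\<nu> (x - y))" using val_add[of y "x - y"] y0 assms False by auto
    ultimately show ?thesis using d by auto
  qed simp
  ultimately show ?thesis ..
qed

end

locale finite_residue_field = valued_field +
  fixes Q :: nat
  assumes residue: "\<exists>R. finite R \<and> R \<subseteq> D 0 \<and> card R = Q \<and> (\<forall>x\<in>D 0. \<exists>r\<in>R. x - r \<in> D 1) \<and>
    (\<forall>r\<in>R. \<forall>r'\<in>R. r - r' \<in> D 1 \<longrightarrow> r = r')"
begin

lemma Q_ge_2: "2 \<le> Q"
proof -
  obtain R where R: "finite R" "R \<subseteq> D 0" "card R = Q" "\<forall>x\<in>D 0. \<exists>r\<in>R. x - r \<in> D 1"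
    using residue by blast
  obtain r where r: "r \<in> R" "0 - r \<in> D 1" using R(4) D_zero by blast
  obtain s where s: "s \<in> R" "1 - s \<in> D 1" using R(4) D_one by blast
  have "r \<noteq> s"
  proof
    assume "r = s"
    then have "1 \<in> D 1" using D_diff[OF s(2) r(2)] by simp
    then show False by (simp add: D_def)
  qed
  then have "card {r, s} = 2" by simp
  then show ?thesis using card_mono[of R "{r, s}"] R r s by simp
qed

lemma Q_pos: "0 < Q" using Q_ge_2 by simp

text \<open>One digit is added per step: a class modulo \<open>D (i + n)\<close> splits into the
  \<open>Q\<close> classes of \<open>s + p * r\<close>, where \<open>p\<close>, of order exactly
  \<open>i + n\<close>, stands for a power of the uniformizer.\<close>

lemma D_representatives:
  obtains S where "finite S" "S \<subseteq> D i" "card S = Q ^ n" "\<And>x. x \<in> D i \<Longrightarrow> \<exists>s\<in>S. x - s \<in> D (i + int n)"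
    "\<And>s s'. s \<in> S \<Longrightarrow> s' \<in> S \<Longrightarrow> s - s' \<in> D (i + int n) \<Longrightarrow> s = s'"
proof (induction n arbitrary: thesis)
  case 0
  show ?case by (rule 0[of "{0}"]) auto
next
  case (Suc n)
  obtain S where S: "finite S" "S \<subseteq> D i" "card S = Q ^ n"
    "\<And>x. x \<in> D i \<Longrightarrow> \<exists>s\<in>S. x - s \<in> D (i + int n)"
    "\<And>s s'. s \<in> S \<Longrightarrow> s' \<in> S \<Longrightarrow> s - s' \<in> D (i + int n) \<Longrightarrow> s = s'"
    by (rule Suc.IH) blast
  obtain R where R: "finite R" "R \<subseteq> D 0" "card R = Q" "\<forall>x\<in>D 0. \<exists>r\<in>R. x - r \<in> D 1"
    "\<forall>r\<in>R. \<forall>r'\<in>R. r - r' \<in> D 1 \<longrightarrow> r = r'"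
    using residue by blast
  obtain p where p: "p \<noteq> 0" "\<nu> p = i + int n" using val_surj by blast
  let ?h = "\<lambda>(s, r). s + p * r"
  have pR: "p * r \<in> D (i + int n)" if "r \<in> R" for r
    using that R(2) p by (auto simp: D_scale)
  have uniq: "s = s' \<and> r = r'"
    if s: "s \<in> S" "s' \<in> S" "r \<in> R" "r' \<in> R" and d: "(s + p * r) - (s' + p * r') \<in> D (i + int (Suc n))"
    for s s' r r'
  proof -
    have "(s + p * r) - (s' + p * r') \<in> D (i + int n)" using d D_mono[of "i + int n" "i + int (Suc n)"] by auto
    moreover have "p * r' - p * r \<in> D (i + int n)" using D_diff pR s by blast
    ultimately have "((s + p * r) - (s' + p * r')) + (p * r' - p * r) \<in> D (i + int n)" by (rule D_add)
    then have "s - s' \<in> D (i + int n)" by simp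
    then have ss: "s = s'" using S(5) s by blast
    then have "p * (r - r') \<in> D (i + int (Suc n))" using d by (simp add: right_diff_distrib)
    then have "r - r' \<in> D 1" using p D_scale[of p "r - r'" "i + int (Suc n)"] by simp
    then have "r = r'" using R(5) s by blast
    with ss show ?thesis by simp
  qed
  have inj: "inj_on ?h (S \<times> R)"
  proof (rule inj_onI)
    fix a b assume ab: "a \<in> S \<times> R" "b \<in> S \<times> R" "?h a = ?h b"
    obtain s r s' r' where e: "a = (s, r)" "b = (s', r')" by (cases a, cases b)
    then show "a = b" using uniq[of s s' r r'] ab by simp
  qed
  let ?T = "?h ` (S \<times> R)"
  show ?case
  proof (rule Suc.prems[of ?T])
    show "finite ?T" using S R by simp
    show "?T \<subseteq> D i"
    proof
      fix y assume "y \<in> ?T"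
      then obtain s r where sr: "s \<in> S" "r \<in> R" "y = s + p * r" by auto
      moreover have "p * r \<in> D i" using pR[OF sr(2)] D_mono[of i "i + int n"] by auto
      ultimately show "y \<in> D i" using S(2) D_add[of s i "p * r"] by blast
    qed
    show "card ?T = Q ^ Suc n"
      using inj S R by (simp add: card_image card_cartesian_product)
    show "\<exists>t\<in>?T. x - t \<in> D (i + int (Suc n))" if x: "x \<in> D i" for x
    proof -
      obtain s where s: "s \<in> S" "x - s \<in> D (i + int n)" using S(4)[OF x] by blast
      then have "(x - s) / p \<in> D 0" using p by (simp add: D_divide)
      then obtain r where r: "r \<in> R" "(x - s) / p - r \<in> D 1" using R(4) by blast
      have "(x - s) / p - r = (x - (s + p * r)) / p" using p by (simp add: field_simps)
      then have "x - (s + p * r) \<in> D (1 + \<nu> p)" using r(2) D_divide[OF p(1), of "x - (s + p * r)" 1] by simp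
      then have "x - (s + p * r) \<in> D (i + int (Suc n))" using p(2) by (simp add: add.commute add.left_commute)
      then show ?thesis using s r by (intro bexI[of _ "s + p * r"]) auto
    qed
    show "t = t'" if t: "t \<in> ?T" "t' \<in> ?T" "t - t' \<in> D (i + int (Suc n))" for t t'
    proof -
      obtain s r s' r' where e: "s \<in> S" "r \<in> R" "t = s + p * r" "s' \<in> S" "r' \<in> R" "t' = s' + p * r'"
        using t by auto
      then show ?thesis using uniq[of s s' r r'] t by simp
    qed
  qed
qed

end

text \<open>Lattice axioms: \<open>A_discrete\<close> bounds the number of elements of
  \<open>A\<close> in a ball from above, \<open>A_cocompact\<close> from below. \<open>N\<close>
  takes over the part of the genus in these estimates.\<close>

locale discrete_cocompact_ring = finite_residue_field \<nu> Q for \<nu> :: "'l::field \<Rightarrow> int" and Q :: nat +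
  fixes A :: "'l set" and N :: nat
  assumes A_one: "1 \<in> A"
    and A_diff: "x \<in> A \<Longrightarrow> y \<in> A \<Longrightarrow> x - y \<in> A"
    and A_mult: "x \<in> A \<Longrightarrow> y \<in> A \<Longrightarrow> x * y \<in> A"
    and A_discrete: "x \<in> A \<Longrightarrow> x \<noteq> 0 \<Longrightarrow> \<nu> x \<le> 0"
    and A_cocompact: "\<exists>a\<in>A. x - a \<in> D (- int N)"
begin

lemma A_zero: "0 \<in> A" using A_diff[OF A_one A_one] by simp
lemma A_minus: "x \<in> A \<Longrightarrow> - x \<in> A" using A_diff[OF A_zero, of x] by simp
lemma A_add: "x \<in> A \<Longrightarrow> y \<in> A \<Longrightarrow> x + y \<in> A" using A_diff[of x "- y"] A_minus[of y] by simp
lemma A_power: "x \<in> A \<Longrightarrow> x ^ n \<in> A" by (induction n) (auto intro: A_one A_mult)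
lemma A_prod: "(\<And>i. i \<in> S \<Longrightarrow> f i \<in> A) \<Longrightarrow> prod f S \<in> A"
  by (induction S rule: infinite_finite_induct) (auto intro: A_one A_mult)

lemma A_D_1: "x \<in> A \<Longrightarrow> x \<in> D 1 \<Longrightarrow> x = 0"
  using A_discrete[of x] by (cases "x = 0") (auto simp: D_def)

abbreviation AD :: "nat \<Rightarrow> 'l set" where
  "AD j \<equiv> A \<inter> D (- int j)"

text \<open>Since \<open>A\<close> meets \<open>D 1\<close> only in 0, \<open>AD j\<close> injects
  into \<open>D (- j)\<close> modulo \<open>D 1\<close>, a quotient with \<open>j + 1\<close>
  digits.\<close>

lemma
  shows AD_finite: "finite (AD j)" and AD_upper: "card (AD j) \<le> Q ^ (j + 1)"
proof -
  obtain S where S: "finite S" "card S = Q ^ (j + 1)"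
    "\<And>x. x \<in> D (- int j) \<Longrightarrow> \<exists>s\<in>S. x - s \<in> D (- int j + int (j + 1))"
    by (rule D_representatives[of "- int j" "j + 1"]) blast
  then have "\<forall>x\<in>D (- int j). \<exists>s. s \<in> S \<and> x - s \<in> D 1" by auto
  then obtain h where h: "\<And>x. x \<in> D (- int j) \<Longrightarrow> h x \<in> S \<and> x - h x \<in> D 1"
    using bchoice[of "D (- int j)" "\<lambda>x s. s \<in> S \<and> x - s \<in> D 1"] by blast
  have inj: "inj_on h (AD j)"
  proof (rule inj_onI)
    fix x y assume xy: "x \<in> AD j" "y \<in> AD j" "h x = h y"
    then have "x - y \<in> D 1" using h[of x] h[of y] D_trans[of x "h x" 1 y] D_diff_commute by auto
    then show "x = y" using A_D_1[of "x - y"] A_diff xy by auto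
  qed
  have sub: "h ` AD j \<subseteq> S" using h by auto
  show "finite (AD j)" using inj_on_finite[OF inj sub S(1)] .
  show "card (AD j) \<le> Q ^ (j + 1)" using card_inj_on_le[OF inj sub S(1)] S(2) by simp
qed

text \<open>Rounding to \<open>A\<close> moves a point by an element of \<open>D (- N)\<close>, so
  it is injective on representatives of \<open>D (- j)\<close> modulo
  \<open>D (- N)\<close>.\<close>

lemma AD_lower: "N \<le> j \<Longrightarrow> Q ^ (j - N) \<le> card (AD j)"
proof -
  assume j: "N \<le> j"
  obtain S where S: "finite S" "S \<subseteq> D (- int j)" "card S = Q ^ (j - N)"
    "\<And>s s'. s \<in> S \<Longrightarrow> s' \<in> S \<Longrightarrow> s - s' \<in> D (- int j + int (j - N)) \<Longrightarrow> s = s'"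
    by (rule D_representatives[of "- int j" "j - N"]) blast
  have jN: "- int j + int (j - N) = - int N" using j by simp
  obtain h where h: "\<And>x. h x \<in> A \<and> x - h x \<in> D (- int N)" using A_cocompact by metis
  have inj: "inj_on h S"
  proof (rule inj_onI)
    fix x y assume xy: "x \<in> S" "y \<in> S" "h x = h y"
    have "x - y \<in> D (- int N)" using xy(3) h[of x] h[of y] D_trans[of x "h x" _ y] D_diff_commute by auto
    then show "x = y" using S(4)[unfolded jN] xy by blast
  qed
  have "h ` S \<subseteq> AD j"
  proof
    fix y assume "y \<in> h ` S"
    then obtain x where x: "x \<in> S" "y = h x" by auto
    have "x - h x \<in> D (- int j)" using h[of x] D_mono[of "- int j" "- int N"] j by auto
    then have "x - (x - h x) \<in> D (- int j)" using D_diff S(2) x by blast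
    then show "y \<in> AD j" using h[of x] x by simp
  qed
  then show ?thesis using card_inj_on_le[OF inj _ AD_finite] S(3) by simp
qed

lemma A_ball_lower:
  assumes "N \<le> j"
  shows "finite {a \<in> A. a - y \<in> D (- int j)}" "Q ^ (j - N) \<le> card {a \<in> A. a - y \<in> D (- int j)}"
proof -
  obtain a0 where a0: "a0 \<in> A" "y - a0 \<in> D (- int N)" using A_cocompact by blast
  then have y: "y - a0 \<in> D (- int j)" using D_mono[of "- int j" "- int N"] assms by auto
  have "{a \<in> A. a - y \<in> D (- int j)} = (+) a0 ` AD j"
  proof (intro equalityI subsetI)
    fix a assume "a \<in> {a \<in> A. a - y \<in> D (- int j)}"
    then have "a - a0 \<in> AD j" using y a0 D_trans[of a y _ a0] A_diff by auto
    then show "a \<in> (+) a0 ` AD j" by (auto simp: image_iff intro!: bexI[of _ "a - a0"])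
  next
    fix a assume "a \<in> (+) a0 ` AD j"
    then obtain b where b: "b \<in> AD j" "a = a0 + b" by auto
    then have "b - (y - a0) \<in> D (- int j)" using y D_diff by auto
    then show "a \<in> {a \<in> A. a - y \<in> D (- int j)}" using a0 A_add b by (auto simp: algebra_simps)
  qed
  moreover have "card ((+) a0 ` AD j) = card (AD j)" by (intro card_image) simp
  ultimately show "finite {a \<in> A. a - y \<in> D (- int j)}" "Q ^ (j - N) \<le> card {a \<in> A. a - y \<in> D (- int j)}"
    using AD_finite[of j] AD_lower[OF assms] by auto
qed

lemma exists_pole: "\<exists>t\<in>A. t \<noteq> 0 \<and> \<nu> t < 0"
proof -
  obtain x where x: "x \<noteq> 0" "\<nu> x = - int N - 1" using val_surj by blast
  obtain t where t: "t \<in> A" "x - t \<in> D (- int N)" using A_cocompact by blast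
  have "t \<noteq> 0 \<and> \<nu> t = \<nu> x" using val_eq_of_diff[of x t] x t by simp
  then show ?thesis using t x by force
qed

section \<open>Ideals of the lattice ring and their norms\<close>

definition ideal_in :: "'l set \<Rightarrow> bool" where
  "ideal_in J \<longleftrightarrow> J \<subseteq> A \<and> 0 \<in> J \<and> (\<forall>x\<in>J. \<forall>y\<in>J. x + y \<in> J) \<and> (\<forall>a\<in>A. \<forall>x\<in>J. a * x \<in> J)"

definition maximal_in :: "'l set \<Rightarrow> bool" where
  "maximal_in J \<longleftrightarrow> ideal_in J \<and> 1 \<notin> J \<and> (\<forall>J'. ideal_in J' \<longrightarrow> J \<subseteq> J' \<longrightarrow> 1 \<notin> J' \<longrightarrow> J' = J)"

definition residue_classes :: "'l set \<Rightarrow> 'l set set" where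
  "residue_classes J = (\<lambda>a. {x \<in> A. x - a \<in> J}) ` A"

text \<open>\<open>card\<close> is 0 on an infinite quotient, so \<open>0 < nrm J\<close> also
  records finiteness.\<close>

definition nrm :: "'l set \<Rightarrow> nat" where
  "nrm J = card (residue_classes J)"

lemma ideal_inD:
  assumes "ideal_in J"
  shows "J \<subseteq> A" "0 \<in> J" "x \<in> J \<Longrightarrow> y \<in> J \<Longrightarrow> x + y \<in> J" "a \<in> A \<Longrightarrow> x \<in> J \<Longrightarrow> a * x \<in> J"
    "x \<in> J \<Longrightarrow> - x \<in> J" "x \<in> J \<Longrightarrow> y \<in> J \<Longrightarrow> x - y \<in> J"
proof -
  show *: "J \<subseteq> A" "0 \<in> J" "x \<in> J \<Longrightarrow> y \<in> J \<Longrightarrow> x + y \<in> J" "a \<in> A \<Longrightarrow> x \<in> J \<Longrightarrow> a * x \<in> J" for a x y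
    using assms unfolding ideal_in_def by auto
  have m: "- x \<in> J" if "x \<in> J" for x using *(4)[of "-1" x] A_minus[OF A_one] that by simp
  then show "x \<in> J \<Longrightarrow> - x \<in> J" .
  show "x \<in> J \<Longrightarrow> y \<in> J \<Longrightarrow> x - y \<in> J" using *(3)[of x "- y"] m[of y] by simp
qed

lemma residue_class_eq:
  assumes "ideal_in J" "a \<in> A" "b \<in> A"
  shows "{x \<in> A. x - a \<in> J} = {x \<in> A. x - b \<in> J} \<longleftrightarrow> a - b \<in> J"
proof
  assume "{x \<in> A. x - a \<in> J} = {x \<in> A. x - b \<in> J}"
  moreover have "a \<in> {x \<in> A. x - a \<in> J}" using assms ideal_inD(2) by simp
  ultimately show "a - b \<in> J" by auto
next
  assume ab: "a - b \<in> J"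
  have "x - a \<in> J \<longleftrightarrow> x - b \<in> J" for x
    using ideal_inD(3)[OF assms(1), of "x - a" "a - b"] ideal_inD(6)[OF assms(1), of "x - b" "a - b"] ab by auto
  then show "{x \<in> A. x - a \<in> J} = {x \<in> A. x - b \<in> J}" by simp
qed

lemma residue_representatives:
  assumes J: "ideal_in J" and S: "\<And>a. a \<in> A \<Longrightarrow> \<exists>s\<in>S. a - s \<in> J" and SA: "S \<subseteq> A"
  obtains T where "T \<subseteq> S" "card T = nrm J" "\<And>t t'. t \<in> T \<Longrightarrow> t' \<in> T \<Longrightarrow> t - t' \<in> J \<Longrightarrow> t = t'"
    "finite T \<longleftrightarrow> finite (residue_classes J)"
proof -
  let ?c = "\<lambda>a. {x \<in> A. x - a \<in> J}"
  have "?c ` A \<subseteq> ?c ` S"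
  proof
    fix c assume "c \<in> ?c ` A"
    then obtain a where a: "a \<in> A" "c = ?c a" by auto
    obtain s where s: "s \<in> S" "a - s \<in> J" using S a by blast
    then have "s \<in> A" using SA by auto
    then have "?c a = ?c s" using residue_class_eq[OF J a(1), of s] s by blast
    then show "c \<in> ?c ` S" using s a by blast
  qed
  then have eq: "residue_classes J = ?c ` S" unfolding residue_classes_def using SA by blast
  obtain T where T: "T \<subseteq> S" "inj_on ?c T" "?c ` S = ?c ` T" using subset_image_inj[of "?c ` S" ?c S] by auto
  show thesis
  proof (rule that[OF T(1)])
    show "card T = nrm J" unfolding nrm_def eq T(3) using T(2) by (simp add: card_image)
    show "finite T \<longleftrightarrow> finite (residue_classes J)" unfolding eq T(3) using finite_image_iff[OF T(2)] by simp
    fix t t' assume t: "t \<in> T" "t' \<in> T" "t - t' \<in> J"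
    then have "t \<in> A" "t' \<in> A" using T(1) SA by auto
    then have "?c t = ?c t'" using residue_class_eq[OF J, of t t'] t by blast
    then show "t = t'" using inj_onD[OF T(2)] t by blast
  qed
qed

text \<open>Division with remainder by \<open>f\<close>: the quotient \<open>a / f\<close> is
  rounded to \<open>b\<close> in \<open>A\<close>, and the remainder is \<open>f\<close> times an
  element of \<open>D (- N)\<close>.\<close>

lemma ideal_reps:
  assumes J: "ideal_in J" and f: "f \<in> J" "f \<in> D (- int j)" "f \<noteq> 0" and a: "a \<in> A"
  shows "\<exists>s\<in>AD (j + N). a - s \<in> J"
proof -
  obtain b where b: "b \<in> A" "a / f - b \<in> D (- int N)" using A_cocompact by blast
  let ?s = "a - b * f"
  have "f * (a / f - b) \<in> D (- int j + - int N)" using D_mult[OF f(2) b(2)] .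
  then have "?s \<in> D (- int (j + N))" using f(3) by (simp add: algebra_simps)
  moreover have "?s \<in> A" using a b f ideal_inD(1)[OF J] A_diff A_mult by blast
  moreover have "a - ?s \<in> J" using ideal_inD(4)[OF J b(1) f(1)] by simp
  ultimately show ?thesis by blast
qed

text \<open>Remainders modulo \<open>f\<close> meet every class, which bounds the norm. For the last
  bound, the sums of an element of \<open>J \<inter> D (- j)\<close> and a class representative are
  pairwise distinct and all stay in \<open>AD (j + N)\<close>.\<close>

lemma
  assumes J: "ideal_in J" and f: "f \<in> J" "f \<in> D (- int j)" "f \<noteq> 0"
  shows residue_classes_finite: "finite (residue_classes J)"
    and nrm_upper: "nrm J \<le> Q ^ (j + N + 1)"
    and ideal_AD_upper: "card (J \<inter> D (- int j)) * nrm J \<le> Q ^ (j + N + 1)"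
proof -
  obtain T where T: "T \<subseteq> AD (j + N)" "card T = nrm J" "\<And>t t'. t \<in> T \<Longrightarrow> t' \<in> T \<Longrightarrow> t - t' \<in> J \<Longrightarrow> t = t'"
      "finite T \<longleftrightarrow> finite (residue_classes J)"
    by (rule residue_representatives[OF J, of "AD (j + N)"]) (use ideal_reps[OF J f] in auto)
  have fT: "finite T" using finite_subset[OF T(1) AD_finite] .
  then show "finite (residue_classes J)" using T(4) by simp
  have up: "card (AD (j + N)) \<le> Q ^ (j + N + 1)" using AD_upper by blast
  show "nrm J \<le> Q ^ (j + N + 1)" using card_mono[OF AD_finite T(1)] up T(2) by simp
  let ?h = "\<lambda>(p, t). p + t"
  have JA: "J \<subseteq> A" using ideal_inD(1)[OF J] .
  have "inj_on ?h ((J \<inter> D (- int j)) \<times> T)"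
  proof (rule inj_onI)
    fix x y assume xy: "x \<in> (J \<inter> D (- int j)) \<times> T" "y \<in> (J \<inter> D (- int j)) \<times> T" "?h x = ?h y"
    obtain p t p' t' where e: "x = (p, t)" "y = (p', t')" by (cases x, cases y)
    have pt: "p \<in> J" "p' \<in> J" "t \<in> T" "t' \<in> T" "p + t = p' + t'" using xy e by auto
    then have "t - t' = p' - p" by (simp add: algebra_simps)
    then have "t - t' \<in> J" using ideal_inD(6)[OF J] pt by simp
    then have "t = t'" using T(3) pt by blast
    then show "x = y" using e pt by simp
  qed
  moreover have "?h ` ((J \<inter> D (- int j)) \<times> T) \<subseteq> AD (j + N)"
  proof
    fix z assume "z \<in> ?h ` ((J \<inter> D (- int j)) \<times> T)"
    then obtain p t where pt: "p \<in> J" "p \<in> D (- int j)" "t \<in> T" "z = p + t" by auto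
    have "p \<in> D (- int (j + N))" using pt(2) D_mono[of "- int (j + N)" "- int j"] by auto
    then show "z \<in> AD (j + N)" using pt T(1) JA D_add A_add by blast
  qed
  ultimately have "card ((J \<inter> D (- int j)) \<times> T) \<le> card (AD (j + N))"
    using card_inj_on_le AD_finite by blast
  then show "card (J \<inter> D (- int j)) * nrm J \<le> Q ^ (j + N + 1)" using up T(2) by (simp add: card_cartesian_product)
qed

text \<open>The summand 1 covers the case that \<open>J\<close> has no nonzero element in
  \<open>D (- j)\<close>; then \<open>X\<close> has at most one point. The scaling \<open>c\<close>
  serves denominators that are congruent modulo \<open>c\<close>.\<close>

lemma ideal_coset_upper:
  assumes J: "ideal_in J" and c: "c \<noteq> 0" and nJ: "0 < nrm J"
    and X: "\<And>x y. x \<in> X \<Longrightarrow> y \<in> X \<Longrightarrow> (x - y) / c \<in> J \<inter> D (- int j)"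
  shows "finite X" "real (card X) \<le> real Q ^ (j + N + 1) / real (nrm J) + 1"
proof -
  let ?J = "J \<inter> D (- int j)"
  have fJ: "finite ?J" using finite_subset[of ?J "AD j"] AD_finite ideal_inD(1)[OF J] by blast
  have XX: "finite X \<and> card X \<le> card ?J"
  proof (cases "X = {}")
    case False
    then obtain x0 where x0: "x0 \<in> X" by blast
    have inj: "inj_on (\<lambda>x. (x - x0) / c) X" using c by (auto simp: inj_on_def)
    have sub: "(\<lambda>x. (x - x0) / c) ` X \<subseteq> ?J" using X x0 by auto
    show ?thesis using inj_on_finite[OF inj sub fJ] card_inj_on_le[OF inj sub fJ] by simp
  qed simp
  then show "finite X" by simp
  show "real (card X) \<le> real Q ^ (j + N + 1) / real (nrm J) + 1"
  proof (cases "\<exists>f\<in>?J. f \<noteq> 0")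
    case True
    then obtain f where "f \<in> J" "f \<in> D (- int j)" "f \<noteq> 0" by blast
    then have "card ?J * nrm J \<le> Q ^ (j + N + 1)" using ideal_AD_upper[OF J] by blast
    then have "card X * nrm J \<le> Q ^ (j + N + 1)" using XX mult_le_mono1 le_trans by blast
    then have "real (card X) * real (nrm J) \<le> real Q ^ (j + N + 1)"
      by (metis of_nat_le_iff of_nat_mult of_nat_power)
    then show ?thesis using nJ by (simp add: field_simps)
  next
    case False
    then have "?J \<subseteq> {0}" by blast
    then have "card ?J \<le> 1" using card_mono[of "{0::'l}" ?J] by simp
    then show ?thesis using XX by (smt (verit) divide_nonneg_nonneg of_nat_0_le_iff of_nat_1 of_nat_le_iff zero_le_power)
  qed
qed

end

section \<open>Counting maximal ideals\<close>

lemma card_image_le_of_factor: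
  assumes "finite (F ` S)" "\<And>x y. x \<in> S \<Longrightarrow> y \<in> S \<Longrightarrow> F x = F y \<Longrightarrow> G x = G y"
  shows "card (G ` S) \<le> card (F ` S)"
proof -
  let ?h = "\<lambda>c. G (SOME x. x \<in> S \<and> F x = c)"
  have "G x = ?h (F x)" if "x \<in> S" for x
  proof -
    have "(SOME y. y \<in> S \<and> F y = F x) \<in> S \<and> F (SOME y. y \<in> S \<and> F y = F x) = F x"
      using that by (intro someI[of "\<lambda>y. y \<in> S \<and> F y = F x"]) simp
    then show ?thesis using assms(2)[of x] that by metis
  qed
  then have "G ` S \<subseteq> ?h ` F ` S" by auto
  then have "card (G ` S) \<le> card (?h ` F ` S)" using assms(1) by (intro card_mono) auto
  also have "\<dots> \<le> card (F ` S)" using assms(1) by (rule card_image_le)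
  finally show ?thesis .
qed

context discrete_cocompact_ring
begin

lemma maximal_inD:
  assumes "maximal_in p"
  shows "ideal_in p" "1 \<notin> p" "ideal_in J \<Longrightarrow> p \<subseteq> J \<Longrightarrow> 1 \<notin> J \<Longrightarrow> J = p"
  using assms unfolding maximal_in_def by simp_all

lemma ideal_in_Int: "ideal_in J \<Longrightarrow> ideal_in J' \<Longrightarrow> ideal_in (J \<inter> J')"
  unfolding ideal_in_def by auto

lemma ideal_in_A: "ideal_in A"
  unfolding ideal_in_def using A_zero A_add A_mult by auto

lemma ideal_in_add_principal:
  assumes J: "ideal_in J" and x: "x \<in> A"
  shows "ideal_in {y + a * x | y a. y \<in> J \<and> a \<in> A}" (is "ideal_in ?K")
    and "J \<subseteq> {y + a * x | y a. y \<in> J \<and> a \<in> A}" "x \<in> {y + a * x | y a. y \<in> J \<and> a \<in> A}"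
proof -
  note Jd = ideal_inD[OF J]
  have zero: "y \<in> ?K" if "y \<in> J" for y using that A_zero by force
  show "J \<subseteq> ?K" using zero by blast
  show "x \<in> ?K" using Jd(2) A_one by force
  show "ideal_in ?K"
    unfolding ideal_in_def
  proof (intro conjI ballI)
    show "?K \<subseteq> A" using Jd(1) x A_add A_mult by blast
    show "0 \<in> ?K" using zero Jd(2) by blast
    fix u assume "u \<in> ?K"
    then obtain y a where u: "u = y + a * x" "y \<in> J" "a \<in> A" by blast
    {
      fix v assume "v \<in> ?K"
      then obtain z b where v: "v = z + b * x" "z \<in> J" "b \<in> A" by blast
      have "u + v = (y + z) + (a + b) * x" using u v by (simp add: algebra_simps)
      then show "u + v \<in> ?K" using Jd(3)[OF u(2) v(2)] A_add[OF u(3) v(3)] by blast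
    }
    fix c assume c: "c \<in> A"
    have "c * u = c * y + (c * a) * x" using u by (simp add: algebra_simps)
    then show "c * u \<in> ?K" using Jd(4)[OF c u(2)] A_mult[OF c u(3)] by blast
  qed
qed

lemma maximal_inverse:
  assumes p: "maximal_in p" and x: "x \<in> A" "x \<notin> p"
  obtains a where "a \<in> A" "1 - a * x \<in> p"
proof -
  have J: "ideal_in p" by (rule maximal_inD(1)[OF p])
  note K = ideal_in_add_principal[OF J x(1)]
  have "1 \<in> {y + a * x | y a. y \<in> p \<and> a \<in> A}"
  proof (rule ccontr)
    assume "1 \<notin> {y + a * x | y a. y \<in> p \<and> a \<in> A}"
    then have "{y + a * x | y a. y \<in> p \<and> a \<in> A} = p" by (rule maximal_inD(3)[OF p K(1,2)])
    then show False using K(3) x(2) by simp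
  qed
  then obtain y a where e: "1 = y + a * x" "y \<in> p" "a \<in> A" by blast
  have "y + a * x - a * x \<in> p" using e(2) by simp
  then have "1 - a * x \<in> p" unfolding e(1)[symmetric] .
  then show thesis by (rule that[OF e(3)])
qed

lemma maximal_prime:
  assumes p: "maximal_in p" and x: "x \<in> A" "x \<notin> p" and y: "y \<in> A" "x * y \<in> p"
  shows "y \<in> p"
proof -
  have J: "ideal_in p" by (rule maximal_inD(1)[OF p])
  obtain a where a: "a \<in> A" "1 - a * x \<in> p" using maximal_inverse[OF p x] .
  have "y * (1 - a * x) + a * (x * y) \<in> p"
    using ideal_inD(3)[OF J ideal_inD(4)[OF J y(1) a(2)] ideal_inD(4)[OF J a(1) y(2)]] .
  then show ?thesis by (simp add: algebra_simps)
qed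

text \<open>Half of the Chinese remainder theorem: \<open>a * x\<close> is 0 modulo \<open>J\<close>
  and 1 modulo \<open>p\<close>, so residues modulo both can be prescribed at once.\<close>

lemma nrm_Int:
  assumes J: "ideal_in J" and p: "maximal_in p" and nsub: "\<not> J \<subseteq> p"
    and fin: "finite (residue_classes (J \<inter> p))"
  shows "nrm J * nrm p \<le> nrm (J \<inter> p)"
proof -
  have P: "ideal_in p" using p maximal_inD(1) by simp
  have JP: "ideal_in (J \<inter> p)" using ideal_in_Int[OF J P] .
  obtain x where x: "x \<in> J" "x \<notin> p" using nsub by blast
  have xA: "x \<in> A" using x ideal_inD(1)[OF J] by blast
  obtain a where a: "a \<in> A" "1 - a * x \<in> p" using maximal_inverse[OF p xA x(2)] .
  let ?e = "a * x"
  have e: "?e \<in> J" "?e \<in> A" using ideal_inD(4)[OF J a(1) x(1)] ideal_inD(1)[OF J] by auto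
  let ?cl = "\<lambda>J a. {x \<in> A. x - a \<in> J}"
  let ?G = "\<lambda>a. (?cl J a, ?cl p a)"
  have "residue_classes J \<times> residue_classes p \<subseteq> ?G ` A"
  proof
    fix z assume "z \<in> residue_classes J \<times> residue_classes p"
    then obtain X Y where XY: "z = (X, Y)" "X \<in> residue_classes J" "Y \<in> residue_classes p" by (rule SigmaE)
    obtain b where b: "X = ?cl J b" "b \<in> A" using XY(2) unfolding residue_classes_def by (rule imageE)
    obtain c where c: "Y = ?cl p c" "c \<in> A" using XY(3) unfolding residue_classes_def by (rule imageE)
    note bc = b(2) c(2) XY(1)[unfolded b(1) c(1)]
    let ?y = "(1 - ?e) * b + ?e * c"
    have yA: "?y \<in> A" by (rule A_add[OF A_mult[OF A_diff[OF A_one e(2)] bc(1)] A_mult[OF e(2) bc(2)]])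
    have "?y - b = (c - b) * ?e" by (simp add: algebra_simps)
    then have "?y - b \<in> J" using ideal_inD(4)[OF J A_diff[OF bc(2,1)] e(1)] by (simp only:)
    then have 1: "?cl J ?y = ?cl J b" by (rule residue_class_eq[OF J yA bc(1), THEN iffD2])
    have "?y - c = (b - c) * (1 - ?e)" by (simp add: algebra_simps)
    then have "?y - c \<in> p" using ideal_inD(4)[OF P A_diff[OF bc(1,2)] a(2)] by (simp only:)
    then have "?cl p ?y = ?cl p c" by (rule residue_class_eq[OF P yA bc(2), THEN iffD2])
    with 1 have "z = ?G ?y" using bc(3) by (simp only:)
    then show "z \<in> ?G ` A" using yA by (rule image_eqI)
  qed
  moreover have "?G ` A \<subseteq> residue_classes J \<times> residue_classes p"
    unfolding residue_classes_def by (intro image_subsetI SigmaI imageI)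
  ultimately have eq: "?G ` A = residue_classes J \<times> residue_classes p" by (intro equalityI)
  have "card (?G ` A) \<le> card (?cl (J \<inter> p) ` A)"
  proof (rule card_image_le_of_factor[where F = "?cl (J \<inter> p)" and G = ?G])
    show "finite (?cl (J \<inter> p) ` A)" using fin unfolding residue_classes_def .
    fix y z assume yz: "y \<in> A" "z \<in> A" "?cl (J \<inter> p) y = ?cl (J \<inter> p) z"
    have "y - z \<in> J \<inter> p" using yz(3) by (rule residue_class_eq[OF JP yz(1,2), THEN iffD1])
    then have "y - z \<in> J" "y - z \<in> p" by auto
    then show "?G y = ?G z"
      using residue_class_eq[OF J yz(1,2), THEN iffD2] residue_class_eq[OF P yz(1,2), THEN iffD2]
      by (simp only:)
  qed
  then show ?thesis unfolding eq nrm_def card_cartesian_product residue_classes_def[of "J \<inter> p"] .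
qed

text \<open>An element of bounded pole order lies in few maximal ideals of large norm: the norms
  multiply up to the norm of the intersection, and that norm is bounded through
  \<open>f\<close>.\<close>

lemma nrm_Inter:
  assumes "finite S" "\<And>p. p \<in> S \<Longrightarrow> maximal_in p \<and> f \<in> p \<and> B \<le> nrm p" "f \<in> A" "f \<in> D (- int j)" "f \<noteq> 0"
  shows "B ^ card S \<le> Q ^ (j + N + 1)"
proof -
  \<comment> \<open>Intersecting with \<open>A\<close> makes the empty intersection the unit ideal
    instead of \<open>UNIV\<close>.\<close>
  have "ideal_in (A \<inter> \<Inter> S) \<and> f \<in> A \<inter> \<Inter> S \<and> B ^ card S \<le> nrm (A \<inter> \<Inter> S)"
    using assms(1,2)
  proof (induction S)
    case empty
    have "{x \<in> A. x - 0 \<in> A} \<in> residue_classes A" unfolding residue_classes_def using A_zero by blast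
    moreover have "finite (residue_classes A)"
      using residue_classes_finite[OF ideal_in_A _ assms(4,5)] assms(3) by blast
    ultimately have "1 \<le> nrm A" unfolding nrm_def by (metis One_nat_def Suc_leI card_gt_0_iff empty_iff)
    then show ?case using ideal_in_A assms(3) by simp
  next
    case (insert p S)
    let ?J = "A \<inter> \<Inter> S"
    have IH: "ideal_in ?J" "f \<in> ?J" "B ^ card S \<le> nrm ?J" using insert by auto
    have p: "maximal_in p" "f \<in> p" "B \<le> nrm p" using insert by auto
    have P: "ideal_in p" using p maximal_inD(1) by simp
    have eq: "A \<inter> \<Inter> (insert p S) = ?J \<inter> p" by auto
    have id: "ideal_in (?J \<inter> p)" using ideal_in_Int[OF IH(1) P] .
    have nsub: "\<not> ?J \<subseteq> p"
    proof -
      \<comment> \<open>Prime avoidance: each \<open>q\<close> in \<open>S\<close> is maximal and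
        differs from \<open>p\<close>, so it has an element outside \<open>p\<close>, and the
        product of these stays outside the prime \<open>p\<close>.\<close>
      have "\<exists>h. h \<in> A \<and> h \<notin> p \<and> (\<forall>q\<in>S. h \<in> q)"
        using insert(1,2) insert.prems
      proof (induction S)
        case empty
        then show ?case using A_one maximal_inD(2)[OF p(1)] by blast
      next
        case (insert q S)
        obtain h where h: "h \<in> A" "h \<notin> p" "\<forall>q\<in>S. h \<in> q" using insert by auto
        have q: "maximal_in q" "q \<noteq> p" using insert by auto
        then obtain g where g: "g \<in> q" "g \<notin> p" using maximal_inD(3)[OF q(1) P] maximal_inD(2)[OF p(1)] by blast
        have Q': "ideal_in q" "q \<subseteq> A" using maximal_inD(1)[OF q(1)] ideal_inD(1) by auto
        have gA: "g \<in> A" using g Q' by blast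
        have "h * g \<in> q" using ideal_inD(4)[OF Q'(1) h(1) g(1)] .
        moreover have "\<forall>r\<in>S. h * g \<in> r"
        proof
          fix r assume r: "r \<in> S"
          then have "ideal_in r" using insert.prems maximal_inD(1) by blast
          then have "g * h \<in> r" using ideal_inD(4)[of r g h] gA h(3) r by blast
          then show "h * g \<in> r" by (simp add: mult.commute)
        qed
        moreover have "h * g \<notin> p" using maximal_prime[OF p(1) h(1,2) gA] g by blast
        ultimately show ?case using A_mult[OF h(1) gA] by blast
      qed
      then show ?thesis by blast
    qed
    have "finite (residue_classes (?J \<inter> p))"
      using residue_classes_finite[OF id _ assms(4,5)] IH(2) p(2) by blast
    then have "nrm ?J * nrm p \<le> nrm (?J \<inter> p)" using nrm_Int[OF IH(1) p(1) nsub] by blast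
    moreover have "B ^ card (insert p S) \<le> nrm ?J * nrm p"
      using insert(1,2) IH(3) p(3) by (simp add: mult_le_mono mult.commute)
    ultimately show ?case unfolding eq using id IH(2) p(2) by auto
  qed
  then show ?thesis using nrm_upper[of "A \<inter> \<Inter> S" f j] assms(4,5) le_trans by blast
qed

text \<open>Norms are grouped between consecutive powers of \<open>Q\<close>; a norm need not itself
  be a power of \<open>Q\<close>.\<close>

definition places :: "nat \<Rightarrow> 'l set set" where
  "places i = {p. maximal_in p \<and> Q ^ i \<le> nrm p \<and> nrm p < Q ^ (i + 1)}"

text \<open>Two elements of a sufficiently large \<open>AD j\<close> agree modulo \<open>p\<close>,
  so every \<open>p\<close> in question contains a nonzero element of \<open>AD j\<close>. Each such
  element lies in at most \<open>2 * N + 3\<close> of these ideals, which gives the factor.\<close>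

lemma
  assumes i: "1 \<le> i"
  shows places_finite: "finite (places i)" and places_card: "card (places i) \<le> (2 * N + 3) * Q ^ (i + N + 2)"
proof -
  \<comment> \<open>With \<open>j - N = i + 1\<close>, \<open>AD_lower\<close> yields
    \<open>Q ^ (i + 1)\<close> elements, more than any norm in \<open>places i\<close>.\<close>
  define j where "j = i + 1 + N"
  define P where "P = (\<lambda>f. {p \<in> places i. f \<in> p})"
  have bound: "finite (P f) \<and> card (P f) \<le> 2 * N + 3" if f: "f \<in> AD j" "f \<noteq> 0" for f
  proof (rule ccontr)
    assume neg: "\<not> ?thesis"
    have "\<exists>S. S \<subseteq> P f \<and> finite S \<and> card S = 2 * N + 4"
    proof (cases "finite (P f)")
      case True
      then have "2 * N + 4 \<le> card (P f)" using neg by simp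
      then obtain S where "S \<subseteq> P f" "card S = 2 * N + 4" "finite S" by (rule obtain_subset_with_card_n)
      then show ?thesis by blast
    next
      case False
      then show ?thesis using infinite_arbitrarily_large[of "P f" "2 * N + 4"] by blast
    qed
    then obtain S where S: "S \<subseteq> P f" "finite S" "card S = 2 * N + 4" by blast
    have "(Q ^ i) ^ card S \<le> Q ^ (j + N + 1)"
      by (rule nrm_Inter[OF S(2), of f]) (use S f in \<open>auto simp: P_def places_def\<close>)
    then have "Q ^ (i * (2 * N + 4)) \<le> Q ^ (j + N + 1)" unfolding S(3) by (simp add: power_mult)
    \<comment> \<open>The exponents would satisfy
      \<open>i * (2 * N + 4) \<le> i + 2 * N + 2\<close>, which already fails for
      \<open>i = 1\<close>; this is where \<open>2 * N + 4\<close> comes from.\<close>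
    with Q_ge_2 have "i * (2 * N + 4) \<le> j + N + 1" by (intro power_le_imp_le_exp[of Q "i * (2 * N + 4)"]) simp_all
    then have "i * (2 * N + 4) \<le> i + 2 * N + 2" unfolding j_def by simp
    moreover have "i + 2 * N + 3 \<le> i * (2 * N + 4)" using i by (cases i) auto
    ultimately show False by simp
  qed
  have sub: "places i \<subseteq> (\<Union>f\<in>AD j - {0}. P f)"
  proof
    fix p assume p: "p \<in> places i"
    then have pm: "maximal_in p" and np: "nrm p < Q ^ (i + 1)" "Q ^ i \<le> nrm p" unfolding places_def by auto
    have P: "ideal_in p" using pm by (rule maximal_inD(1))
    have "0 < nrm p" using np(2) Q_pos zero_less_power[of Q i] by linarith
    then have fin: "finite (residue_classes p)" unfolding nrm_def using card_ge_0_finite by blast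
    let ?c = "\<lambda>a. {x \<in> A. x - a \<in> p}"
    have "Q ^ (i + 1) \<le> card (AD j)" using AD_lower[of j] unfolding j_def by simp
    then have lt: "nrm p < card (AD j)" using np by simp
    have "\<not> inj_on ?c (AD j)"
    proof
      assume "inj_on ?c (AD j)"
      then have "card (AD j) \<le> nrm p" unfolding nrm_def
        by (rule card_inj_on_le[OF _ _ fin]) (auto simp: residue_classes_def)
      then show False using lt by simp
    qed
    then obtain a b where ab: "a \<in> AD j" "b \<in> AD j" "?c a = ?c b" "a \<noteq> b" unfolding inj_on_def by blast
    then have "a - b \<in> p" using residue_class_eq[OF P, of a b] by blast
    moreover have "a - b \<in> AD j" using ab A_diff D_diff by blast
    ultimately show "p \<in> (\<Union>f\<in>AD j - {0}. P f)" using ab(4) p unfolding P_def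
      by (intro UN_I[of "a - b"]) simp_all
  qed
  have fin: "finite (\<Union>f\<in>AD j - {0}. P f)"
    by (rule finite_UN_I[OF finite_Diff[OF AD_finite]]) (use bound in blast)
  then show "finite (places i)" by (rule finite_subset[OF sub])
  have "card (places i) \<le> card (\<Union>f\<in>AD j - {0}. P f)" by (rule card_mono[OF fin sub])
  also have "\<dots> \<le> (\<Sum>f\<in>AD j - {0}. card (P f))" by (rule card_UN_le[OF finite_Diff[OF AD_finite]])
  also have "\<dots> \<le> (\<Sum>f\<in>AD j - {0}. 2 * N + 3)" using bound by (intro sum_mono) auto
  also have "\<dots> = card (AD j - {0}) * (2 * N + 3)" by simp
  also have "\<dots> \<le> Q ^ (j + 1) * (2 * N + 3)"
    by (rule mult_le_mono1[OF le_trans[OF card_mono[OF AD_finite Diff_subset] AD_upper]])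
  finally show "card (places i) \<le> (2 * N + 3) * Q ^ (i + N + 2)" unfolding j_def by (simp add: mult.commute add.commute add.left_commute)
qed

lemma exists_maximal:
  assumes J: "ideal_in J" "1 \<notin> J"
  obtains p where "maximal_in p" "J \<subseteq> p"
proof -
  let ?\<A> = "{K. ideal_in K \<and> 1 \<notin> K \<and> J \<subseteq> K}"
  have "\<exists>M\<in>?\<A>. \<forall>X\<in>?\<A>. M \<subseteq> X \<longrightarrow> X = M"
  proof (rule subset_Zorn_nonempty)
    show "?\<A> \<noteq> {}" using J by blast
    fix C assume C: "C \<noteq> {}" "subset.chain ?\<A> C"
    have Cid: "ideal_in K \<and> 1 \<notin> K \<and> J \<subseteq> K" if "K \<in> C" for K using C(2) that unfolding subset.chain_def by blast
    have "ideal_in (\<Union> C)" unfolding ideal_in_def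
    proof (intro conjI ballI)
      show "\<Union> C \<subseteq> A" using Cid ideal_inD(1) by blast
      show "0 \<in> \<Union> C" using Cid ideal_inD(2) C(1) by blast
      fix x assume "x \<in> \<Union> C"
      then obtain K where K: "K \<in> C" "x \<in> K" by blast
      {
        fix y assume "y \<in> \<Union> C"
        then obtain L where L: "L \<in> C" "y \<in> L" by blast
        have "K \<subseteq> L \<or> L \<subseteq> K" using C(2) K L unfolding subset.chain_def by blast
        then show "x + y \<in> \<Union> C"
        proof
          assume "K \<subseteq> L"
          then have "x + y \<in> L" using ideal_inD(3)[of L x y] Cid[OF L(1)] K(2) L(2) by (metis subsetD)
          then show ?thesis using L(1) by (rule UnionI[rotated])
        next
          assume "L \<subseteq> K"
          then have "x + y \<in> K" using ideal_inD(3)[of K x y] Cid[OF K(1)] K(2) L(2) by (metis subsetD)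
          then show ?thesis using K(1) by (rule UnionI[rotated])
        qed
      }
      fix a assume "a \<in> A"
      then show "a * x \<in> \<Union> C" using ideal_inD(4)[of K a x] Cid K by blast
    qed
    then show "\<Union> C \<in> ?\<A>" using Cid C(1) by blast
  qed
  then obtain M where M: "ideal_in M" "1 \<notin> M" "J \<subseteq> M" "\<forall>X\<in>?\<A>. M \<subseteq> X \<longrightarrow> X = M" by blast
  have "maximal_in M" unfolding maximal_in_def using M by blast
  then show thesis using that M(3) by blast
qed

definition coprime_in :: "'l \<Rightarrow> 'l \<Rightarrow> bool" where
  "coprime_in f g \<longleftrightarrow> (\<exists>a\<in>A. \<exists>b\<in>A. f * a + g * b = 1)"

lemma not_coprime_maximal:
  assumes "f \<in> A" "g \<in> A" "\<not> coprime_in f g"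
  obtains p where "maximal_in p" "f \<in> p" "g \<in> p"
proof -
  have z: "ideal_in {0}" unfolding ideal_in_def using A_zero by auto
  note K = ideal_in_add_principal[OF z assms(1)]
  let ?K = "{y + a * f |y a. y \<in> {0} \<and> a \<in> A}"
  note L = ideal_in_add_principal[OF K(1) assms(2)]
  let ?L = "{y + a * g |y a. y \<in> ?K \<and> a \<in> A}"
  have "1 \<notin> ?L"
  proof
    assume "1 \<in> ?L"
    then obtain y a b where "1 = y + a * f + b * g" and y: "y \<in> {0}" and ab: "a \<in> A" "b \<in> A" by blast
    moreover have "f * a + g * b = y + a * f + b * g" using y by (simp add: mult.commute)
    ultimately have "f * a + g * b = 1" by (simp only:)
    then show False using assms(3) ab unfolding coprime_in_def by blast
  qed
  then obtain p where p: "maximal_in p" "?L \<subseteq> p" by (rule exists_maximal[OF L(1)])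
  have "f \<in> p" by (rule subsetD[OF p(2) subsetD[OF L(2) K(3)]])
  moreover have "g \<in> p" by (rule subsetD[OF p(2) L(3)])
  ultimately show thesis by (rule that[OF p(1)])
qed

text \<open>Two of the powers \<open>1, t, \<dots>, t\<^sup>B\<close> agree modulo a maximal ideal of norm at most \<open>B\<close>, so
  the product of all their differences lies in every such ideal.\<close>

lemma small_places_annihilator:
  obtains m where "m \<in> A" "m \<noteq> 0" "\<And>p. maximal_in p \<Longrightarrow> finite (residue_classes p) \<Longrightarrow> nrm p \<le> B \<Longrightarrow> m \<in> p"
proof -
  obtain t where t: "t \<in> A" "t \<noteq> 0" "\<nu> t < 0" using exists_pole by blast
  define m where "m = (\<Prod>(i, j)\<in>{(i, j). i < j \<and> j \<le> B}. t ^ j - t ^ i)"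
  have fin: "finite {(i, j). i < j \<and> j \<le> B}"
    by (rule finite_subset[of _ "{..B} \<times> {..B}"]) auto
  have ne: "t ^ j \<noteq> t ^ i" if "i < j" for i j
  proof
    assume "t ^ j = t ^ i"
    then have "int j * \<nu> t = int i * \<nu> t" using val_power t by metis
    then show False using t that by simp
  qed
  show thesis
  proof (rule that[of m])
    show "m \<in> A" unfolding m_def by (rule A_prod) (auto intro: A_diff A_power t)
    show "m \<noteq> 0" unfolding m_def using ne fin by (auto simp: prod_zero_iff)
    fix p assume p: "maximal_in p" "finite (residue_classes p)" "nrm p \<le> B"
    have P: "ideal_in p" using p maximal_inD(1) by simp
    let ?c = "\<lambda>i. {x \<in> A. x - t ^ i \<in> p}"
    have "\<not> inj_on ?c {..B}"
    proof
      assume "inj_on ?c {..B}"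
      then have "card {..B} \<le> nrm p" unfolding nrm_def
        by (rule card_inj_on_le[OF _ _ p(2)]) (auto simp: residue_classes_def intro!: A_power t)
      then show False using p(3) by simp
    qed
    then obtain i j where ij: "i \<le> B" "j \<le> B" "?c i = ?c j" "i \<noteq> j" unfolding inj_on_def by blast
    then have "t ^ i - t ^ j \<in> p" "t ^ j - t ^ i \<in> p"
      using residue_class_eq[OF P A_power[OF t(1)] A_power[OF t(1)], of i j]
        residue_class_eq[OF P A_power[OF t(1)] A_power[OF t(1)], of j i] by blast+
    then obtain i j where ij: "i < j" "j \<le> B" "t ^ j - t ^ i \<in> p" using ij by (metis nat_neq_iff)
    have "m = (\<Prod>(i, j)\<in>{(i, j). i < j \<and> j \<le> B} - {(i, j)}. t ^ j - t ^ i) * (t ^ j - t ^ i)"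
      unfolding m_def using prod.remove[OF fin, of "(i, j)" "\<lambda>(i, j). t ^ j - t ^ i"] ij by (simp add: mult.commute)
    moreover have "(\<Prod>(i, j)\<in>{(i, j). i < j \<and> j \<le> B} - {(i, j)}. t ^ j - t ^ i) \<in> A"
      by (rule A_prod) (auto intro: A_diff A_power t)
    ultimately show "m \<in> p" using ideal_inD(4)[OF P _ ij(3)] by simp
  qed
qed

end

section \<open>Counting coprime fractions\<close>

text \<open>The summand for \<open>i\<close> bounds the pairs spoiled by ideals of norm about
  \<open>q ^ i\<close>: there are O(\<open>q ^ i\<close>) such ideals, each catching at most
  \<open>X / q ^ i + 1\<close> denominators and \<open>Y / q ^ i + 1\<close> numerators. After
  multiplying out, only the first term is of order \<open>X * Y\<close>, and its geometric tail is
  small for large \<open>i0\<close>.\<close>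

lemma sum_places_bound:
  fixes q X Y :: real
  assumes q: "2 \<le> q" and X: "0 \<le> X" "0 \<le> Y"
  shows "(\<Sum>i=i0..K. q ^ i * ((X / q ^ i + 1) * (Y / q ^ i + 1)))
     \<le> 2 * (X * Y) / q ^ i0 + real (K + 1) * (X + Y) + 2 * q ^ K"
proof -
  have q0: "0 < q ^ i" for i using q by simp
  have inv: "(\<Sum>i=i0..K. 1 / q ^ i) \<le> 2 / q ^ i0" for K
  proof (cases "i0 \<le> K")
    case True
    have "(\<Sum>i=i0..K. 1 / q ^ i) \<le> 2 / q ^ i0 - 1 / q ^ K"
      using True
    proof (induction rule: dec_induct)
      case base
      then show ?case by simp
    next
      case (step n)
      have "2 / q ^ Suc n \<le> 1 / q ^ n" using q q0[of n] by (simp add: field_simps)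
      then show ?case using step by (simp add: sum.atLeast_Suc_atMost)
    qed
    then show ?thesis using q0[of K] by (smt (verit) divide_nonneg_nonneg)
  next
    case False
    then show ?thesis using q0[of i0] by simp
  qed
  have pow: "(\<Sum>i=i0..K. q ^ i) \<le> 2 * q ^ K"
  proof -
    have "(\<Sum>i=i0..K. q ^ i) \<le> (\<Sum>i=0..K. q ^ i)" using q by (intro sum_mono2) auto
    also have "\<dots> \<le> 2 * q ^ K"
    proof (induction K)
      case (Suc K)
      have "2 * q ^ K \<le> q * q ^ K" using q q0[of K] by simp
      then show ?case using Suc by simp
    qed simp
    finally show ?thesis .
  qed
  have "(\<Sum>i=i0..K. q ^ i * ((X / q ^ i + 1) * (Y / q ^ i + 1)))
    = (\<Sum>i=i0..K. (X * Y) * (1 / q ^ i) + (X + Y) + q ^ i)"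
    by (intro sum.cong refl) (use q in \<open>simp add: field_simps\<close>)
  also have "\<dots> = (X * Y) * (\<Sum>i=i0..K. 1 / q ^ i) + real (card {i0..K}) * (X + Y) + (\<Sum>i=i0..K. q ^ i)"
    by (simp only: sum.distrib sum_distrib_left[symmetric] sum_constant distrib_left)
  also have "\<dots> \<le> (X * Y) * (2 / q ^ i0) + real (K + 1) * (X + Y) + 2 * q ^ K"
    using X by (intro add_mono mult_left_mono mult_right_mono inv pow) auto
  finally show ?thesis by (simp add: mult.commute)
qed

text \<open>Meant for the middle term of the preceding bound: it is linear in \<open>k\<close> times
  \<open>q ^ k\<close> and has to be beaten by \<open>q ^ (2 * k)\<close>.\<close>

lemma linear_le_power:
  fixes q C :: real
  assumes "2 \<le> q"
  shows "\<exists>k\<ge>k0. C * real (k + 1) \<le> q ^ k"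
proof -
  have 1: "(\<lambda>k. real k * (1 / q) ^ k) \<longlonglongrightarrow> 0"
    by (rule powser_times_n_limit_0) (use assms in \<open>simp add: norm_divide\<close>)
  have 2: "(\<lambda>k. (1 / q) ^ k) \<longlonglongrightarrow> 0"
    by (rule LIMSEQ_realpow_zero) (use assms in simp_all)
  have "(\<lambda>k. C * (real k * (1 / q) ^ k + (1 / q) ^ k)) \<longlonglongrightarrow> C * (0 + 0)"
    by (rule tendsto_mult_left[OF tendsto_add[OF 1 2]])
  then have "(\<lambda>k. C * (real k * (1 / q) ^ k + (1 / q) ^ k)) \<longlonglongrightarrow> 0" by simp
  then have "\<forall>\<^sub>F k in sequentially. C * (real k * (1 / q) ^ k + (1 / q) ^ k) < 1"
    by (rule order_tendstoD(2)) simp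
  then have "\<forall>\<^sub>F k in sequentially. C * (real k * (1 / q) ^ k + (1 / q) ^ k) < 1 \<and> k \<ge> k0"
    using eventually_ge_at_top eventually_conj by blast
  then obtain k where k: "C * (real k * (1 / q) ^ k + (1 / q) ^ k) < 1" "k \<ge> k0"
    using eventually_happens'[OF sequentially_bot] by blast
  have "C * real (k + 1) < q ^ k" using k(1) assms by (simp add: field_simps power_one_over)
  then show ?thesis using k(2) less_imp_le by blast
qed

context discrete_cocompact_ring
begin

text \<open>If \<open>f / g = f0 / g0\<close> with both pairs coprime, then
  \<open>g / g0 = f * a + g * b\<close> lies in \<open>A\<close> and has order 0. So a fraction
  determines its pair up to the at most \<open>Q\<close> elements of \<open>AD 0\<close>.\<close>

lemma coprime_fiber_card:
  assumes S: "finite S" and gS: "\<And>g f. (g, f) \<in> S \<Longrightarrow> g \<in> A \<and> f \<in> A \<and> g \<noteq> 0 \<and> \<nu> g = n \<and> coprime_in f g"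
  shows "card S \<le> card ((\<lambda>(g, f). f / g) ` S) * Q"
proof -
  let ?h = "\<lambda>(g, f). f / g"
  have fiber: "card {z \<in> S. ?h z = s} \<le> Q" if s: "s \<in> ?h ` S" for s
  proof -
    obtain g0 f0 where g0: "(g0, f0) \<in> S" "s = f0 / g0" using s by auto
    note G0 = gS[OF g0(1)]
    obtain a b where ab: "a \<in> A" "b \<in> A" "f0 * a + g0 * b = 1" using G0 unfolding coprime_in_def by blast
    have inj: "inj_on (\<lambda>(g, f). g / g0) {z \<in> S. ?h z = s}"
    proof (rule inj_onI)
      fix x y assume xy: "x \<in> {z \<in> S. ?h z = s}" "y \<in> {z \<in> S. ?h z = s}" "(\<lambda>(g, f). g / g0) x = (\<lambda>(g, f). g / g0) y"
      obtain g f g' f' where e: "x = (g, f)" "y = (g', f')" by (cases x, cases y)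
      have m: "(g, f) \<in> S" "f / g = s" "(g', f') \<in> S" "f' / g' = s" "g / g0 = g' / g0" using xy e by auto
      then have gg: "g = g'" using G0 by simp
      have "g \<noteq> 0" using gS m(1) by blast
      then have "f = s * g" "f' = s * g" using m gg by (auto simp: field_simps)
      then show "x = y" using e gg by simp
    qed
    have sub: "(\<lambda>(g, f). g / g0) ` {z \<in> S. ?h z = s} \<subseteq> AD 0"
    proof
      fix u assume "u \<in> (\<lambda>(g, f). g / g0) ` {z \<in> S. ?h z = s}"
      then obtain g f where gf: "(g, f) \<in> S" "f / g = s" "u = g / g0" by auto
      note G = gS[OF gf(1)]
      have eq: "f * g0 = f0 * g" using gf(2) g0(2) G G0 by (simp add: field_simps)
      have "g = g * (f0 * a + g0 * b)" using ab(3) by simp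
      also have "\<dots> = (f0 * g) * a + g * g0 * b" by (simp add: algebra_simps)
      also have "\<dots> = g0 * (f * a + g * b)" unfolding eq[symmetric] by (simp add: algebra_simps)
      finally have "u = f * a + g * b" using gf(3) G0 by (metis nonzero_mult_div_cancel_left)
      then have "u \<in> A" using G ab A_mult A_add by simp
      moreover have "\<nu> u = 0" using gf(3) G G0 val_divide[of g g0] by simp
      ultimately show "u \<in> AD 0" by (simp add: D_def)
    qed
    have "card {z \<in> S. ?h z = s} \<le> card (AD 0)" by (rule card_inj_on_le[OF inj sub AD_finite])
    also have "\<dots> \<le> Q" using AD_upper[of 0] by simp
    finally show ?thesis .
  qed
  have "S = (\<Union>s\<in>?h ` S. {z \<in> S. ?h z = s})" by auto
  then have "card S \<le> (\<Sum>s\<in>?h ` S. card {z \<in> S. ?h z = s})"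
    using card_UN_le[of "?h ` S" "\<lambda>s. {z \<in> S. ?h z = s}"] S by simp
  also have "\<dots> \<le> (\<Sum>s\<in>?h ` S. Q)" by (intro sum_mono fiber)
  finally show ?thesis by simp
qed

text \<open>Among the pairs \<open>(f, g)\<close> with \<open>g \<equiv> 1\<close> modulo an element \<open>m\<close> that lies in all maximal ideals
  of small norm, those sharing a maximal ideal are a minority: such an ideal has large norm, and
  the number of ideals of norm about \<open>Q\<^sup>i\<close> is \<open>O(Q\<^sup>i)\<close>.\<close>

lemma noncoprime_pairs_card:
  fixes i0 jg jf k :: nat
  assumes m: "m \<in> A" "m \<noteq> 0"
    and ann: "\<And>p. maximal_in p \<Longrightarrow> finite (residue_classes p) \<Longrightarrow> nrm p \<le> Q ^ i0 \<Longrightarrow> m \<in> p"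
    and i0: "1 \<le> i0"
    and G0: "\<And>a. a \<in> G0 \<Longrightarrow> a \<in> A \<and> a - y \<in> D (- int jg) \<and> 1 + m * a \<noteq> 0 \<and> \<nu> (1 + m * a) = - int k"
    and G: "G = (\<lambda>a. 1 + m * a) ` G0"
    and F: "\<And>g. F g = {f \<in> A. f - g * x \<in> D (- int jf)}"
  shows "real (card {(g, f). g \<in> G \<and> f \<in> F g \<and> \<not> coprime_in f g})
    \<le> real ((2 * N + 3) * Q ^ (N + 2)) *
      (2 * (real Q ^ (jg + N + 1) * real Q ^ (jf + N + 1)) / real Q ^ i0
       + real (k + N + 2) * (real Q ^ (jg + N + 1) + real Q ^ (jf + N + 1)) + 2 * real Q ^ (k + N + 1))"
proof -
  let ?q = "real Q"
  let ?X = "?q ^ (jg + N + 1)" and ?Y = "?q ^ (jf + N + 1)" and ?K = "k + N + 1"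
  let ?C = "real ((2 * N + 3) * Q ^ (N + 2))"
  let ?Bad = "{(g, f). g \<in> G \<and> f \<in> F g \<and> \<not> coprime_in f g}"
  define BP where "BP p = (SIGMA g:G \<inter> p. F g \<inter> p)" for p
  have GA: "g \<in> A \<and> g \<noteq> 0 \<and> \<nu> g = - int k" if "g \<in> G" for g
    using that G0 m A_add A_mult A_one unfolding G by auto
  \<comment> \<open>\<open>g\<close> is 1 modulo \<open>m\<close>, so an ideal containing both would
    contain 1.\<close>
  have mp: "m \<notin> p" if p: "maximal_in p" and g: "g \<in> G" "g \<in> p" for p g
  proof
    assume "m \<in> p"
    obtain a where a: "a \<in> G0" "g = 1 + m * a" using g(1) unfolding G by blast
    note P = maximal_inD[OF p]
    have "a * m \<in> p" using ideal_inD(4)[OF P(1) _ \<open>m \<in> p\<close>] G0[OF a(1)] by blast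
    then have "g - a * m \<in> p" using ideal_inD(6)[OF P(1) g(2)] by blast
    then show False using P(2) a(2) by (simp add: mult.commute)
  qed
  have BPcard: "finite (BP p) \<and> real (card (BP p)) \<le> (?X / ?q ^ i + 1) * (?Y / ?q ^ i + 1)"
    if "p \<in> places i" for p i
  proof -
    have p: "maximal_in p" "Q ^ i \<le> nrm p" using that unfolding places_def by auto
    note P = maximal_inD[OF p(1)]
    have n0: "0 < nrm p" using p(2) Q_pos zero_less_power[of Q i] by linarith
    have le: "?q ^ j / real (nrm p) \<le> ?q ^ j / ?q ^ i" for j
    proof (rule divide_left_mono)
      show "?q ^ i \<le> real (nrm p)" using p(2) by (metis of_nat_le_iff of_nat_power)
    qed (use n0 Q_pos in auto)
    \<comment> \<open>\<open>p\<close> is prime and avoids \<open>m\<close>, so congruence of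
      denominators modulo \<open>p\<close> passes to the parameters \<open>a\<close>; this is the
      coset bound with \<open>c = m\<close>.\<close>
    have 1: "finite (G \<inter> p) \<and> real (card (G \<inter> p)) \<le> ?X / real (nrm p) + 1"
    proof -
      have "(g - g') / m \<in> p \<inter> D (- int jg)" if gg: "g \<in> G \<inter> p" "g' \<in> G \<inter> p" for g g'
      proof -
        obtain a a' where a: "a \<in> G0" "g = 1 + m * a" "a' \<in> G0" "g' = 1 + m * a'" using gg unfolding G by blast
        have e: "(g - g') / m = a - a'" using a m by (simp add: field_simps)
        have "a - a' \<in> D (- int jg)" using G0[OF a(1)] G0[OF a(3)] D_trans[of a y _ a'] D_diff_commute by blast
        moreover have "g - g' \<in> p" using ideal_inD(6)[OF P(1)] gg by blast
        then have "m * (a - a') \<in> p" using a by (simp add: algebra_simps)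
        then have "a - a' \<in> p"
          using maximal_prime[OF p(1) m(1) mp[OF p(1), of g]] gg G0[OF a(1)] G0[OF a(3)] A_diff by blast
        ultimately show ?thesis unfolding e by blast
      qed
      then show ?thesis using ideal_coset_upper[OF P(1) m(2) n0, of "G \<inter> p" jg] by blast
    qed
    have 2: "finite (F g \<inter> p) \<and> real (card (F g \<inter> p)) \<le> ?Y / real (nrm p) + 1" for g
    proof -
      have "(f - f') / 1 \<in> p \<inter> D (- int jf)" if ff: "f \<in> F g \<inter> p" "f' \<in> F g \<inter> p" for f f'
      proof -
        have "f - f' \<in> D (- int jf)" using ff D_trans[of f "g * x" _ f'] D_diff_commute unfolding F by blast
        moreover have "f - f' \<in> p" using ideal_inD(6)[OF P(1)] ff by blast
        ultimately show ?thesis by simp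
      qed
      then show ?thesis using ideal_coset_upper[OF P(1) one_neq_zero n0, of "F g \<inter> p" jf] by blast
    qed
    have fin: "finite (BP p)" unfolding BP_def using 1 2 by auto
    have "real (card (BP p)) = (\<Sum>g\<in>G \<inter> p. real (card (F g \<inter> p)))"
      unfolding BP_def using 1 2 by (subst card_SigmaI) auto
    also have "\<dots> \<le> (\<Sum>g\<in>G \<inter> p. ?Y / real (nrm p) + 1)" using 2 by (intro sum_mono) blast
    also have "\<dots> = real (card (G \<inter> p)) * (?Y / real (nrm p) + 1)" by simp
    also have "\<dots> \<le> (?X / ?q ^ i + 1) * (?Y / ?q ^ i + 1)"
      using 1 le[of "jg + N + 1"] le[of "jf + N + 1"] by (intro mult_mono) (auto intro!: add_nonneg_nonneg)
    finally show ?thesis using fin by blast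
  qed
  have sub: "?Bad \<subseteq> (\<Union>i\<in>{i0..?K}. \<Union>p\<in>places i. BP p)"
  proof
    fix z assume "z \<in> ?Bad"
    then obtain g f where z: "z = (g, f)" "g \<in> G" "f \<in> F g" "\<not> coprime_in f g" by blast
    have fA: "f \<in> A" using z(3) unfolding F by blast
    obtain p where p: "maximal_in p" "f \<in> p" "g \<in> p" using not_coprime_maximal[OF fA _ z(4)] GA[OF z(2)] by blast
    note P = maximal_inD[OF p(1)]
    have gD: "g \<in> D (- int k)" using GA[OF z(2)] by (simp add: D_def)
    \<comment> \<open>\<open>g\<close> has order \<open>- k\<close> and lies in \<open>p\<close>,
      which bounds the norm from above. With the lower bound supplied by \<open>m\<close>, only the
      levels from \<open>i0\<close> to \<open>k + N + 1\<close> occur.\<close>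
    have fin: "finite (residue_classes p)" and up: "nrm p \<le> Q ^ ?K"
      using residue_classes_finite[OF P(1) p(3) gD] nrm_upper[OF P(1) p(3) gD] GA[OF z(2)] by auto
    have lo: "Q ^ i0 < nrm p" using ann[OF p(1) fin] mp[OF p(1) z(2) p(3)] by (meson not_le)
    have "1 \<le> nrm p" using lo by simp
    then obtain i where i: "Q ^ i \<le> nrm p" "nrm p < Q ^ (i + 1)" using ex_power_ivl1[OF Q_ge_2] by blast
    have Q1: "1 < Q" using Q_ge_2 by simp
    have "Q ^ i \<le> Q ^ ?K" using i(1) up by (rule le_trans)
    then have "i \<le> ?K" by (rule power_le_imp_le_exp[OF Q1])
    moreover have "Q ^ i0 < Q ^ (i + 1)" using lo i(2) by (rule less_trans)
    then have "i0 < i + 1" by (rule power_less_imp_less_exp[OF Q1])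
    moreover have "p \<in> places i" unfolding places_def using p i by blast
    moreover have "z \<in> BP p" unfolding BP_def using z p by blast
    ultimately show "z \<in> (\<Union>i\<in>{i0..?K}. \<Union>p\<in>places i. BP p)" by (intro UN_I[of i] UN_I[of p]) auto
  qed
  have pf: "finite (places i)" "real (card (places i)) \<le> ?C * ?q ^ i" if "i \<in> {i0..?K}" for i
  proof -
    have i1: "1 \<le> i" using that i0 by simp
    show "finite (places i)" by (rule places_finite[OF i1])
    have "real (card (places i)) \<le> real ((2 * N + 3) * Q ^ (i + N + 2))" using places_card[OF i1] by (rule of_nat_mono)
    then show "real (card (places i)) \<le> ?C * ?q ^ i" by (simp add: power_add mult_ac)
  qed
  have fU: "finite (\<Union>p\<in>places i. BP p)" if "i \<in> {i0..?K}" for i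
    by (rule finite_UN_I[OF pf(1)[OF that]]) (use BPcard in blast)
  have cU: "real (card (\<Union>p\<in>places i. BP p)) \<le> ?C * (?q ^ i * ((?X / ?q ^ i + 1) * (?Y / ?q ^ i + 1)))"
    if i: "i \<in> {i0..?K}" for i
  proof -
    have "real (card (\<Union>p\<in>places i. BP p)) \<le> real (\<Sum>p\<in>places i. card (BP p))"
      by (rule of_nat_mono[OF card_UN_le[OF pf(1)[OF i]]])
    also have "\<dots> = (\<Sum>p\<in>places i. real (card (BP p)))" by simp
    also have "\<dots> \<le> (\<Sum>p\<in>places i. (?X / ?q ^ i + 1) * (?Y / ?q ^ i + 1))" using BPcard by (intro sum_mono) blast
    also have "\<dots> = real (card (places i)) * ((?X / ?q ^ i + 1) * (?Y / ?q ^ i + 1))" by simp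
    also have "\<dots> \<le> (?C * ?q ^ i) * ((?X / ?q ^ i + 1) * (?Y / ?q ^ i + 1))"
      by (rule mult_right_mono[OF pf(2)[OF i]]) (intro mult_nonneg_nonneg add_nonneg_nonneg divide_nonneg_nonneg, auto)
    finally show ?thesis by (simp only: mult.assoc)
  qed
  have "real (card ?Bad) \<le> real (card (\<Union>i\<in>{i0..?K}. \<Union>p\<in>places i. BP p))"
    by (rule of_nat_mono[OF card_mono[OF _ sub]]) (use fU in blast)
  also have "\<dots> \<le> real (\<Sum>i=i0..?K. card (\<Union>p\<in>places i. BP p))"
    by (rule of_nat_mono[OF card_UN_le]) simp
  also have "\<dots> = (\<Sum>i=i0..?K. real (card (\<Union>p\<in>places i. BP p)))" by simp
  also have "\<dots> \<le> (\<Sum>i=i0..?K. ?C * (?q ^ i * ((?X / ?q ^ i + 1) * (?Y / ?q ^ i + 1))))" by (intro sum_mono cU)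
  also have "\<dots> = ?C * (\<Sum>i=i0..?K. ?q ^ i * ((?X / ?q ^ i + 1) * (?Y / ?q ^ i + 1)))" by (simp only: sum_distrib_left)
  also have "\<dots> \<le> ?C * (2 * (?X * ?Y) / ?q ^ i0 + real (?K + 1) * (?X + ?Y) + 2 * ?q ^ ?K)"
    by (intro mult_left_mono sum_places_bound) (use Q_ge_2 in auto)
  finally show ?thesis by (simp add: add.assoc)
qed

text \<open>Uniformity is the point: \<open>c\<close> depends neither on the ball nor on
  \<open>k\<close>. Only denominators equal to 1 modulo \<open>m\<close> are counted; this loses a
  factor \<open>Q ^ \<mu>\<close> but disposes of all ideals of small norm.\<close>

lemma coprime_fractions_count:
  obtains c :: real where "0 < c"
    "\<And>x r k0. \<exists>k\<ge>k0. \<exists>S. finite S \<and> c * real Q ^ (2 * k) \<le> real (card S) * real Q ^ r \<and>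
       (\<forall>z\<in>S. z - x \<in> D (int r) \<and> (\<exists>f\<in>A. \<exists>g\<in>A. g \<noteq> 0 \<and> \<nu> g = - int k \<and> coprime_in f g \<and> z = f / g))"
proof -
  define q where "q = real Q"
  have q2: "2 \<le> q" using Q_ge_2 unfolding q_def by simp
  have qpos: "0 < q ^ i" for i using q2 by simp
  define C where "C = real ((2 * N + 3) * Q ^ (N + 2))"
  have C0: "0 < C" unfolding C_def using Q_pos by simp
  \<comment> \<open>Large enough to make the first term of the sieve at most a quarter of all pairs;
    \<open>q ^ (4 * N + 2)\<close> is the gap between the upper and lower counts of pairs.\<close>
  obtain i0 where i0: "i0 \<ge> 1" "(8 * C * q ^ (4 * N + 2)) * real (i0 + 1) \<le> q ^ i0"
    using linear_le_power[OF q2] by blast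
  have "8 * C * q ^ (4 * N + 2) * 1 \<le> (8 * C * q ^ (4 * N + 2)) * real (i0 + 1)"
    by (rule mult_left_mono) (use C0 qpos[of "4 * N + 2"] in \<open>simp_all del: power_Suc power_add\<close>)
  with i0(2) have i0q: "8 * C * q ^ (4 * N + 2) \<le> q ^ i0" by linarith
  obtain m where m: "m \<in> A" "m \<noteq> 0"
    "\<And>p. maximal_in p \<Longrightarrow> finite (residue_classes p) \<Longrightarrow> nrm p \<le> Q ^ i0 \<Longrightarrow> m \<in> p"
    using small_places_annihilator[of "Q ^ i0"] by blast
  define \<mu> where "\<mu> = nat (- \<nu> m)"
  have \<mu>: "\<nu> m = - int \<mu>" unfolding \<mu>_def using A_discrete[OF m(1,2)] by simp
  \<comment> \<open>The exponent collects \<open>1 + \<mu> + 2 * N\<close> from the number of pairs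
    and one more from the fibres of \<open>f / g\<close>; the 2 is the loss to pairs that are not
    coprime.\<close>
  define c where "c = 1 / (2 * q ^ (2 + \<mu> + 2 * N))"
  show thesis
  proof (rule that[of c])
    show "0 < c" unfolding c_def by (intro divide_pos_pos mult_pos_pos qpos) simp_all
    fix x :: 'l and r k0 :: nat
    \<comment> \<open>Chosen to make the remaining terms of the sieve at most another
      quarter.\<close>
    define C3 where "C3 = 4 * C * real (2 * N + 6) * q ^ (N + 1 + (1 + \<mu> + r + 2 * N))"
    obtain k where k: "k \<ge> k0 + N + \<mu> + 1 + r" "C3 * real (k + 1) \<le> q ^ k"
      using linear_le_power[OF q2] by blast
    \<comment> \<open>\<open>jg\<close> forces \<open>m * (a - y)\<close> to have order above
      \<open>- k\<close>, so that \<open>1 + m * a\<close> has the order of \<open>xk\<close>.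
      \<open>jf\<close> turns \<open>f - g * x\<close> in \<open>D (- jf)\<close> into
      \<open>f / g - x\<close> in \<open>D r\<close>.\<close>
    define jg where "jg = k - 1 - \<mu>"
    define jf where "jf = k - r"
    have jg: "N \<le> jg" "jg + \<mu> + 1 = k" and jf: "N \<le> jf" "jf + r = k" unfolding jg_def jf_def using k by auto
    obtain xk where xk: "xk \<noteq> 0" "\<nu> xk = - int k" using val_surj by blast
    define y where "y = (xk - 1) / m"
    define G0 where "G0 = {a \<in> A. a - y \<in> D (- int jg)}"
    define G where "G = (\<lambda>a. 1 + m * a) ` G0"
    define F where "F g = {f \<in> A. f - g * x \<in> D (- int jf)}" for g
    have G0: "a \<in> A \<and> a - y \<in> D (- int jg) \<and> 1 + m * a \<noteq> 0 \<and> \<nu> (1 + m * a) = - int k" if "a \<in> G0" for a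
    proof -
      have a: "a \<in> A" "a - y \<in> D (- int jg)" using that unfolding G0_def by auto
      have "(1 + m * a) - xk = m * (a - y)" unfolding y_def using m(2) by (simp add: field_simps)
      moreover have "m * (a - y) \<in> D (\<nu> xk + 1)"
      proof -
        have "- int jg = \<nu> xk + 1 - \<nu> m" using xk(2) \<mu> jg by simp
        then show ?thesis using a(2) D_scale[OF m(2), of "a - y" "\<nu> xk + 1"] by simp
      qed
      ultimately have "xk - (1 + m * a) \<in> D (\<nu> xk + 1)" using D_diff_commute by metis
      from val_eq_of_diff[OF xk(1) this] show ?thesis using a xk(2) by simp
    qed
    have finG0: "finite G0" and cG0: "Q ^ (jg - N) \<le> card G0"
      unfolding G0_def using A_ball_lower[OF jg(1)] by auto
    have "inj_on (\<lambda>a. 1 + m * a) G0" using m(2) by (auto simp: inj_on_def)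
    then have cG: "card G = card G0" unfolding G_def by (rule card_image)
    have finG: "finite G" unfolding G_def using finG0 by simp
    have finF: "finite (F g)" and cF: "Q ^ (jf - N) \<le> card (F g)" for g
      unfolding F_def using A_ball_lower[OF jf(1)] by auto
    define P where "P = q ^ (jg - N) * q ^ (jf - N)"
    let ?Pairs = "SIGMA g:G. F g"
    have "Q ^ (jg - N) * Q ^ (jf - N) \<le> card G * Q ^ (jf - N)" using cG0 cG by simp
    also have "\<dots> \<le> (\<Sum>g\<in>G. card (F g))" using sum_bounded_below[of G "Q ^ (jf - N)" "\<lambda>g. card (F g)"] cF by simp
    also have "\<dots> = card ?Pairs" using finG finF by simp
    finally have "real (Q ^ (jg - N) * Q ^ (jf - N)) \<le> real (card ?Pairs)" by (rule of_nat_mono)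
    then have cP: "P \<le> real (card ?Pairs)" unfolding P_def q_def by simp
    let ?Bad = "{(g, f). g \<in> G \<and> f \<in> F g \<and> \<not> coprime_in f g}"
    have "real (card ?Bad) \<le> C * (2 * (q ^ (jg + N + 1) * q ^ (jf + N + 1)) / q ^ i0
       + real (k + N + 2) * (q ^ (jg + N + 1) + q ^ (jf + N + 1)) + 2 * q ^ (k + N + 1))"
      unfolding C_def q_def
      by (rule noncoprime_pairs_card[OF m i0(1), where ?G0.0 = G0 and y = y and x = x]) (use G0 G_def F_def in blast)+
    moreover have "C * (2 * (q ^ (jg + N + 1) * q ^ (jf + N + 1)) / q ^ i0) \<le> P / 4"
    proof -
      have "q ^ (jg + N + 1) * q ^ (jf + N + 1) = P * q ^ (4 * N + 2)"
      proof -
        have e: "jg + N + 1 = (jg - N) + (2 * N + 1)" "jf + N + 1 = (jf - N) + (2 * N + 1)" "4 * N + 2 = (2 * N + 1) + (2 * N + 1)"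
          using jg jf by auto
        show ?thesis unfolding P_def e power_add by (simp only: mult_ac)
      qed
      then have "C * (2 * (q ^ (jg + N + 1) * q ^ (jf + N + 1)) / q ^ i0) = P * (8 * C * q ^ (4 * N + 2)) / (4 * q ^ i0)"
        by (simp add: field_simps)
      also have "\<dots> \<le> P * q ^ i0 / (4 * q ^ i0)"
        by (rule divide_right_mono[OF mult_left_mono[OF i0q]]) (use q2 in \<open>auto simp: P_def\<close>)
      also have "\<dots> = P / 4" using q2 by simp
      finally show ?thesis .
    qed
    moreover have P2: "P * q ^ (1 + \<mu> + r + 2 * N) = q ^ (2 * k)"
    proof -
      have "(jg - N) + (jf - N) + (1 + \<mu> + r + 2 * N) = 2 * k" using jg jf by simp
      then show ?thesis unfolding P_def by (metis power_add)
    qed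
    moreover have "C * (real (k + N + 2) * (q ^ (jg + N + 1) + q ^ (jf + N + 1)) + 2 * q ^ (k + N + 1)) \<le> P / 4"
    proof -
      let ?Z = "q ^ (k + N + 1)" and ?W = "q ^ (1 + \<mu> + r + 2 * N)"
      have "q ^ (jg + N + 1) \<le> ?Z" "q ^ (jf + N + 1) \<le> ?Z" using q2 jg jf by (auto intro!: power_increasing)
      then have "real (k + N + 2) * (q ^ (jg + N + 1) + q ^ (jf + N + 1)) \<le> real (k + N + 2) * (2 * ?Z)"
        by (intro mult_left_mono) auto
      then have "real (k + N + 2) * (q ^ (jg + N + 1) + q ^ (jf + N + 1)) + 2 * ?Z \<le> real (2 * (k + N + 2) + 2) * ?Z"
        by (simp add: algebra_simps)
      also have "\<dots> \<le> real ((2 * N + 6) * (k + 1)) * ?Z"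
        by (intro mult_right_mono of_nat_mono) (use qpos[of "k + N + 1"] in \<open>auto simp: algebra_simps\<close>)
      finally have "C * (real (k + N + 2) * (q ^ (jg + N + 1) + q ^ (jf + N + 1)) + 2 * ?Z)
          \<le> C * (real ((2 * N + 6) * (k + 1)) * ?Z)" using C0 by (intro mult_left_mono) auto
      also have "\<dots> = (C3 * real (k + 1)) * q ^ k / (4 * ?W)"
      proof (rule nonzero_eq_divide_eq[THEN iffD2])
        show "4 * ?W \<noteq> 0" using q2 by simp
        show "C * (real ((2 * N + 6) * (k + 1)) * ?Z) * (4 * ?W) = (C3 * real (k + 1)) * q ^ k"
          unfolding C3_def by (simp only: of_nat_mult power_add mult_ac)
      qed
      also have "\<dots> \<le> q ^ k * q ^ k / (4 * ?W)"
        by (rule divide_right_mono[OF mult_right_mono[OF k(2)]]) (use q2 in auto)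
      also have "q ^ k * q ^ k = P * ?W" unfolding P2 by (simp add: mult_2 power_add)
      also have "P * ?W / (4 * ?W) = P / 4" using q2 by simp
      finally show ?thesis .
    qed
    ultimately have bad: "real (card ?Bad) \<le> P / 2" by (simp add: distrib_left)
    define Good where "Good = {(g, f). g \<in> G \<and> f \<in> F g \<and> coprime_in f g}"
    have PG: "?Pairs = Good \<union> ?Bad" unfolding Good_def by auto
    have finP: "finite ?Pairs" using finG finF by simp
    then have finGood: "finite Good" unfolding PG by simp
    have "card ?Pairs \<le> card Good + card ?Bad" unfolding PG by (rule card_Un_le)
    then have good: "P / 2 \<le> real (card Good)" using bad cP by linarith
    define S where "S = (\<lambda>(g, f). f / g) ` Good"
    have Gg: "g \<in> A \<and> g \<noteq> 0 \<and> \<nu> g = - int k" if "g \<in> G" for g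
      using that G0 m(1) A_add A_mult A_one unfolding G_def by auto
    have GoodD: "g \<in> A \<and> f \<in> A \<and> g \<noteq> 0 \<and> \<nu> g = - int k \<and> coprime_in f g \<and> f \<in> F g" if "(g, f) \<in> Good" for g f
      using that Gg unfolding Good_def F_def by auto
    have "card Good \<le> card S * Q" unfolding S_def
      by (rule coprime_fiber_card[OF finGood]) (use GoodD in blast)
    then have "real (card Good) \<le> real (card S) * q" unfolding q_def by (metis of_nat_le_iff of_nat_mult)
    then have "P / 2 \<le> real (card S) * q" using good by simp
    then have "P / 2 * q ^ (1 + \<mu> + r + 2 * N) \<le> real (card S) * q * q ^ (1 + \<mu> + r + 2 * N)"
      by (rule mult_right_mono) (use q2 in auto)
    then have "q ^ (2 * k) / 2 \<le> real (card S) * q ^ r * q ^ (2 + \<mu> + 2 * N)"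
      unfolding P2[symmetric] by (simp add: power_add power2_eq_square mult_ac)
    then have "c * q ^ (2 * k) \<le> real (card S) * q ^ r"
      unfolding c_def using qpos[of "2 + \<mu> + 2 * N"] by (simp add: field_simps)
    moreover have "z - x \<in> D (int r) \<and> (\<exists>f\<in>A. \<exists>g\<in>A. g \<noteq> 0 \<and> \<nu> g = - int k \<and> coprime_in f g \<and> z = f / g)"
      if z: "z \<in> S" for z
    proof -
      obtain g f where gf: "(g, f) \<in> Good" "z = f / g" using z unfolding S_def by auto
      note GF = GoodD[OF gf(1)]
      have "z - x = (f - g * x) / g" using gf(2) GF by (simp add: field_simps)
      moreover have "f - g * x \<in> D (int r + \<nu> g)" using GF jf(2) unfolding F_def by auto
      ultimately have "z - x \<in> D (int r)" using D_divide[of g "f - g * x" "int r"] GF by simp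
      then show ?thesis using GF gf(2) by blast
    qed
    moreover have "finite S" unfolding S_def using finGood by simp
    ultimately show "\<exists>k\<ge>k0. \<exists>S. finite S \<and> c * real Q ^ (2 * k) \<le> real (card S) * real Q ^ r \<and>
       (\<forall>z\<in>S. z - x \<in> D (int r) \<and> (\<exists>f\<in>A. \<exists>g\<in>A. g \<noteq> 0 \<and> \<nu> g = - int k \<and> coprime_in f g \<and> z = f / g))"
      unfolding q_def using k(1) by (intro exI[of _ k] conjI exI[of _ S]) auto
  qed
qed

end

section \<open>Approximation almost everywhere\<close>

context valued_field
begin

text \<open>The base \<open>b\<close> will be the number of constants, while \<open>Q\<close> is the
  size of the residue field; they differ at a place of degree above 1. The base only rescales the
  metric, so comparisons are translated into the sets \<open>D j\<close>.\<close>

context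
  fixes b :: nat
  assumes b: "2 \<le> b"
begin

lemma absval_le_iff: "absval b \<nu> x \<le> real b powi (- j) \<longleftrightarrow> x \<in> D j"
proof (cases "x = 0")
  case False
  have "real b powi (- \<nu> x) \<le> real b powi (- j) \<longleftrightarrow> j \<le> \<nu> x"
  proof
    show "j \<le> \<nu> x" if "real b powi (- \<nu> x) \<le> real b powi (- j)"
    proof (rule ccontr)
      assume "\<not> j \<le> \<nu> x"
      then have "real b powi (- j) < real b powi (- \<nu> x)" using b by (intro power_int_strict_increasing) auto
      then show False using that by simp
    qed
    show "real b powi (- \<nu> x) \<le> real b powi (- j)" if "j \<le> \<nu> x"
      using that b by (intro power_int_increasing) auto
  qed
  then show ?thesis using False by (simp add: absval_def D_def)
qed (use b in \<open>simp add: absval_def\<close>)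

text \<open>Orders are integers, so a strict bound raises the index by one; this is the source of
  the \<open>+ 1\<close> in the radius used for \<open>E\<close>.\<close>

lemma absval_less_iff: "absval b \<nu> x < real b powi (- j) \<longleftrightarrow> x \<in> D (j + 1)"
proof (cases "x = 0")
  case False
  have "real b powi (- \<nu> x) < real b powi (- j) \<longleftrightarrow> j < \<nu> x"
  proof
    show "j < \<nu> x" if "real b powi (- \<nu> x) < real b powi (- j)"
    proof (rule ccontr)
      assume "\<not> j < \<nu> x"
      then have "real b powi (- j) \<le> real b powi (- \<nu> x)" using b by (intro power_int_increasing) auto
      then show False using that by simp
    qed
    show "real b powi (- \<nu> x) < real b powi (- j)" if "j < \<nu> x"
      using that b by (intro power_int_strict_increasing) auto
  qed
  then show ?thesis using False by (simp add: absval_def D_def add1_zle_eq)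
qed (use b in \<open>simp add: absval_def\<close>)

lemma absval_nonneg: "0 \<le> absval b \<nu> x"
  by (simp add: absval_def)

lemma absval_minus: "absval b \<nu> (- x) = absval b \<nu> x"
  by (simp add: absval_def)

lemma absval_eq: "x \<noteq> 0 \<Longrightarrow> absval b \<nu> x = real b powi (- \<nu> x)"
  by (simp add: absval_def)

lemma powi_less: "0 < e \<Longrightarrow> \<exists>j. real b powi (- int j) < e"
proof -
  assume e: "0 < e"
  have "inverse (real b) < 1" using b by (simp add: inverse_less_1_iff)
  then obtain j where "inverse (real b) ^ j < e" using real_arch_pow_inv[OF e] by blast
  then show ?thesis by (auto simp: power_int_minus power_inverse)
qed

lemma absval_add: "absval b \<nu> (x + y) \<le> max (absval b \<nu> x) (absval b \<nu> y)"
proof -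
  have *: "absval b \<nu> (x + y) \<le> absval b \<nu> x" if "absval b \<nu> y \<le> absval b \<nu> x" for x y
  proof (cases "x = 0")
    case True
    then show ?thesis using that by simp
  next
    case False
    then have "x \<in> D (\<nu> x)" "y \<in> D (\<nu> x)" using that by (auto simp: D_def absval_le_iff absval_eq)
    then have "x + y \<in> D (\<nu> x)" by (rule D_add)
    then show ?thesis using False by (simp add: absval_le_iff[symmetric] absval_eq)
  qed
  show ?thesis using *[of x y] *[of y x] by (cases "absval b \<nu> y \<le> absval b \<nu> x") (auto simp: add.commute)
qed

lemma Metric_space_absval: "Metric_space UNIV (\<lambda>x y. absval b \<nu> (x - y))"
proof
  fix x y z :: 'l
  show "0 \<le> absval b \<nu> (x - y)" by (rule absval_nonneg)
  show "absval b \<nu> (x - y) = absval b \<nu> (y - x)" using absval_minus[of "x - y"] by simp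
  show "absval b \<nu> (x - y) = 0 \<longleftrightarrow> x = y" using b by (auto simp: absval_def)
  have "absval b \<nu> (x - z) \<le> max (absval b \<nu> (x - y)) (absval b \<nu> (y - z))"
    using absval_add[of "x - y" "y - z"] by simp
  then show "absval b \<nu> (x - z) \<le> absval b \<nu> (x - y) + absval b \<nu> (y - z)"
    using absval_nonneg[of "x - y"] absval_nonneg[of "y - z"] by linarith
qed

interpretation ms: Metric_space UNIV "\<lambda>x y. absval b \<nu> (x - y)"
  by (rule Metric_space_absval)

lemma mball_absval: "ms.mball x (real b powi (- j)) = {y. y - x \<in> D (j + 1)}"
  unfolding ms.mball_def using absval_less_iff[of "x - _" j] D_diff_commute by auto

lemma small_mball: "0 < e \<Longrightarrow> \<exists>j. {y. y - x \<in> D (int j)} \<subseteq> ms.mball x e"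
proof -
  assume "0 < e"
  then obtain j where j: "real b powi (- int j) < e" using powi_less by blast
  have "{y. y - x \<in> D (int j)} \<subseteq> ms.mball x e"
  proof
    fix y assume "y \<in> {y. y - x \<in> D (int j)}"
    then have "x - y \<in> D (int j)" using D_diff_commute by blast
    then have "absval b \<nu> (x - y) \<le> real b powi (- int j)" by (simp only: absval_le_iff)
    then show "y \<in> ms.mball x e" using j by simp
  qed
  then show ?thesis by blast
qed

lemma openin_valuation_topology:
  "openin (valuation_topology (absval b \<nu>)) U \<longleftrightarrow> (\<forall>x\<in>U. \<exists>j. \<forall>y. y - x \<in> D j \<longrightarrow> y \<in> U)"
proof
  assume o: "openin (valuation_topology (absval b \<nu>)) U"
  show "\<forall>x\<in>U. \<exists>j. \<forall>y. y - x \<in> D j \<longrightarrow> y \<in> U"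
  proof
    fix x assume "x \<in> U"
    then obtain e where e: "e > 0" "ms.mball x e \<subseteq> U"
      using o unfolding valuation_topology_def ms.openin_mtopology by blast
    then show "\<exists>j. \<forall>y. y - x \<in> D j \<longrightarrow> y \<in> U" using small_mball[OF e(1), of x] by blast
  qed
next
  assume r: "\<forall>x\<in>U. \<exists>j. \<forall>y. y - x \<in> D j \<longrightarrow> y \<in> U"
  show "openin (valuation_topology (absval b \<nu>)) U"
    unfolding valuation_topology_def ms.openin_mtopology
  proof (intro conjI allI impI)
    fix x assume "x \<in> U"
    then obtain j where j: "\<forall>y. y - x \<in> D j \<longrightarrow> y \<in> U" using r by blast
    have "ms.mball x (real b powi (- (j - 1))) \<subseteq> U" unfolding mball_absval using j by auto
    moreover have "0 < real b powi (- (j - 1))" using b by (intro zero_less_power_int) simp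
    ultimately show "\<exists>r>0. ms.mball x r \<subseteq> U" by blast
  qed simp
qed

lemma limitin_valuation_topology:
  "limitin (valuation_topology (absval b \<nu>)) f l sequentially \<longleftrightarrow>
    (\<lambda>k. absval b \<nu> (f k - l)) \<longlonglongrightarrow> 0"
  unfolding valuation_topology_def ms.limitin_metric tendsto_iff
  by (simp add: absval_nonneg)

lemma closure_of_valuation_topology:
  assumes "valuation_topology (absval b \<nu>) closure_of S = UNIV"
  shows "\<exists>y\<in>S. x - y \<in> D j"
proof -
  have "x \<in> valuation_topology (absval b \<nu>) closure_of S" using assms by simp
  moreover have "0 < real b powi (- (j - 1))" using b by (intro zero_less_power_int) simp
  ultimately have "\<exists>y\<in>S. y \<in> ms.mball x (real b powi (- (j - 1)))"
    unfolding valuation_topology_def ms.metric_closure_of by blast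
  then show ?thesis unfolding mball_absval using D_diff_commute by auto
qed

text \<open>Total boundedness comes from the finitely many classes of \<open>D 0\<close> modulo each
  \<open>D j\<close>, and \<open>D 0\<close> is closed because its cosets are open. Compactness is
  what makes the Haar measure of balls finite.\<close>

lemma compactin_D:
  assumes comp: "Metric_space.mcomplete UNIV (\<lambda>x y. absval b \<nu> (x - y))"
    and S: "\<And>j. \<exists>S\<subseteq>D 0. finite S \<and> (\<forall>x\<in>D 0. \<exists>s\<in>S. x - s \<in> D (int j))"
  shows "compactin (valuation_topology (absval b \<nu>)) (D 0)"
proof -
  have "ms.mtotally_bounded (D 0)" unfolding ms.mtotally_bounded_def
  proof (intro allI impI)
    fix e :: real assume e: "0 < e"
    obtain j where j: "real b powi (- int j) < e" using powi_less[OF e] by blast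
    obtain S where S: "S \<subseteq> D 0" "finite S" "\<forall>x\<in>D 0. \<exists>s\<in>S. x - s \<in> D (int j)" using S by blast
    have "D 0 \<subseteq> (\<Union>x\<in>S. ms.mball x e)"
    proof
      fix x assume "x \<in> D 0"
      then obtain s where s: "s \<in> S" "x - s \<in> D (int j)" using S(3) by blast
      then have "absval b \<nu> (s - x) \<le> real b powi (- int j)" using absval_le_iff D_diff_commute by blast
      then show "x \<in> (\<Union>x\<in>S. ms.mball x e)" using s(1) j by (intro UN_I[of s]) auto
    qed
    then show "\<exists>K. finite K \<and> K \<subseteq> D 0 \<and> D 0 \<subseteq> (\<Union>x\<in>K. ms.mball x e)" using S by blast
  qed
  then have "compactin ms.mtopology (ms.mtopology closure_of D 0)"
    using ms.mtotally_bounded_eq_compact_closure_of[OF comp] by blast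
  moreover have "openin ms.mtopology (- D 0)"
    unfolding openin_valuation_topology[unfolded valuation_topology_def]
  proof
    fix x assume "x \<in> - D 0"
    then have "\<forall>y. y - x \<in> D 0 \<longrightarrow> y \<in> - D 0" using D_diff[of y 0 "y - x" for y] by auto
    then show "\<exists>j. \<forall>y. y - x \<in> D j \<longrightarrow> y \<in> - D 0" by blast
  qed
  then have "closedin ms.mtopology (D 0)" unfolding closedin_def by (simp add: Compl_eq_Diff_UNIV)
  then have "ms.mtopology closure_of D 0 = D 0" by (simp add: closure_of_closedin)
  ultimately show ?thesis unfolding valuation_topology_def by simp
qed

end

end

section \<open>Haar measure of balls and of the approximation discs\<close>

locale haar_discrete_cocompact_ring = discrete_cocompact_ring \<nu> Q A N
  for \<nu> :: "'l::field \<Rightarrow> int" and Q A N +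
  fixes b :: nat and \<mu> :: "'l measure"
  assumes b: "2 \<le> b"
    and complete: "Metric_space.mcomplete UNIV (\<lambda>x y. absval b \<nu> (x - y))"
    and haar: "haar_measure (valuation_topology (absval b \<nu>)) \<mu>"
begin

abbreviation Bl :: "'l \<Rightarrow> nat \<Rightarrow> 'l set" where
  "Bl x r \<equiv> {y. y - x \<in> D (int r)}"

lemma haarD:
  shows "space \<mu> = UNIV" "sets \<mu> = sigma_sets UNIV {U. openin (valuation_topology (absval b \<nu>)) U}"
    "B \<in> sets \<mu> \<Longrightarrow> emeasure \<mu> ((+) a ` B) = emeasure \<mu> B"
    "compactin (valuation_topology (absval b \<nu>)) C \<Longrightarrow> emeasure \<mu> C < \<infinity>"
    "openin (valuation_topology (absval b \<nu>)) U \<Longrightarrow> U \<noteq> {} \<Longrightarrow> 0 < emeasure \<mu> U"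
  using haar unfolding haar_measure_def by simp_all

lemma open_sets: "(\<And>x. x \<in> U \<Longrightarrow> \<exists>j. \<forall>y. y - x \<in> D j \<longrightarrow> y \<in> U) \<Longrightarrow> U \<in> sets \<mu>"
proof -
  assume U: "\<And>x. x \<in> U \<Longrightarrow> \<exists>j. \<forall>y. y - x \<in> D j \<longrightarrow> y \<in> U"
  have "openin (valuation_topology (absval b \<nu>)) U"
    unfolding openin_valuation_topology[OF b] using U by blast
  then show ?thesis unfolding haarD(2) by (auto intro: sigma_sets.Basic)
qed

lemma Bl_subset: "y \<in> Bl x r \<Longrightarrow> Bl y r \<subseteq> Bl x r"
  using D_trans by blast

lemma Bl_sets [simp]: "Bl x r \<in> sets \<mu>"
  by (rule open_sets) (use Bl_subset in blast)

lemma emeasure_Bl_translate: "emeasure \<mu> (Bl x r) = emeasure \<mu> (Bl 0 r)"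
proof -
  have "(+) x ` Bl 0 r = Bl x r"
  proof (intro equalityI subsetI)
    fix y assume "y \<in> Bl x r"
    then show "y \<in> (+) x ` Bl 0 r" by (intro image_eqI[of _ _ "y - x"]) simp_all
  qed auto
  then show ?thesis using haarD(3)[OF Bl_sets[of 0 r], of x] by (simp only:)
qed

lemma emeasure_Bl_finite: "emeasure \<mu> (Bl x r) \<noteq> \<infinity>"
proof -
  have "compactin (valuation_topology (absval b \<nu>)) (D 0)"
  proof (rule compactin_D[OF b complete])
    fix j
    obtain S where "finite S" "S \<subseteq> D 0" "\<And>x. x \<in> D 0 \<Longrightarrow> \<exists>s\<in>S. x - s \<in> D (0 + int j)"
      by (rule D_representatives[of 0 j]) blast
    then show "\<exists>S\<subseteq>D 0. finite S \<and> (\<forall>x\<in>D 0. \<exists>s\<in>S. x - s \<in> D (int j))" by auto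
  qed
  then have f: "emeasure \<mu> (D 0) < \<infinity>" by (rule haarD(4))
  have "D 0 = Bl 0 0" by simp
  then have D0: "D 0 \<in> sets \<mu>" using Bl_sets by metis
  have "Bl 0 r \<subseteq> D 0" using D_mono[of 0 "int r"] by auto
  then have "emeasure \<mu> (Bl 0 r) \<le> emeasure \<mu> (D 0)" using D0 by (rule emeasure_mono)
  then show ?thesis using f emeasure_Bl_translate[of x r] by auto
qed

lemma Bl_Int_fmeasurable:
  assumes X: "X \<in> sets \<mu>"
  shows "Bl x r \<inter> X \<in> fmeasurable \<mu>"
proof -
  have "Bl x r \<in> fmeasurable \<mu>"
    by (rule fmeasurableI[OF Bl_sets]) (use emeasure_Bl_finite[of x r] in \<open>simp add: top.not_eq_extremum\<close>)
  then show ?thesis by (rule fmeasurableI2[OF _ Int_lower1 sets.Int[OF Bl_sets X]])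
qed

definition M0 :: real where "M0 = measure \<mu> (D 0)"

lemma M0_pos: "0 < M0"
proof -
  have "openin (valuation_topology (absval b \<nu>)) (D 0)"
    unfolding openin_valuation_topology[OF b] 
  proof
    fix x assume "x \<in> D 0"
    then have "\<forall>y. y - x \<in> D 0 \<longrightarrow> y \<in> D 0" using D_add[of "y - x" 0 x for y] by auto
    then show "\<exists>j. \<forall>y. y - x \<in> D j \<longrightarrow> y \<in> D 0" ..
  qed
  then have "0 < emeasure \<mu> (D 0)" by (rule haarD(5)) (use D_zero in blast)
  moreover have "emeasure \<mu> (D 0) \<noteq> \<infinity>" using emeasure_Bl_finite[of 0 0] by simp
  ultimately show ?thesis unfolding M0_def by (simp add: emeasure_eq_ennreal_measure)
qed

lemma Bl_disjoint: "x - y \<notin> D (int r) \<Longrightarrow> Bl x r \<inter> Bl y r = {}"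
  using D_trans D_diff_commute by blast

lemma measure_Un_Bl:
  assumes "finite S" "\<And>s s'. s \<in> S \<Longrightarrow> s' \<in> S \<Longrightarrow> s - s' \<in> D (int r) \<Longrightarrow> s = s'"
    "\<And>s. s \<in> S \<Longrightarrow> X s \<in> sets \<mu> \<and> X s \<subseteq> Bl s r"
  shows "measure \<mu> (\<Union>s\<in>S. X s) = (\<Sum>s\<in>S. measure \<mu> (X s))"
proof (rule measure_finite_Union[OF assms(1)])
  show "X ` S \<subseteq> sets \<mu>" using assms(3) by blast
  show "disjoint_family_on X S" unfolding disjoint_family_on_def
    using assms(2,3) Bl_disjoint by blast
  fix s assume s: "s \<in> S"
  have "emeasure \<mu> (X s) \<le> emeasure \<mu> (Bl s r)" using assms(3)[OF s] by (intro emeasure_mono) auto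
  then show "emeasure \<mu> (X s) \<noteq> \<infinity>" using emeasure_Bl_finite[of s r] by (auto simp: top_unique)
qed

text \<open>\<open>D 0\<close> is the disjoint union of the \<open>Q ^ r\<close> cosets of
  \<open>D r\<close>, all of equal measure by translation.\<close>

lemma measure_Bl: "measure \<mu> (Bl x r) = M0 / real Q ^ r"
proof -
  obtain S where S: "finite S" "S \<subseteq> D 0" "card S = Q ^ r" "\<And>x. x \<in> D 0 \<Longrightarrow> \<exists>s\<in>S. x - s \<in> D (0 + int r)"
    "\<And>s s'. s \<in> S \<Longrightarrow> s' \<in> S \<Longrightarrow> s - s' \<in> D (0 + int r) \<Longrightarrow> s = s'"
    by (rule D_representatives[of 0 r]) blast
  have "D 0 = (\<Union>s\<in>S. Bl s r)"
  proof (intro equalityI subsetI)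
    fix x assume "x \<in> D 0"
    then show "x \<in> (\<Union>s\<in>S. Bl s r)" using S(4) by auto
  next
    fix x assume "x \<in> (\<Union>s\<in>S. Bl s r)"
    then obtain s where s: "s \<in> S" "x - s \<in> D (int r)" by blast
    then have "x - s \<in> D 0" using D_mono[of 0 "int r"] by auto
    then show "x \<in> D 0" using D_add[of "x - s" 0 s] s S(2) by auto
  qed
  then have "M0 = (\<Sum>s\<in>S. measure \<mu> (Bl s r))"
    unfolding M0_def using measure_Un_Bl[OF S(1), of r "\<lambda>s. Bl s r"] S(5) by simp
  also have "\<dots> = (\<Sum>s\<in>S. measure \<mu> (Bl x r))"
    by (intro sum.cong refl) (metis emeasure_Bl_translate measure_def)
  also have "\<dots> = real Q ^ r * measure \<mu> (Bl x r)" using S(3) by simp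
  finally show ?thesis using Q_pos by (simp add: field_simps)
qed

text \<open>The discs of \<open>M\<close>-approximation for denominators of exact order
  \<open>- k\<close>; order above \<open>2 * k + M\<close> is membership in
  \<open>D (2 * k + M + 1)\<close>. With the order of \<open>g\<close> fixed all discs have the same
  size, and since \<open>M\<close> is a natural number they are separated.\<close>

definition E :: "nat \<Rightarrow> nat \<Rightarrow> 'l set" where
  "E M k = {\<alpha>. \<exists>f\<in>A. \<exists>g\<in>A. g \<noteq> 0 \<and> \<nu> g = - int k \<and> coprime_in f g \<and> \<alpha> - f / g \<in> D (int (2 * k + M + 1))}"

lemma E_invariant: "\<alpha> \<in> E M k \<Longrightarrow> \<beta> - \<alpha> \<in> D (int (2 * k + M + 1)) \<Longrightarrow> \<beta> \<in> E M k"
  unfolding E_def using D_trans by blast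

lemma E_sets [simp]: "E M k \<in> sets \<mu>"
  by (rule open_sets) (use E_invariant in blast)

text \<open>At least \<open>c * Q ^ (2 * k) / Q ^ r\<close> disjoint discs of measure
  \<open>M0 / Q ^ (2 * k + M + 1)\<close> fit into the ball; the powers of \<open>Q\<close> in
  \<open>k\<close> cancel, which leaves the proportion \<open>c / Q ^ (M + 1)\<close>.\<close>

lemma E_ball_measure:
  obtains c :: real where "0 < c" "c \<le> 1"
    "\<And>x r k0. \<exists>k\<ge>k0. c * measure \<mu> (Bl x r) \<le> measure \<mu> (Bl x r \<inter> E M k)"
proof -
  obtain c where c: "0 < c" "\<And>x r k0. \<exists>k\<ge>k0. \<exists>S. finite S \<and> c * real Q ^ (2 * k) \<le> real (card S) * real Q ^ r \<and>
       (\<forall>z\<in>S. z - x \<in> D (int r) \<and> (\<exists>f\<in>A. \<exists>g\<in>A. g \<noteq> 0 \<and> \<nu> g = - int k \<and> coprime_in f g \<and> z = f / g))"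
    using coprime_fractions_count by blast
  \<comment> \<open>The minimum with 1 keeps \<open>1 - c'\<close> nonnegative when the bound is
    iterated.\<close>
  define c' where "c' = min 1 (c / real Q ^ (M + 1))"
  show thesis
  proof (rule that[of c'])
    show "0 < c'" "c' \<le> 1" unfolding c'_def using c(1) Q_pos by auto
    fix x r k0
    \<comment> \<open>\<open>k \<ge> r\<close> makes the discs finer than the ball, so they lie
      inside it.\<close>
    obtain k S where k: "k \<ge> max k0 r" and S: "finite S" "c * real Q ^ (2 * k) \<le> real (card S) * real Q ^ r"
       "\<forall>z\<in>S. z - x \<in> D (int r) \<and> (\<exists>f\<in>A. \<exists>g\<in>A. g \<noteq> 0 \<and> \<nu> g = - int k \<and> coprime_in f g \<and> z = f / g)"
      using c(2)[of "max k0 r" r x] by metis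
    let ?n = "2 * k + M + 1"
    have sep: "z = z'" if z: "z \<in> S" "z' \<in> S" "z - z' \<in> D (int ?n)" for z z'
    proof (rule ccontr)
      assume ne: "z \<noteq> z'"
      obtain f g where fg1: "f \<in> A" "g \<in> A" "g \<noteq> 0" "\<nu> g = - int k" "z = f / g"
        using bspec[OF S(3) z(1)] by blast
      obtain f' g' where fg2: "f' \<in> A" "g' \<in> A" "g' \<noteq> 0" "\<nu> g' = - int k" "z' = f' / g'"
        using bspec[OF S(3) z(2)] by blast
      note fg = fg1 fg2
      have e: "z - z' = (f * g' - f' * g) / (g * g')" using fg by (simp add: field_simps)
      have "f * g' - f' * g \<noteq> 0" using ne e by auto
      moreover have "f * g' - f' * g \<in> A" by (rule A_diff[OF A_mult[OF fg(1,7)] A_mult[OF fg(6,2)]])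
      ultimately have "\<nu> (f * g' - f' * g) \<le> 0" using A_discrete by blast
      moreover have "\<nu> (z - z') = \<nu> (f * g' - f' * g) + int (2 * k)"
        unfolding e using \<open>f * g' - f' * g \<noteq> 0\<close> fg by (simp add: val_divide val_mult)
      ultimately show False using z(3) ne by (simp add: D_def)
    qed
    have sub: "(\<Union>z\<in>S. Bl z ?n) \<subseteq> Bl x r \<inter> E M k"
    proof
      fix y assume "y \<in> (\<Union>z\<in>S. Bl z ?n)"
      then obtain z where z: "z \<in> S" "y - z \<in> D (int ?n)" by blast
      have "y - z \<in> D (int r)" using z(2) D_mono[of "int r" "int ?n"] k by auto
      then have "y - x \<in> D (int r)" using bspec[OF S(3) z(1)] D_trans by blast
      moreover have "y \<in> E M k"
      proof -
        obtain f g where "f \<in> A" "g \<in> A" "g \<noteq> 0" "\<nu> g = - int k" "coprime_in f g" "z = f / g"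
          using bspec[OF S(3) z(1)] by blast
        then show ?thesis unfolding E_def using z(2) by blast
      qed
      ultimately show "y \<in> Bl x r \<inter> E M k" by blast
    qed
    have "measure \<mu> (\<Union>z\<in>S. Bl z ?n) = (\<Sum>z\<in>S. measure \<mu> (Bl z ?n))"
      by (rule measure_Un_Bl[OF S(1) sep]) (assumption+, use Bl_sets in blast)
    then have "measure \<mu> (\<Union>z\<in>S. Bl z ?n) = real (card S) * (M0 / real Q ^ ?n)"
      unfolding measure_Bl by (simp only: sum_constant)
    moreover have "measure \<mu> (\<Union>z\<in>S. Bl z ?n) \<le> measure \<mu> (Bl x r \<inter> E M k)"
    proof (rule measure_mono_fmeasurable[OF sub])
      show "(\<Union>z\<in>S. Bl z ?n) \<in> sets \<mu>" by (intro sets.finite_UN S(1) Bl_sets)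
      show "Bl x r \<inter> E M k \<in> fmeasurable \<mu>"
        by (rule Bl_Int_fmeasurable[OF E_sets])
    qed
    moreover have "c' * measure \<mu> (Bl x r) \<le> real (card S) * (M0 / real Q ^ ?n)"
    proof -
      have "c' * measure \<mu> (Bl x r) \<le> c / real Q ^ (M + 1) * (M0 / real Q ^ r)"
        unfolding measure_Bl c'_def using M0_pos by (intro mult_right_mono) auto
      also have "\<dots> = (c * real Q ^ (2 * k)) * (M0 / (real Q ^ ?n * real Q ^ r))"
        using Q_pos by (simp add: power_add field_simps)
      also have "\<dots> \<le> (real (card S) * real Q ^ r) * (M0 / (real Q ^ ?n * real Q ^ r))"
        using S(2) M0_pos by (intro mult_right_mono) auto
      also have "\<dots> = real (card S) * (M0 / real Q ^ ?n)" using Q_pos by simp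
      finally show ?thesis .
    qed
    ultimately show "\<exists>k\<ge>k0. c' * measure \<mu> (Bl x r) \<le> measure \<mu> (Bl x r \<inter> E M k)"
      using k by (intro exI[of _ k]) auto
  qed
qed

text \<open>Every ball is met by some late \<open>E M k\<close> in a fixed proportion, and what remains is again a finite
  disjoint union of balls. Iterating replaces the Lebesgue density theorem.\<close>

lemma limsup_complement_null: "D 0 \<inter> (\<Inter>k\<in>{n..}. - E M k) \<in> null_sets \<mu>"
proof -
  obtain c where c: "0 < c" "c \<le> 1"
    "\<And>x r k0. \<exists>k\<ge>k0. c * measure \<mu> (Bl x r) \<le> measure \<mu> (Bl x r \<inter> E M k)"
    using E_ball_measure[of M] by blast
  define Z where "Z = (\<Inter>k\<in>{n..}. - E M k)"
  have "- E M k \<in> sets \<mu>" for k using sets.compl_sets[OF E_sets[of M k]] haarD(1) by (simp add: Compl_eq_Diff_UNIV)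
  then have Zs: "Z \<in> sets \<mu>" unfolding Z_def by (intro sets.countable_INT') auto
  have fm: "Bl x r \<inter> X \<in> fmeasurable \<mu>" if "X \<in> sets \<mu>" for x r X
    by (rule Bl_Int_fmeasurable[OF that])
  \<comment> \<open>The induction runs over all balls at once, because the \<open>k\<close> that
    serves a ball depends on the ball.\<close>
  have main: "measure \<mu> (Bl x r \<inter> Z) \<le> (1 - c) ^ j * measure \<mu> (Bl x r)" for x r j
  proof (induction j arbitrary: x r)
    case 0
    show ?case using measure_mono_fmeasurable[of "Bl x r \<inter> Z" "Bl x r" \<mu>] Zs fm[of UNIV x r] haarD(1) sets.top[of \<mu>] by auto
  next
    case (Suc j)
    obtain k where k: "k \<ge> n" "c * measure \<mu> (Bl x r) \<le> measure \<mu> (Bl x r \<inter> E M k)" using c(3) by blast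
    let ?n = "2 * k + M + 1"
    obtain S where S: "finite S" "S \<subseteq> D (int r)" "\<And>x. x \<in> D (int r) \<Longrightarrow> \<exists>s\<in>S. x - s \<in> D (int r + int ?n)"
      "\<And>s s'. s \<in> S \<Longrightarrow> s' \<in> S \<Longrightarrow> s - s' \<in> D (int r + int ?n) \<Longrightarrow> s = s'"
      by (rule D_representatives[of "int r" ?n]) blast
    let ?r' = "r + ?n"
    have r': "int r + int ?n = int ?r'" by simp
    define S' where "S' = {z. z - x \<in> S \<and> z \<notin> E M k}"
    have S'sub: "S' \<subseteq> (+) x ` S" unfolding S'_def by (auto simp: image_iff intro!: bexI[of _ "_ - x"])
    have finS': "finite S'" using finite_subset[OF S'sub] S(1) by simp
    have S'sep: "s = s'" if "s \<in> S'" "s' \<in> S'" "s - s' \<in> D (int ?r')" for s s'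
      using S(4)[of "s - x" "s' - x"] that unfolding S'_def r' by simp
    \<comment> \<open>\<open>E M k\<close> is a union of cosets of \<open>D (2 * k + M + 1)\<close>,
      and the radius \<open>?r'\<close> is at least as fine, so each small ball lies wholly inside
      or wholly outside \<open>E M k\<close>.\<close>
    have eq: "Bl x r - E M k = (\<Union>z\<in>S'. Bl z ?r')"
    proof (intro equalityI subsetI)
      fix y assume y: "y \<in> Bl x r - E M k"
      then obtain s where s: "s \<in> S" "(y - x) - s \<in> D (int ?r')" using S(3)[of "y - x"] unfolding r' by blast
      then have ys: "y - (x + s) \<in> D (int ?r')" by (simp add: algebra_simps)
      have "x + s \<notin> E M k"
      proof
        assume "x + s \<in> E M k"
        moreover have "y - (x + s) \<in> D (int ?n)" using ys D_mono[of "int ?n" "int ?r'"] by auto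
        ultimately have "y \<in> E M k" by (rule E_invariant)
        then show False using y by blast
      qed
      then show "y \<in> (\<Union>z\<in>S'. Bl z ?r')" using s ys unfolding S'_def by (intro UN_I[of "x + s"]) auto
    next
      fix y assume "y \<in> (\<Union>z\<in>S'. Bl z ?r')"
      then obtain z where z: "z - x \<in> S" "z \<notin> E M k" "y - z \<in> D (int ?r')" unfolding S'_def by blast
      have "y - z \<in> D (int r)" using z(3) D_mono[of "int r" "int ?r'"] by auto
      then have "y - x \<in> D (int r)" using z(1) S(2) D_trans by blast
      moreover have "y \<notin> E M k"
      proof
        assume "y \<in> E M k"
        moreover have "z - y \<in> D (int ?n)" using z(3) D_mono[of "int ?n" "int ?r'"] D_diff_commute by auto
        ultimately show False using E_invariant z(2) by blast
      qed
      ultimately show "y \<in> Bl x r - E M k" by blast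
    qed
    have "Bl x r \<inter> Z = (Bl x r - E M k) \<inter> Z" using k(1) unfolding Z_def by auto
    also have "\<dots> = (\<Union>z\<in>S'. Bl z ?r' \<inter> Z)" unfolding eq by blast
    finally have BZ: "Bl x r \<inter> Z = (\<Union>z\<in>S'. Bl z ?r' \<inter> Z)" .
    have "measure \<mu> (Bl x r \<inter> Z) = (\<Sum>z\<in>S'. measure \<mu> (Bl z ?r' \<inter> Z))"
      unfolding BZ by (rule measure_Un_Bl[OF finS' S'sep, where X = "\<lambda>z. Bl z ?r' \<inter> Z"])
        (assumption+, intro conjI sets.Int Bl_sets Zs Int_lower1)
    also have "\<dots> \<le> (\<Sum>z\<in>S'. (1 - c) ^ j * measure \<mu> (Bl z ?r'))" by (intro sum_mono Suc.IH)
    also have "\<dots> = (1 - c) ^ j * (\<Sum>z\<in>S'. measure \<mu> (Bl z ?r'))" by (simp only: sum_distrib_left)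
    also have "(\<Sum>z\<in>S'. measure \<mu> (Bl z ?r')) = measure \<mu> (Bl x r - E M k)"
      unfolding eq by (rule measure_Un_Bl[OF finS' S'sep, symmetric]) (assumption+, use Bl_sets in blast)
    also have "measure \<mu> (Bl x r - E M k) = measure \<mu> (Bl x r) - measure \<mu> (Bl x r \<inter> E M k)"
    proof -
      have "Bl x r - E M k = Bl x r - (Bl x r \<inter> E M k)" by blast
      then show ?thesis
        using measure_Diff[OF emeasure_Bl_finite Bl_sets sets.Int[OF Bl_sets E_sets] Int_lower1, of x r M k] by (simp only:)
    qed
    also have "(1 - c) ^ j * \<dots> \<le> (1 - c) ^ j * ((1 - c) * measure \<mu> (Bl x r))"
      using k(2) c(2) by (intro mult_left_mono) (auto simp: algebra_simps)
    finally show ?case by (simp add: mult_ac)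
  qed
  have "(\<lambda>j. (1 - c) ^ j * measure \<mu> (Bl 0 0)) \<longlonglongrightarrow> 0 * measure \<mu> (Bl 0 0)"
    by (intro tendsto_mult tendsto_const LIMSEQ_realpow_zero) (use c in auto)
  then have "measure \<mu> (Bl 0 0 \<inter> Z) \<le> 0 * measure \<mu> (Bl 0 0)"
    by (rule LIMSEQ_le_const) (use main in blast)
  then have "measure \<mu> (D 0 \<inter> Z) = 0" using measure_nonneg[of \<mu> "D 0 \<inter> Z"] by simp
  moreover have "D 0 \<inter> Z \<in> fmeasurable \<mu>" using fm[OF Zs, of 0 0] by simp
  ultimately show ?thesis unfolding Z_def
    by (intro null_setsI) (auto simp: fmeasurable_def emeasure_eq_ennreal_measure less_top)
qed

section \<open>From infinitely many discs to approximability\<close>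

lemma powi_sandwich:
  assumes "\<And>n. 0 \<le> s n" "\<And>n. s n \<le> real b powi (- int n)"
  shows "s \<longlonglongrightarrow> 0"
proof (rule tendsto_sandwich[of "\<lambda>_. 0" s sequentially "\<lambda>n. inverse (real b) ^ n" 0])
  show "(\<lambda>n. inverse (real b) ^ n) \<longlonglongrightarrow> 0" using b by (intro LIMSEQ_realpow_zero) (auto simp: inverse_less_1_iff)
  show "\<forall>\<^sub>F n in sequentially. s n \<le> inverse (real b) ^ n"
    using assms(2) by (intro always_eventually allI) (simp add: power_int_minus power_inverse)
qed (use assms(1) in simp_all)

text \<open>Choosing one approximation in each \<open>D n\<close> replaces the convergent sequence;
  in this form the set is visibly a countable intersection.\<close>

lemma approximable_iff:
  "\<alpha> \<in> approximable A (absval b \<nu>) \<pi> m \<longleftrightarrow>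
    (\<forall>n. \<exists>x. is_approximation A (absval b \<nu>) \<pi> m \<alpha> x \<and> x - \<alpha> \<in> D (int n))"
proof
  assume "\<alpha> \<in> approximable A (absval b \<nu>) \<pi> m"
  then obtain x where x: "\<And>k. is_approximation A (absval b \<nu>) \<pi> m \<alpha> (x k)"
    "(\<lambda>k. absval b \<nu> (x k - \<alpha>)) \<longlonglongrightarrow> 0" unfolding approximable_def by (auto simp: limitin_valuation_topology[OF b])
  show "\<forall>n. \<exists>x. is_approximation A (absval b \<nu>) \<pi> m \<alpha> x \<and> x - \<alpha> \<in> D (int n)"
  proof
    fix n
    have "0 < real b powi (- int n)" using b by (intro zero_less_power_int) simp
    then have "\<forall>\<^sub>F k in sequentially. absval b \<nu> (x k - \<alpha>) < real b powi (- int n)" by (rule order_tendstoD(2)[OF x(2)])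
    then obtain k where "absval b \<nu> (x k - \<alpha>) < real b powi (- int n)" using eventually_happens'[OF sequentially_bot] by blast
    then have "x k - \<alpha> \<in> D (int n)" using absval_le_iff[OF b] less_imp_le by blast
    then show "\<exists>x. is_approximation A (absval b \<nu>) \<pi> m \<alpha> x \<and> x - \<alpha> \<in> D (int n)" using x(1) by blast
  qed
next
  assume "\<forall>n. \<exists>x. is_approximation A (absval b \<nu>) \<pi> m \<alpha> x \<and> x - \<alpha> \<in> D (int n)"
  then obtain x where x: "\<And>n. is_approximation A (absval b \<nu>) \<pi> m \<alpha> (x n)" "\<And>n. x n - \<alpha> \<in> D (int n)" by metis
  have "(\<lambda>n. absval b \<nu> (x n - \<alpha>)) \<longlonglongrightarrow> 0"
    by (rule powi_sandwich) (use absval_nonneg[OF b] absval_le_iff[OF b] x(2) in blast)+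
  then have "limitin (valuation_topology (absval b \<nu>)) x \<alpha> sequentially"
    by (simp only: limitin_valuation_topology[OF b])
  then show "\<alpha> \<in> approximable A (absval b \<nu>) \<pi> m" unfolding approximable_def using x(1) by blast
qed

text \<open>Convergence is automatic: a point of \<open>E M k\<close> differs from its fraction by
  an element of \<open>D (2 * k + M + 1)\<close>, and \<open>k\<close> is unbounded. A natural
  \<open>M\<close> above \<open>m\<close> gives a stronger inequality, so negative \<open>m\<close>
  are covered as well.\<close>

lemma limsup_approximable:
  assumes \<pi>: "uniformizer \<nu> \<pi>" and M: "m \<le> int M"
    and inf: "\<And>n. \<exists>k\<ge>n. \<alpha> \<in> E M k"
  shows "\<alpha> \<in> approximable A (absval b \<nu>) \<pi> m"
proof -
  have \<pi>': "absval b \<nu> \<pi> powi m = real b powi (- m)"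
    using \<pi> unfolding uniformizer_def by (simp add: absval_def power_int_minus power_int_inverse)
  have "\<exists>x. is_approximation A (absval b \<nu>) \<pi> m \<alpha> x \<and> x - \<alpha> \<in> D (int n)" for n
  proof -
    obtain k where k: "k \<ge> n" "\<alpha> \<in> E M k" using inf by blast
    then obtain f g where fg: "f \<in> A" "g \<in> A" "g \<noteq> 0" "\<nu> g = - int k" "coprime_in f g"
      "\<alpha> - f / g \<in> D (int (2 * k + M + 1))" unfolding E_def by blast
    obtain a c where ac: "a \<in> A" "c \<in> A" "f * a + g * c = 1" using fg(5) unfolding coprime_in_def by blast
    have "{f * a + g * b | a b. a \<in> A \<and> b \<in> A} = A"
    proof (intro equalityI subsetI)
      fix z assume "z \<in> {f * a + g * b | a b. a \<in> A \<and> b \<in> A}"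
      then show "z \<in> A" using fg A_add A_mult by blast
    next
      fix z assume z: "z \<in> A"
      have "z = z * (f * a + g * c)" using ac(3) by simp
      also have "\<dots> = f * (z * a) + g * (z * c)" by (simp add: algebra_simps)
      finally show "z \<in> {f * a + g * b | a b. a \<in> A \<and> b \<in> A}" using z ac A_mult by blast
    qed
    moreover have "absval b \<nu> (\<alpha> - f / g) < absval b \<nu> \<pi> powi m / (absval b \<nu> g)\<^sup>2"
    proof -
      have "absval b \<nu> g = real b powi int k" using fg by (simp add: absval_def)
      then have "(absval b \<nu> g)\<^sup>2 = real b powi (2 * int k)" using b
        by (metis (no_types, lifting) power_int_of_nat power_mult mult.commute of_nat_mult of_nat_numeral)
      then have "absval b \<nu> \<pi> powi m / (absval b \<nu> g)\<^sup>2 = real b powi (- (m + 2 * int k))"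
        unfolding \<pi>' using b by (simp add: power_int_diff[symmetric])
      moreover have "\<alpha> - f / g \<in> D (m + 2 * int k + 1)"
        using fg(6) D_mono[of "m + 2 * int k + 1" "int (2 * k + M + 1)"] M by auto
      ultimately show ?thesis by (simp only: absval_less_iff[OF b])
    qed
    ultimately have "is_approximation A (absval b \<nu>) \<pi> m \<alpha> (f / g)" unfolding is_approximation_def using fg by blast
    moreover have "f / g - \<alpha> \<in> D (int n)" using fg(6) D_mono[of "int n" "int (2 * k + M + 1)"] k(1) D_diff_commute by auto
    ultimately show ?thesis by blast
  qed
  then show ?thesis unfolding approximable_iff by blast
qed

text \<open>By the ultrametric inequality an approximation of \<open>\<alpha>\<close> still
  approximates every nearby \<open>\<beta>\<close>, so each \<open>U n\<close> is open.\<close>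

lemma approximable_sets: "approximable A (absval b \<nu>) \<pi> m \<in> sets \<mu>"
proof -
  define U where "U n = {\<alpha>. \<exists>x. is_approximation A (absval b \<nu>) \<pi> m \<alpha> x \<and> x - \<alpha> \<in> D (int n)}" for n
  have "U n \<in> sets \<mu>" for n
  proof (rule open_sets)
    fix \<alpha> assume "\<alpha> \<in> U n"
    then obtain f g where fg: "f \<in> A" "g \<in> A" "g \<noteq> 0" "{f * a + g * b | a b. a \<in> A \<and> b \<in> A} = A"
      "absval b \<nu> (\<alpha> - f / g) < absval b \<nu> \<pi> powi m / (absval b \<nu> g)\<^sup>2" "f / g - \<alpha> \<in> D (int n)"
      unfolding U_def is_approximation_def by blast
    let ?R = "absval b \<nu> \<pi> powi m / (absval b \<nu> g)\<^sup>2"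
    have "0 < ?R" using fg(5) absval_nonneg[OF b, of "\<alpha> - f / g"] by linarith
    then obtain j where j: "real b powi (- int j) < ?R" using powi_less[OF b] by blast
    have "\<beta> \<in> U n" if \<beta>: "\<beta> - \<alpha> \<in> D (int (max j n))" for \<beta>
    proof -
      have bj: "\<beta> - \<alpha> \<in> D (int j)" "\<beta> - \<alpha> \<in> D (int n)"
        using \<beta> D_mono[of "int j" "int (max j n)"] D_mono[of "int n" "int (max j n)"] by auto
      have "absval b \<nu> (\<beta> - \<alpha>) < ?R" using bj(1) absval_le_iff[OF b, of "\<beta> - \<alpha>" "int j"] j by linarith
      moreover have "absval b \<nu> (\<beta> - f / g) \<le> max (absval b \<nu> (\<beta> - \<alpha>)) (absval b \<nu> (\<alpha> - f / g))"
        using absval_add[OF b, of "\<beta> - \<alpha>" "\<alpha> - f / g"] by simp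
      ultimately have "absval b \<nu> (\<beta> - f / g) < ?R" using fg(5) by linarith
      then have "is_approximation A (absval b \<nu>) \<pi> m \<beta> (f / g)" unfolding is_approximation_def using fg(1-4) by blast
      moreover have "f / g - \<beta> \<in> D (int n)" using D_trans[OF fg(6)] bj(2) D_diff_commute by blast
      ultimately show ?thesis unfolding U_def by blast
    qed
    then show "\<exists>j. \<forall>\<beta>. \<beta> - \<alpha> \<in> D j \<longrightarrow> \<beta> \<in> U n" by blast
  qed
  then have "(\<Inter>n. U n) \<in> sets \<mu>" by (intro sets.countable_INT) auto
  moreover have "approximable A (absval b \<nu>) \<pi> m = (\<Inter>n. U n)" unfolding U_def using approximable_iff by auto
  ultimately show ?thesis by simp
qed

lemma not_approximable_null:
  assumes \<pi>: "uniformizer \<nu> \<pi>"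
  shows "D 0 - approximable A (absval b \<nu>) \<pi> m \<in> null_sets \<mu>"
proof (rule null_sets_subset)
  show "(\<Union>n. D 0 \<inter> (\<Inter>k\<in>{n..}. - E (nat m) k)) \<in> null_sets \<mu>"
    using limsup_complement_null by (intro null_sets_UN)
  have "Bl 0 0 \<in> sets \<mu>" by (rule Bl_sets)
  then have "D 0 \<in> sets \<mu>" by simp
  then show "D 0 - approximable A (absval b \<nu>) \<pi> m \<in> sets \<mu>" using approximable_sets by (rule sets.Diff)
  show "D 0 - approximable A (absval b \<nu>) \<pi> m \<subseteq> (\<Union>n. D 0 \<inter> (\<Inter>k\<in>{n..}. - E (nat m) k))"
  proof
    fix \<alpha> assume \<alpha>: "\<alpha> \<in> D 0 - approximable A (absval b \<nu>) \<pi> m"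
    have "m \<le> int (nat m)" by simp
    then have "\<not> (\<forall>n. \<exists>k\<ge>n. \<alpha> \<in> E (nat m) k)" using limsup_approximable[OF \<pi>] \<alpha> by blast
    then obtain n where "\<forall>k\<ge>n. \<alpha> \<notin> E (nat m) k" by blast
    then show "\<alpha> \<in> (\<Union>n. D 0 \<inter> (\<Inter>k\<in>{n..}. - E (nat m) k))" using \<alpha> by auto
  qed
qed

lemma D_0_eq: "valuation_integers (absval b \<nu>) = D 0"
  unfolding valuation_integers_def using absval_le_iff[OF b, of _ 0] by auto

text \<open>\<open>\<Sigma>\<close> consists of the integral points approximable for every natural
  \<open>m\<close>; its complement is a countable union of null sets. Taking for each
  \<open>k\<close> a \<open>k\<close>-approximation within \<open>D k\<close> yields both
  limits.\<close>

theorem almost_all_approximable: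
  assumes \<pi>: "uniformizer \<nu> \<pi>"
  shows "(\<forall>m::int. valuation_integers (absval b \<nu>) - approximable A (absval b \<nu>) \<pi> m \<in> null_sets \<mu>) \<and>
         (\<exists>\<Sigma> \<subseteq> valuation_integers (absval b \<nu>).
            valuation_integers (absval b \<nu>) - \<Sigma> \<in> null_sets \<mu> \<and>
            (\<forall>\<alpha> \<in> \<Sigma>. \<exists>f g. (\<forall>k::nat. f k \<in> A \<and> g k \<in> A \<and> g k \<noteq> 0) \<and>
               limitin (valuation_topology (absval b \<nu>)) (\<lambda>k. f k / g k) \<alpha> sequentially \<and>
               (\<lambda>k. absval b \<nu> (\<alpha> - f k / g k) * (absval b \<nu> (g k))\<^sup>2) \<longlonglongrightarrow> 0))"
  unfolding D_0_eq
proof (intro conjI allI exI[of _ "D 0 \<inter> (\<Inter>m. approximable A (absval b \<nu>) \<pi> (int m))"] ballI)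
  fix m show "D 0 - approximable A (absval b \<nu>) \<pi> m \<in> null_sets \<mu>" by (rule not_approximable_null[OF \<pi>])
next
  have "(\<Union>m. D 0 - approximable A (absval b \<nu>) \<pi> (int m)) \<in> null_sets \<mu>"
    using not_approximable_null[OF \<pi>] by (intro null_sets_UN)
  moreover have "D 0 - D 0 \<inter> (\<Inter>m. approximable A (absval b \<nu>) \<pi> (int m)) = (\<Union>m. D 0 - approximable A (absval b \<nu>) \<pi> (int m))"
    by blast
  ultimately show "D 0 - D 0 \<inter> (\<Inter>m. approximable A (absval b \<nu>) \<pi> (int m)) \<in> null_sets \<mu>" by simp
next
  fix \<alpha> assume "\<alpha> \<in> D 0 \<inter> (\<Inter>m. approximable A (absval b \<nu>) \<pi> (int m))"
  then have \<alpha>: "\<alpha> \<in> approximable A (absval b \<nu>) \<pi> (int m)" for m by blast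
  have p: "absval b \<nu> \<pi> powi m = real b powi (- m)" for m
    using \<pi> unfolding uniformizer_def by (simp add: absval_def power_int_minus power_int_inverse)
  have "\<exists>f g. f \<in> A \<and> g \<in> A \<and> g \<noteq> 0 \<and> f / g - \<alpha> \<in> D (int k) \<and>
      absval b \<nu> (\<alpha> - f / g) * (absval b \<nu> g)\<^sup>2 \<le> real b powi (- int k)" for k
  proof -
    obtain x where x: "is_approximation A (absval b \<nu>) \<pi> (int k) \<alpha> x" "x - \<alpha> \<in> D (int k)"
      using \<alpha>[of k] unfolding approximable_iff by blast
    then obtain f g where fg: "f \<in> A" "g \<in> A" "g \<noteq> 0" "x = f / g"
      "absval b \<nu> (\<alpha> - f / g) < absval b \<nu> \<pi> powi int k / (absval b \<nu> g)\<^sup>2"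
      unfolding is_approximation_def by blast
    have "0 < absval b \<nu> g" using absval_eq[OF b fg(3)] b by (simp add: zero_less_power_int)
    then have "absval b \<nu> (\<alpha> - f / g) * (absval b \<nu> g)\<^sup>2 \<le> real b powi (- int k)"
      using fg(5) unfolding p by (simp add: field_simps)
    then show ?thesis using fg x(2) by blast
  qed
  then obtain f g where fg: "\<And>k. f k \<in> A \<and> g k \<in> A \<and> g k \<noteq> 0" "\<And>k. f k / g k - \<alpha> \<in> D (int k)"
      "\<And>k. absval b \<nu> (\<alpha> - f k / g k) * (absval b \<nu> (g k))\<^sup>2 \<le> real b powi (- int k)" by metis
  have "(\<lambda>k. absval b \<nu> (f k / g k - \<alpha>)) \<longlonglongrightarrow> 0"
    by (rule powi_sandwich) (use absval_nonneg[OF b] absval_le_iff[OF b] fg(2) in blast)+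
  then have "limitin (valuation_topology (absval b \<nu>)) (\<lambda>k. f k / g k) \<alpha> sequentially"
    by (simp only: limitin_valuation_topology[OF b])
  moreover have "(\<lambda>k. absval b \<nu> (\<alpha> - f k / g k) * (absval b \<nu> (g k))\<^sup>2) \<longlonglongrightarrow> 0"
    by (rule powi_sandwich) (use absval_nonneg[OF b] fg(3) in auto)
  ultimately show "\<exists>f g. (\<forall>k::nat. f k \<in> A \<and> g k \<in> A \<and> g k \<noteq> 0) \<and>
               limitin (valuation_topology (absval b \<nu>)) (\<lambda>k. f k / g k) \<alpha> sequentially \<and>
               (\<lambda>k. absval b \<nu> (\<alpha> - f k / g k) * (absval b \<nu> (g k))\<^sup>2) \<longlonglongrightarrow> 0"
    using fg(1) by blast
qed simp

end

section \<open>Subrings with finite quotients\<close>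

definition subring_of :: "'a::comm_ring_1 set \<Rightarrow> bool" where
  "subring_of S \<longleftrightarrow> 1 \<in> S \<and> (\<forall>x\<in>S. \<forall>y\<in>S. x - y \<in> S \<and> x * y \<in> S)"

lemma
  assumes "subring_of S"
  shows subring_of_one: "1 \<in> S"
    and subring_of_diff: "x \<in> S \<Longrightarrow> y \<in> S \<Longrightarrow> x - y \<in> S"
    and subring_of_mult: "x \<in> S \<Longrightarrow> y \<in> S \<Longrightarrow> x * y \<in> S"
    and subring_of_zero: "0 \<in> S"
    and subring_of_minus: "x \<in> S \<Longrightarrow> - x \<in> S"
    and subring_of_add: "x \<in> S \<Longrightarrow> y \<in> S \<Longrightarrow> x + y \<in> S"
    and subring_of_power: "x \<in> S \<Longrightarrow> x ^ n \<in> S"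
proof -
  show one: "1 \<in> S" and diff: "\<And>x y. x \<in> S \<Longrightarrow> y \<in> S \<Longrightarrow> x - y \<in> S" and mult: "\<And>x y. x \<in> S \<Longrightarrow> y \<in> S \<Longrightarrow> x * y \<in> S"
    using assms unfolding subring_of_def by simp_all
  show zero: "0 \<in> S" using diff[OF one one] by simp
  show minus: "\<And>x. x \<in> S \<Longrightarrow> - x \<in> S" using diff[OF zero] by simp
  show "\<And>x y. x \<in> S \<Longrightarrow> y \<in> S \<Longrightarrow> x + y \<in> S" using diff minus by (metis diff_minus_eq_add)
  show "x \<in> S \<Longrightarrow> x ^ n \<in> S" by (induction n) (use one mult in auto)
qed

lemma subring_of_sum: "subring_of S \<Longrightarrow> (\<And>i. i \<in> I \<Longrightarrow> f i \<in> S) \<Longrightarrow> sum f I \<in> S"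
  by (induction I rule: infinite_finite_induct) (auto intro: subring_of_zero subring_of_add)

lemma subring_of_prod: "subring_of S \<Longrightarrow> (\<And>i. i \<in> I \<Longrightarrow> f i \<in> S) \<Longrightarrow> prod f I \<in> S"
  by (induction I rule: infinite_finite_induct) (auto intro: subring_of_one subring_of_mult)

text \<open>Pigeonhole among finitely many representatives of the powers of \<open>y\<close>; the
  common source of the roots of unity, inverses and idempotents below.\<close>

lemma powers_congruent:
  fixes y :: "'a::comm_ring_1"
  assumes W: "finite W" and cov: "\<And>k. \<exists>w\<in>W. y ^ k - w \<in> J" and J: "\<And>x z. x \<in> J \<Longrightarrow> z \<in> J \<Longrightarrow> x - z \<in> J"
  shows "\<exists>i M. 1 \<le> M \<and> y ^ i - y ^ (i + M) \<in> J"
proof -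
  obtain h where h: "\<And>k. h k \<in> W \<and> y ^ k - h k \<in> J" using cov by metis
  have "range h \<subseteq> W" using h by blast
  then have "finite (range h)" using W by (rule finite_subset)
  then have "\<not> inj h" using finite_imageD[of h UNIV] infinite_UNIV_nat by blast
  then obtain i j where ij: "h i = h j" "i < j" unfolding inj_def by (metis nat_neq_iff)
  have "(y ^ i - h i) - (y ^ j - h j) \<in> J" using h J by blast
  then have "y ^ i - y ^ (i + (j - i)) \<in> J" using ij by simp
  then show ?thesis using ij(2) by (intro exI[of _ i] exI[of _ "j - i"]) simp
qed

text \<open>Cancelling the lowest power of \<open>z\<close> in the relation and reducing modulo
  \<open>z\<close> leaves a nonzero polynomial in \<open>y\<close> over the finite field
  \<open>F\<close>. Its leading coefficient is invertible, so every power of \<open>y\<close>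
  reduces to one of finitely many combinations of lower powers.\<close>

lemma algebraic_powers_congruent:
  fixes y z :: "'a::field"
  assumes S: "subring_of S" and F: "subring_of F" "F \<subseteq> S" "finite F" "\<And>c. c \<in> F \<Longrightarrow> inverse c \<in> F"
    and yz: "y \<in> S" "z \<in> S" "z \<noteq> 0"
    and c: "\<And>a b. c a b \<in> F" "a1 \<le> B" "b1 \<le> B" "c a1 b1 \<noteq> 0"
    and rel: "(\<Sum>b\<le>B. \<Sum>a\<le>B. c a b * y ^ a * z ^ b) = 0"
  shows "\<exists>i M. 1 \<le> M \<and> y ^ i - y ^ (i + M) \<in> (*) z ` S"
proof -
  let ?J = "(*) z ` S"
  have J_diff: "x - x' \<in> ?J" if "x \<in> ?J" "x' \<in> ?J" for x x'
    using that subring_of_diff[OF S] by (auto simp: right_diff_distrib[symmetric])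
  have J_add: "x + x' \<in> ?J" if "x \<in> ?J" "x' \<in> ?J" for x x'
    using that subring_of_add[OF S] by (auto simp: distrib_left[symmetric])
  have J_mult: "r * x \<in> ?J" if "r \<in> S" "x \<in> ?J" for r x
    using that subring_of_mult[OF S] by (auto simp: mult.left_commute)
  define b0 where "b0 = (LEAST b. \<exists>a\<le>B. c a b \<noteq> 0)"
  have ex: "\<exists>a\<le>B. c a b0 \<noteq> 0" unfolding b0_def by (rule LeastI[of _ b1]) (use c in blast)
  have b0le: "b0 \<le> B" using Least_le[of "\<lambda>b. \<exists>a\<le>B. c a b \<noteq> 0" b1] c unfolding b0_def by fastforce
  have zero: "c a b = 0" if "a \<le> B" "b < b0" for a b using not_less_Least[of b] that unfolding b0_def by blast
  define d where "d = Max {a. a \<le> B \<and> c a b0 \<noteq> 0}"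
  have fin: "finite {a. a \<le> B \<and> c a b0 \<noteq> 0}" by simp
  have d: "d \<le> B" "c d b0 \<noteq> 0" using Max_in[OF fin] ex unfolding d_def by blast+
  have above: "c a b0 = 0" if "a \<le> B" "d < a" for a
  proof (rule ccontr)
    assume "c a b0 \<noteq> 0"
    then have "a \<le> d" unfolding d_def using that(1) by (intro Max_ge[OF fin]) simp
    then show False using that(2) by simp
  qed
  define g where "g b = (\<Sum>a\<le>B. c a b * y ^ a)" for b
  have gS: "g b \<in> S" for b unfolding g_def
    using c(1) F(2) yz subring_of_mult[OF S] subring_of_power[OF S] by (intro subring_of_sum[OF S]) blast
  define r where "r = (\<Sum>b\<in>{Suc b0..B}. g b * z ^ (b - Suc b0))"
  have rS: "r \<in> S" unfolding r_def
    using gS yz subring_of_mult[OF S] subring_of_power[OF S] by (intro subring_of_sum[OF S]) blast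
  have "0 = (\<Sum>b\<le>B. g b * z ^ b)" using rel unfolding g_def by (simp add: sum_distrib_right)
  also have "\<dots> = (\<Sum>b\<in>{b0..B}. g b * z ^ b)"
    by (rule sum.mono_neutral_right) (auto simp: g_def zero intro!: sum.neutral)
  also have "\<dots> = g b0 * z ^ b0 + (\<Sum>b\<in>{Suc b0..B}. g b * z ^ b)" using b0le by (simp add: sum.atLeast_Suc_atMost)
  also have "(\<Sum>b\<in>{Suc b0..B}. g b * z ^ b) = (\<Sum>b\<in>{Suc b0..B}. z ^ Suc b0 * (g b * z ^ (b - Suc b0)))"
  proof (rule sum.cong[OF refl])
    fix b assume "b \<in> {Suc b0..B}"
    then have "z ^ b = z ^ Suc b0 * z ^ (b - Suc b0)" by (simp add: power_add[symmetric] del: power_Suc)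
    then show "g b * z ^ b = z ^ Suc b0 * (g b * z ^ (b - Suc b0))" by (simp only: mult_ac)
  qed
  also have "\<dots> = z ^ Suc b0 * r" unfolding r_def by (simp only: sum_distrib_left)
  finally have "z ^ b0 * (g b0 + z * r) = 0" by (simp add: algebra_simps)
  then have g0: "g b0 = - (z * r)" using yz(3) by (simp add: eq_neg_iff_add_eq_0)
  have "g b0 = (\<Sum>a\<in>{..d}. c a b0 * y ^ a)" unfolding g_def
    by (rule sum.mono_neutral_right) (use d above in auto)
  also have "\<dots> = (\<Sum>a<d. c a b0 * y ^ a) + c d b0 * y ^ d" by (simp add: lessThan_Suc_atMost[symmetric])
  finally have "c d b0 * y ^ d = g b0 - (\<Sum>a<d. c a b0 * y ^ a)" by simp
  then have "c d b0 * y ^ d = - (\<Sum>a<d. c a b0 * y ^ a) - z * r" unfolding g0 by simp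
  then have "y ^ d = inverse (c d b0) * (- (\<Sum>a<d. c a b0 * y ^ a) - z * r)" using d(2) by (metis mult.assoc left_inverse mult_1)
  also have "\<dots> = (\<Sum>a<d. (- inverse (c d b0) * c a b0) * y ^ a) - z * (inverse (c d b0) * r)"
    by (simp add: sum_distrib_left right_diff_distrib mult_ac sum_negf[symmetric])
  finally have yd: "y ^ d = (\<Sum>a<d. (- inverse (c d b0) * c a b0) * y ^ a) - z * (inverse (c d b0) * r)" .
  define e where "e a = - inverse (c d b0) * c a b0" for a
  have eF: "e a \<in> F" for a unfolding e_def by (intro subring_of_mult[OF F(1)] subring_of_minus[OF F(1)] F(4) c(1))
  have "inverse (c d b0) * r \<in> S" using subring_of_mult[OF S] F(4)[OF c(1)] F(2) rS by blast
  then have yd': "y ^ d - (\<Sum>a<d. e a * y ^ a) \<in> ?J"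
    using yd subring_of_minus[OF S] unfolding e_def[symmetric] by (auto simp: image_iff intro!: bexI[of _ "- (inverse (c d b0) * r)"])
  define W where "W = (\<lambda>w. \<Sum>a<d. w a * y ^ a) ` (PiE {..<d} (\<lambda>_. F))"
  have W: "(\<Sum>a<d. w a * y ^ a) \<in> W" if "\<And>a. w a \<in> F" for w
  proof -
    have "(\<Sum>a<d. w a * y ^ a) = (\<Sum>a<d. restrict w {..<d} a * y ^ a)" by (intro sum.cong) auto
    moreover have "restrict w {..<d} \<in> PiE {..<d} (\<lambda>_. F)" using that by auto
    ultimately show ?thesis unfolding W_def by blast
  qed
  have "\<exists>w. (\<forall>a. w a \<in> F) \<and> y ^ k - (\<Sum>a<d. w a * y ^ a) \<in> ?J" for k
  proof (induction k)
    case 0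
    \<comment> \<open>For \<open>d = 0\<close> the reduced relation puts 1 into the ideal of
      \<open>z\<close>, and the empty sum represents every power.\<close>
    show ?case
    proof (cases "d = 0")
      case True
      then show ?thesis using yd' eF by auto
    next
      case False
      let ?w = "\<lambda>a::nat. if a = 0 then 1 else 0"
      have "(\<Sum>a<d. ?w a * y ^ a) = (\<Sum>a<d. if a = 0 then 1 else 0)" by (intro sum.cong) auto
      then have "(\<Sum>a<d. ?w a * y ^ a) = 1" using False by simp
      moreover have "0 \<in> ?J" using subring_of_zero[OF S] by force
      ultimately show ?thesis using subring_of_zero[OF F(1)] subring_of_one[OF F(1)] by (intro exI[of _ ?w]) auto
    qed
  next
    case (Suc k)
    then obtain w where w: "\<And>a. w a \<in> F" "y ^ k - (\<Sum>a<d. w a * y ^ a) \<in> ?J" by blast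
    show ?case
    proof (cases d)
      case 0
      then have "y * y ^ k \<in> ?J" using J_mult[OF yz(1) w(2)] by simp
      then show ?thesis using 0 w(1) by (intro exI[of _ w]) auto
    next
      case (Suc d')
      \<comment> \<open>Multiplication by \<open>y\<close> shifts the coefficients; the overflow
        \<open>w d' * y ^ d\<close> is reduced by means of \<open>e\<close>, as with a companion
        matrix.\<close>
      define w' where "w' a = (if a = 0 then 0 else w (a - 1)) + w d' * e a" for a
      have w'F: "w' a \<in> F" for a unfolding w'_def
        using subring_of_add[OF F(1)] subring_of_mult[OF F(1)] subring_of_zero[OF F(1)] w(1) eF by auto
      have 1: "y * y ^ k - y * (\<Sum>a<d. w a * y ^ a) \<in> ?J"
        using J_mult[OF yz(1) w(2)] by (simp add: right_diff_distrib)
      have 2: "w d' * y ^ d - w d' * (\<Sum>a<d. e a * y ^ a) \<in> ?J"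
        using J_mult[OF _ yd', of "w d'"] w(1) F(2) by (auto simp: right_diff_distrib)
      have "y * (\<Sum>a<d. w a * y ^ a) = (\<Sum>a<d. w a * y ^ Suc a)" by (simp add: sum_distrib_left mult_ac)
      also have "\<dots> = (\<Sum>a<d'. w a * y ^ Suc a) + w d' * y ^ d" unfolding Suc by simp
      also have "(\<Sum>a<d'. w a * y ^ Suc a) = (\<Sum>a<d. (if a = 0 then 0 else w (a - 1)) * y ^ a)"
        unfolding Suc by (subst sum.lessThan_Suc_shift) simp
      finally have "y * (\<Sum>a<d. w a * y ^ a) - w d' * y ^ d = (\<Sum>a<d. (if a = 0 then 0 else w (a - 1)) * y ^ a)" by simp
      then have "(\<Sum>a<d. w' a * y ^ a) = y * (\<Sum>a<d. w a * y ^ a) - w d' * y ^ d + w d' * (\<Sum>a<d. e a * y ^ a)"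
        unfolding w'_def distrib_right sum.distrib by (simp add: sum_distrib_left mult.assoc)
      then have "y ^ Suc k - (\<Sum>a<d. w' a * y ^ a)
          = (y * y ^ k - y * (\<Sum>a<d. w a * y ^ a)) + (w d' * y ^ d - w d' * (\<Sum>a<d. e a * y ^ a))" by simp
      then show ?thesis using J_add[OF 1 2] w'F by metis
    qed
  qed
  then have "\<exists>w\<in>W. y ^ k - w \<in> ?J" for k using W by metis
  moreover have "finite W" unfolding W_def using F(3) by (intro finite_imageI finite_PiE) auto
  ultimately show ?thesis using J_diff by (intro powers_congruent) blast+
qed

section \<open>Graded ideals and the Nullstellensatz\<close>

text \<open>\<open>V k\<close> consists of the values at the generic point of the forms of degree \<open>k\<close>; subsets of \<open>V k\<close> are
  indexed by \<open>k\<close> because the same value may come from several degrees.\<close>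

locale graded_ring =
  fixes V :: "nat \<Rightarrow> 'l::field set" and n :: nat and \<xi> :: "nat \<Rightarrow> 'l"
  assumes V_one: "1 \<in> V 0"
    and V_diff: "x \<in> V k \<Longrightarrow> y \<in> V k \<Longrightarrow> x - y \<in> V k"
    and V_mult: "x \<in> V j \<Longrightarrow> y \<in> V k \<Longrightarrow> x * y \<in> V (j + k)"
    and V_inverse: "c \<in> V 0 \<Longrightarrow> inverse c \<in> V 0"
    and V_finite: "finite (V k)"
    and coord: "i \<le> n \<Longrightarrow> \<xi> i \<in> V 1"
    and V_gen: "v \<in> V (Suc k) \<Longrightarrow> \<exists>w. (\<forall>i\<le>n. w i \<in> V k) \<and> v = (\<Sum>i\<le>n. \<xi> i * w i)"
    and coord_nonzero: "\<exists>i\<le>n. \<xi> i \<noteq> 0"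
begin

lemma V_zero: "0 \<in> V k"
proof -
  have "0 \<in> V 0" using V_diff[OF V_one V_one] by simp
  moreover obtain i where "i \<le> n" using coord_nonzero by blast
  have "\<exists>x. x \<in> V k"
  proof (induction k)
    case (Suc k)
    then show ?case using V_mult[OF coord[OF \<open>i \<le> n\<close>]] by auto
  qed (use V_one in blast)
  then show ?thesis using V_diff[of _ k] by (metis cancel_comm_monoid_add_class.diff_cancel)
qed

lemma V_minus: "x \<in> V k \<Longrightarrow> - x \<in> V k" using V_diff[OF V_zero, of x k] by simp
lemma V_add: "x \<in> V k \<Longrightarrow> y \<in> V k \<Longrightarrow> x + y \<in> V k" using V_diff[of x k "- y"] V_minus[of y k] by simp
lemma V_power: "x \<in> V j \<Longrightarrow> x ^ m \<in> V (j * m)"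
  by (induction m) (use V_one V_mult in auto)

lemma V_0_subring: "subring_of (V 0)"
  unfolding subring_of_def using V_one V_diff V_mult[of _ 0 _ 0] by auto

text \<open>One coordinate is split off at a time, with \<open>H\<close> replaced by the set of
  elements that every coordinate multiplies into \<open>H\<close>.\<close>

lemma V_product_span:
  assumes H: "0 \<in> H" "\<And>x y. x \<in> H \<Longrightarrow> y \<in> H \<Longrightarrow> x + y \<in> H"
    and P: "\<And>x y. x \<in> V a \<Longrightarrow> y \<in> V c \<Longrightarrow> x * y \<in> H"
  shows "V (a + c) \<subseteq> H"
  using assms
proof (induction a arbitrary: H)
  case 0
  show ?case using 0(3)[OF V_one] by auto
next
  case (Suc a)
  let ?H = "{z. \<forall>i\<le>n. \<xi> i * z \<in> H}"
  have sub: "V (a + c) \<subseteq> ?H"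
  proof (rule Suc.IH)
    show "0 \<in> ?H" using Suc.prems(1) by simp
    show "x + y \<in> ?H" if "x \<in> ?H" "y \<in> ?H" for x y
      using that Suc.prems(2) by (simp add: distrib_left)
    show "x * y \<in> ?H" if "x \<in> V a" "y \<in> V c" for x y
      using Suc.prems(3)[OF V_mult[OF coord that(1), simplified] that(2)] by (simp add: mult.assoc)
  qed
  show ?case
  proof
    fix v assume "v \<in> V (Suc a + c)"
    then obtain w where w: "\<forall>i\<le>n. w i \<in> V (a + c)" "v = (\<Sum>i\<le>n. \<xi> i * w i)" using V_gen[of v "a + c"] by auto
    have "(\<Sum>i\<in>I. \<xi> i * w i) \<in> H" if "finite I" "I \<subseteq> {..n}" for I
      using that
    proof (induction I)
      case (insert i I)
      then show ?case using w(1) sub Suc.prems(2) by auto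
    qed (use Suc.prems(1) in simp)
    then show "v \<in> H" unfolding w(2) by blast
  qed
qed

definition graded_ideal :: "(nat \<Rightarrow> 'l set) \<Rightarrow> bool" where
  "graded_ideal J \<longleftrightarrow> (\<forall>k. J k \<subseteq> V k \<and> 0 \<in> J k \<and> (\<forall>x\<in>J k. \<forall>y\<in>J k. x + y \<in> J k)) \<and>
    (\<forall>j k. \<forall>c\<in>V j. \<forall>x\<in>J k. c * x \<in> J (j + k))"

definition graded_prime :: "(nat \<Rightarrow> 'l set) \<Rightarrow> bool" where
  "graded_prime P \<longleftrightarrow> graded_ideal P \<and> (\<exists>i\<le>n. \<xi> i \<notin> P 1) \<and>
    (\<forall>j k. \<forall>x\<in>V j. \<forall>y\<in>V k. x * y \<in> P (j + k) \<longrightarrow> x \<in> P j \<or> y \<in> P k)"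

definition graded_closed :: "(nat \<Rightarrow> 'l set) \<Rightarrow> bool" where
  "graded_closed P \<longleftrightarrow> graded_prime P \<and> (\<forall>P'. graded_prime P' \<longrightarrow> (\<forall>k. P k \<subseteq> P' k) \<longrightarrow> P' = P)"

lemma graded_idealD:
  assumes "graded_ideal J"
  shows "x \<in> J k \<Longrightarrow> x \<in> V k" "0 \<in> J k" "x \<in> J k \<Longrightarrow> y \<in> J k \<Longrightarrow> x + y \<in> J k"
    "c \<in> V j \<Longrightarrow> x \<in> J k \<Longrightarrow> c * x \<in> J (j + k)"
    "x \<in> J k \<Longrightarrow> - x \<in> J k" "x \<in> J k \<Longrightarrow> y \<in> J k \<Longrightarrow> x - y \<in> J k"
proof -
  show *: "\<And>x k. x \<in> J k \<Longrightarrow> x \<in> V k" "\<And>k. 0 \<in> J k" "\<And>x y k. x \<in> J k \<Longrightarrow> y \<in> J k \<Longrightarrow> x + y \<in> J k"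
    "\<And>c j x k. c \<in> V j \<Longrightarrow> x \<in> J k \<Longrightarrow> c * x \<in> J (j + k)"
    using assms unfolding graded_ideal_def by blast+
  show m: "\<And>x. x \<in> J k \<Longrightarrow> - x \<in> J k" using *(4)[OF V_minus[OF V_one]] by fastforce
  show "x \<in> J k \<Longrightarrow> y \<in> J k \<Longrightarrow> x - y \<in> J k" using *(3)[of x k "- y"] m[of y] by simp
qed

lemma graded_primeD:
  assumes "graded_prime P"
  shows "graded_ideal P" "\<exists>i\<le>n. \<xi> i \<notin> P 1"
    "x \<in> V j \<Longrightarrow> y \<in> V k \<Longrightarrow> x * y \<in> P (j + k) \<Longrightarrow> x \<in> P j \<or> y \<in> P k"
  using assms unfolding graded_prime_def by blast+

lemma graded_ideal_full:
  assumes J: "graded_ideal J" and "J k = V k"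
  shows "k \<le> m \<Longrightarrow> J m = V m"
proof (induction m rule: dec_induct)
  case base
  show ?case by fact
next
  case (step m)
  have "V m \<subseteq> J m" using step by simp
  have "V (1 + m) \<subseteq> J (1 + m)"
  proof (rule V_product_span)
    show "0 \<in> J (1 + m)" by (rule graded_idealD[OF J])
    show "\<And>x y. x \<in> J (1 + m) \<Longrightarrow> y \<in> J (1 + m) \<Longrightarrow> x + y \<in> J (1 + m)" by (rule graded_idealD(3)[OF J])
    show "\<And>x y. x \<in> V 1 \<Longrightarrow> y \<in> V m \<Longrightarrow> x * y \<in> J (1 + m)" using graded_idealD(4)[OF J] step by blast
  qed
  then show ?case using graded_idealD(1)[OF J] by auto
qed

lemma one_notin_prime:
  assumes P: "graded_prime P" shows "1 \<notin> P 0"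
proof
  assume "1 \<in> P 0"
  moreover obtain i where i: "i \<le> n" "\<xi> i \<notin> P 1" using graded_primeD(2)[OF P] by blast
  ultimately show False using graded_idealD(4)[OF graded_primeD(1)[OF P] coord[OF i(1)], of 1 0] by simp
qed

lemma power_in_prime:
  assumes P: "graded_prime P" and x: "x \<in> V j"
  shows "x ^ m \<in> P (j * m) \<Longrightarrow> x \<in> P j"
proof (induction m)
  case 0
  then show ?case using one_notin_prime[OF P] by simp
next
  case (Suc m)
  then show ?case using graded_primeD(3)[OF P x V_power[OF x, of m]] by auto
qed

lemma graded_prime_not_full:
  assumes P: "graded_prime P" shows "P k \<noteq> V k"
proof
  assume eq: "P k = V k"
  obtain i where i: "i \<le> n" "\<xi> i \<notin> P 1" using graded_primeD(2)[OF P] by blast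
  have "\<xi> i ^ k \<in> P (1 * k)" using V_power[OF coord[OF i(1)], of k] eq by simp
  then show False using power_in_prime[OF P coord[OF i(1)]] i(2) by blast
qed

text \<open>The projective Nullstellensatz: an ideal that is maximal among those proper in every
  degree is prime and omits some coordinate.\<close>

lemma graded_ideal_in_closed:
  assumes J: "graded_ideal J" and nf: "\<And>k. J k \<noteq> V k"
  obtains P where "graded_closed P" "\<And>k. J k \<subseteq> P k"
proof -
  \<comment> \<open>Zorn's lemma works with sets ordered by inclusion, so an indexed family is coded
    as a set of pairs of degree and form.\<close>
  define sec where "sec S k = {v. (k, v) \<in> S}" for S :: "(nat \<times> 'l) set" and k
  define pairs where "pairs J = {(k, v). v \<in> J k}" for J :: "nat \<Rightarrow> 'l set"
  have sp: "sec (pairs J) = J" for J unfolding sec_def pairs_def by auto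
  have ps: "pairs (sec S) = S" for S unfolding sec_def pairs_def by auto
  let ?\<A> = "{S. graded_ideal (sec S) \<and> (\<forall>k. sec S k \<noteq> V k) \<and> pairs J \<subseteq> S}"
  have "\<exists>M\<in>?\<A>. \<forall>X\<in>?\<A>. M \<subseteq> X \<longrightarrow> X = M"
  proof (rule subset_Zorn_nonempty)
    show "?\<A> \<noteq> {}" using J nf by (intro ex_in_conv[THEN iffD1] exI[of _ "pairs J"]) (simp add: sp)
    fix C assume C: "C \<noteq> {}" "subset.chain ?\<A> C"
    have Cid: "graded_ideal (sec S)" "\<And>k. sec S k \<noteq> V k" "pairs J \<subseteq> S" if "S \<in> C" for S
      using C(2) that unfolding subset.chain_def by blast+
    have sub: "sec S k \<subseteq> sec T k" if "S \<subseteq> T" for S T k using that unfolding sec_def by blast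
    have U: "sec (\<Union> C) k = (\<Union>S\<in>C. sec S k)" for k unfolding sec_def by blast
    have "graded_ideal (sec (\<Union> C))"
      unfolding graded_ideal_def U
    proof (intro conjI allI ballI)
      fix k
      show "(\<Union>S\<in>C. sec S k) \<subseteq> V k" using graded_idealD(1)[OF Cid(1)] by blast
      show "0 \<in> (\<Union>S\<in>C. sec S k)" using graded_idealD(2)[OF Cid(1)] C(1) by blast
      fix x y assume "x \<in> (\<Union>S\<in>C. sec S k)" "y \<in> (\<Union>S\<in>C. sec S k)"
      then obtain S T where ST: "S \<in> C" "x \<in> sec S k" "T \<in> C" "y \<in> sec T k" by blast
      have "S \<subseteq> T \<or> T \<subseteq> S" using C(2) ST(1,3) unfolding subset.chain_def by blast
      then show "x + y \<in> (\<Union>S\<in>C. sec S k)"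
      proof
        assume "S \<subseteq> T"
        then have "x \<in> sec T k" using sub ST(2) by blast
        then show ?thesis using graded_idealD(3)[OF Cid(1)[OF ST(3)] _ ST(4)] ST(3) by blast
      next
        assume "T \<subseteq> S"
        then have "y \<in> sec S k" using sub ST(4) by blast
        then show ?thesis using graded_idealD(3)[OF Cid(1)[OF ST(1)] ST(2)] ST(1) by blast
      qed
    next
      fix j k c x assume "c \<in> V j" "x \<in> (\<Union>S\<in>C. sec S k)"
      then show "c * x \<in> (\<Union>S\<in>C. sec S (j + k))" using graded_idealD(4)[OF Cid(1)] by blast
    qed
    moreover have "sec (\<Union> C) k \<noteq> V k" for k
    proof
      assume eq: "sec (\<Union> C) k = V k"
      \<comment> \<open>A finite part of the union already lies in one member of the chain. As
        \<open>V k\<close> is finite, the union cannot fill degree \<open>k\<close> unless some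
        member does.\<close>
      have "\<exists>S\<in>C. F \<subseteq> sec S k" if "finite F" "F \<subseteq> V k" for F
        using that
      proof (induction F)
        case empty
        then show ?case using C(1) by blast
      next
        case (insert v F)
        then obtain S where S: "S \<in> C" "F \<subseteq> sec S k" by blast
        obtain T where T: "T \<in> C" "v \<in> sec T k" using insert.prems eq U by blast
        have "S \<subseteq> T \<or> T \<subseteq> S" using C(2) S(1) T(1) unfolding subset.chain_def by blast
        then show ?case
        proof
          assume "S \<subseteq> T"
          then show ?thesis using sub[of S T k] S T by blast
        next
          assume "T \<subseteq> S"
          then show ?thesis using sub[of T S k] S T by blast
        qed
      qed
      then obtain S where S: "S \<in> C" "V k \<subseteq> sec S k" using V_finite by blast
      then show False using Cid(2)[OF S(1), of k] graded_idealD(1)[OF Cid(1)[OF S(1)], of _ k] by blast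
    qed
    moreover have "pairs J \<subseteq> \<Union> C" using Cid(3) C(1) by blast
    ultimately show "\<Union> C \<in> ?\<A>" by simp
  qed
  then obtain M where M: "graded_ideal (sec M)" "\<And>k. sec M k \<noteq> V k" "pairs J \<subseteq> M" "\<forall>X\<in>?\<A>. M \<subseteq> X \<longrightarrow> X = M"
    by blast
  define P where "P = sec M"
  have JP: "J k \<subseteq> P k" for k using M(3) unfolding P_def sec_def pairs_def by blast
  have max: "P' = P" if "graded_ideal P'" "\<And>k. P' k \<noteq> V k" "\<And>k. P k \<subseteq> P' k" for P'
  proof -
    have "pairs P' \<in> ?\<A>" using that JP unfolding mem_Collect_eq sp by (force simp: pairs_def)
    moreover have "M \<subseteq> pairs P'" using that(3) unfolding P_def pairs_def sec_def by auto
    ultimately have "pairs P' = M" using M(4) by blast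
    then show ?thesis unfolding P_def using sp by metis
  qed
  note Pid = M(1)[folded P_def]
  note Pne = M(2)[folded P_def]
  \<comment> \<open>Adjoining to \<open>P\<close> a form \<open>v\<close> outside it gives the
    larger ideal \<open>Jv\<close>, which by maximality must fill some degree
    \<open>a\<close>.\<close>
  have ext: "\<exists>a. \<forall>y\<in>V a. \<exists>x\<in>P a. \<exists>c. y = x + c * v \<and> (c = 0 \<or> (i \<le> a \<and> c \<in> V (a - i)))"
    if v: "v \<in> V i" "v \<notin> P i" for v i
  proof -
    define Jv where "Jv k = {x + c * v | x c. x \<in> P k \<and> (c = 0 \<or> (i \<le> k \<and> c \<in> V (k - i)))}" for k
    have Jv: "x + c * v \<in> Jv k" if "x \<in> P k" "c = 0 \<or> (i \<le> k \<and> c \<in> V (k - i))" for x c k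
      unfolding Jv_def using that by blast
    have "graded_ideal Jv"
      unfolding graded_ideal_def
    proof (intro conjI allI ballI subsetI)
      fix k
      show "0 \<in> Jv k" using Jv[OF graded_idealD(2)[OF Pid], of 0 k] by simp
      {
        fix y assume "y \<in> Jv k"
        then obtain x c where xc: "y = x + c * v" "x \<in> P k" "c = 0 \<or> (i \<le> k \<and> c \<in> V (k - i))" unfolding Jv_def by blast
        have "c * v \<in> V k" using xc(3) V_mult[OF _ v(1), of c "k - i"] V_zero by auto
        then show "y \<in> V k" using xc(1) graded_idealD(1)[OF Pid xc(2)] V_add by blast
      }
      fix y z assume "y \<in> Jv k" "z \<in> Jv k"
      then obtain x c x' c' where yz: "y = x + c * v" "x \<in> P k" "c = 0 \<or> (i \<le> k \<and> c \<in> V (k - i))"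
        "z = x' + c' * v" "x' \<in> P k" "c' = 0 \<or> (i \<le> k \<and> c' \<in> V (k - i))" unfolding Jv_def by blast
      have "y + z = (x + x') + (c + c') * v" using yz by (simp add: algebra_simps)
      moreover have "c + c' = 0 \<or> (i \<le> k \<and> c + c' \<in> V (k - i))" using yz(3,6) V_add by auto
      ultimately show "y + z \<in> Jv k" using Jv[OF graded_idealD(3)[OF Pid yz(2,5)]] by simp
    next
      fix j k d y assume d: "d \<in> V j" and "y \<in> Jv k"
      then obtain x c where xc: "y = x + c * v" "x \<in> P k" "c = 0 \<or> (i \<le> k \<and> c \<in> V (k - i))" unfolding Jv_def by blast
      have "d * c = 0 \<or> (i \<le> j + k \<and> d * c \<in> V (j + k - i))"
        using xc(3) V_mult[OF d, of c "k - i"] by auto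
      then have "d * x + (d * c) * v \<in> Jv (j + k)" by (rule Jv[OF graded_idealD(4)[OF Pid d xc(2)]])
      then show "d * y \<in> Jv (j + k)" using xc(1) by (simp add: algebra_simps)
    qed
    moreover have sub: "P k \<subseteq> Jv k" for k using Jv[of _ k 0] by auto
    moreover have "v \<in> Jv i" using Jv[OF graded_idealD(2)[OF Pid], of 1 i] V_one by simp
    ultimately have "\<exists>a. Jv a = V a" using max[of Jv] v(2) by blast
    then obtain a where a: "Jv a = V a" by blast
    show ?thesis
    proof (intro exI[of _ a] ballI)
      fix y assume "y \<in> V a"
      then have "y \<in> Jv a" unfolding a .
      then obtain x c where "y = x + c * v" "x \<in> P a" "c = 0 \<or> (i \<le> a \<and> c \<in> V (a - i))" unfolding Jv_def by blast
      then show "\<exists>x\<in>P a. \<exists>c. y = x + c * v \<and> (c = 0 \<or> (i \<le> a \<and> c \<in> V (a - i)))" by blast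
    qed
  qed
  have prime: "v \<in> P i \<or> w \<in> P j" if vw: "v \<in> V i" "w \<in> V j" "v * w \<in> P (i + j)" for v w i j
  proof (rule ccontr)
    assume neg: "\<not> (v \<in> P i \<or> w \<in> P j)"
    obtain a where a: "\<forall>y\<in>V a. \<exists>x\<in>P a. \<exists>c. y = x + c * v \<and> (c = 0 \<or> (i \<le> a \<and> c \<in> V (a - i)))"
      using ext[OF vw(1)] neg by blast
    obtain d where d: "\<forall>y\<in>V d. \<exists>x\<in>P d. \<exists>c. y = x + c * w \<and> (c = 0 \<or> (j \<le> d \<and> c \<in> V (d - j)))"
      using ext[OF vw(2)] neg by blast
    \<comment> \<open>The ideals extended by \<open>v\<close> and by \<open>w\<close> fill the
      degrees \<open>a\<close> and \<open>d\<close>. Expanding a product of two such forms, every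
      term lies in \<open>P\<close>, the last one because \<open>v * w\<close> does.\<close>
    have "V (a + d) \<subseteq> P (a + d)"
    proof (rule V_product_span)
      show "0 \<in> P (a + d)" by (rule graded_idealD[OF Pid])
      show "\<And>x y. x \<in> P (a + d) \<Longrightarrow> y \<in> P (a + d) \<Longrightarrow> x + y \<in> P (a + d)" by (rule graded_idealD(3)[OF Pid])
      fix y z assume yz: "y \<in> V a" "z \<in> V d"
      obtain x c where xc: "x \<in> P a" "y = x + c * v" "c = 0 \<or> (i \<le> a \<and> c \<in> V (a - i))" using a yz(1) by blast
      obtain x' c' where xc': "x' \<in> P d" "z = x' + c' * w" "c' = 0 \<or> (j \<le> d \<and> c' \<in> V (d - j))" using d yz(2) by blast
      have 1: "z * x \<in> P (a + d)" using graded_idealD(4)[OF Pid yz(2) xc(1)] by (simp add: add.commute)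
      have "c * v \<in> V a" using xc(3) V_mult[OF _ vw(1), of c "a - i"] V_zero by auto
      then have 2: "(c * v) * x' \<in> P (a + d)" by (rule graded_idealD(4)[OF Pid _ xc'(1)])
      have 3: "(c * c') * (v * w) \<in> P (a + d)"
      proof (cases "c = 0 \<or> c' = 0")
        case True
        then show ?thesis using graded_idealD(2)[OF Pid] by auto
      next
        case False
        then have "c * c' \<in> V ((a - i) + (d - j))" using xc(3) xc'(3) V_mult by blast
        then have "(c * c') * (v * w) \<in> P (((a - i) + (d - j)) + (i + j))" by (rule graded_idealD(4)[OF Pid _ vw(3)])
        moreover have "((a - i) + (d - j)) + (i + j) = a + d" using False xc(3) xc'(3) by auto
        ultimately show ?thesis by simp
      qed
      have "y * z = z * x + (c * v) * x' + (c * c') * (v * w)" using xc(2) xc'(2) by (simp add: algebra_simps)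
      then show "y * z \<in> P (a + d)" using graded_idealD(3)[OF Pid graded_idealD(3)[OF Pid 1 2] 3] by simp
    qed
    then show False using Pne[of "a + d"] graded_idealD(1)[OF Pid] by blast
  qed
  have "\<exists>i\<le>n. \<xi> i \<notin> P 1"
  proof (rule ccontr)
    assume neg: "\<not> ?thesis"
    have "V (0 + 1) \<subseteq> P (0 + 1)"
    proof
      fix v assume "v \<in> V (0 + 1)"
      then obtain w where w: "\<forall>i\<le>n. w i \<in> V 0" "v = (\<Sum>i\<le>n. \<xi> i * w i)" using V_gen[of v 0] by auto
      have "(\<Sum>i\<in>I. \<xi> i * w i) \<in> P 1" if "finite I" "I \<subseteq> {..n}" for I
        using that
      proof (induction I)
        case (insert i I)
        have "w i * \<xi> i \<in> P (0 + 1)" using graded_idealD(4)[OF Pid, of "w i" 0 "\<xi> i" 1] w(1) neg insert.prems by auto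
        then show ?case using insert graded_idealD(3)[OF Pid, of "\<xi> i * w i" 1] by (simp add: mult.commute)
      qed (use graded_idealD(2)[OF Pid] in simp)
      then show "v \<in> P (0 + 1)" unfolding w(2) by simp
    qed
    then show False using Pne[of 1] graded_idealD(1)[OF Pid] by auto
  qed
  then have gp: "graded_prime P" unfolding graded_prime_def using Pid prime by blast
  have "graded_closed P" unfolding graded_closed_def
    using gp max graded_primeD(1) graded_prime_not_full by blast
  then show thesis using that JP by blast
qed

end

section \<open>Local rings and affine charts\<close>

context graded_ring
begin

definition localring :: "(nat \<Rightarrow> 'l set) \<Rightarrow> 'l set" where
  "localring P = {a / c | a c k. a \<in> V k \<and> c \<in> V k \<and> c \<notin> P k}"

definition K :: "'l set" where
  "K = localring (\<lambda>k. {0})"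

text \<open>For a nonzero form \<open>t\<close> of degree \<open>e\<close>, the union of these
  finite pieces is the coordinate ring of the affine open set \<open>t \<noteq> 0\<close>.\<close>

definition chart_piece :: "'l \<Rightarrow> nat \<Rightarrow> nat \<Rightarrow> 'l set" where
  "chart_piece t e k = (\<lambda>v. v / t ^ k) ` V (e * k)"

definition chart :: "'l \<Rightarrow> nat \<Rightarrow> 'l set" where
  "chart t e = (\<Union>k. chart_piece t e k)"

lemma localringI: "a \<in> V k \<Longrightarrow> c \<in> V k \<Longrightarrow> c \<notin> P k \<Longrightarrow> a / c \<in> localring P"
  unfolding localring_def by blast

lemma localringE:
  assumes "x \<in> localring P"
  obtains a c k where "x = a / c" "a \<in> V k" "c \<in> V k" "c \<notin> P k"
  using assms unfolding localring_def by blast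

lemma graded_prime_zero: "graded_prime (\<lambda>k. {0})"
  unfolding graded_prime_def graded_ideal_def using V_zero coord_nonzero by auto

lemma prime_nonzero: "graded_prime P \<Longrightarrow> c \<notin> P k \<Longrightarrow> c \<noteq> 0"
  using graded_idealD(2)[OF graded_primeD(1)] by blast

lemma prime_mult_notin:
  "graded_prime P \<Longrightarrow> x \<in> V j \<Longrightarrow> y \<in> V k \<Longrightarrow> x \<notin> P j \<Longrightarrow> y \<notin> P k \<Longrightarrow> x * y \<notin> P (j + k)"
  using graded_primeD(3) by blast

lemma localring_subring:
  assumes P: "graded_prime P" shows "subring_of (localring P)"
  unfolding subring_of_def
proof (intro conjI ballI)
  show "1 \<in> localring P" using localringI[of 1 0 1 P, OF V_one V_one one_notin_prime[OF P]] by simp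
  fix x y assume "x \<in> localring P" "y \<in> localring P"
  then obtain a c k a' c' k' where x: "x = a / c" "a \<in> V k" "c \<in> V k" "c \<notin> P k"
    and y: "y = a' / c'" "a' \<in> V k'" "c' \<in> V k'" "c' \<notin> P k'" by (elim localringE)
  have nz: "c \<noteq> 0" "c' \<noteq> 0" using prime_nonzero[OF P] x y by auto
  have cc: "c * c' \<in> V (k + k')" "c * c' \<notin> P (k + k')"
    using V_mult x y prime_mult_notin[OF P] by auto
  have "x - y = (a * c' - c * a') / (c * c')" using x y nz by (simp add: field_simps)
  moreover have "a * c' - c * a' \<in> V (k + k')" using V_diff V_mult x y by blast
  ultimately show "x - y \<in> localring P" using localringI[where P = P and k = "k + k'", OF _ cc] by simp
  have "x * y = (a * a') / (c * c')" using x y by simp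
  moreover have "a * a' \<in> V (k + k')" using V_mult x y by blast
  ultimately show "x * y \<in> localring P" using localringI[where P = P and k = "k + k'", OF _ cc] by simp
qed

lemma K_subring: "subring_of K"
  unfolding K_def by (rule localring_subring[OF graded_prime_zero])

lemma K_I: "a \<in> V k \<Longrightarrow> c \<in> V k \<Longrightarrow> c \<noteq> 0 \<Longrightarrow> a / c \<in> K"
  unfolding K_def by (rule localringI) auto

context
  fixes t :: 'l and e :: nat
  assumes t: "t \<in> V e" "t \<noteq> 0"
begin

lemma chartI: "v \<in> V (e * k) \<Longrightarrow> v / t ^ k \<in> chart t e"
  unfolding chart_def chart_piece_def by blast

lemma chart_pieceI: "v \<in> V (e * k) \<Longrightarrow> v / t ^ k \<in> chart_piece t e k"
  unfolding chart_piece_def by blast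

lemma chartE:
  assumes "x \<in> chart t e" obtains v k where "v \<in> V (e * k)" "x = v / t ^ k"
  using assms unfolding chart_def chart_piece_def by blast

lemma chart_piece_mono: "k \<le> k' \<Longrightarrow> chart_piece t e k \<subseteq> chart_piece t e k'"
proof
  fix x assume le: "k \<le> k'" and "x \<in> chart_piece t e k"
  then obtain v where v: "v \<in> V (e * k)" "x = v / t ^ k" unfolding chart_piece_def by blast
  have "v * t ^ (k' - k) \<in> V (e * k + e * (k' - k))" by (rule V_mult[OF v(1) V_power[OF t(1)]])
  moreover have "e * k + e * (k' - k) = e * k'" using le by (simp add: distrib_left[symmetric])
  moreover have "t ^ k' = t ^ k * t ^ (k' - k)" using le by (simp add: power_add[symmetric])
  then have "x = v * t ^ (k' - k) / t ^ k'" using v(2) t(2) by simp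
  ultimately show "x \<in> chart_piece t e k'" using chart_pieceI by simp
qed

lemma chart_subring: "subring_of (chart t e)"
  unfolding subring_of_def
proof (intro conjI ballI)
  show "1 \<in> chart t e" using chartI[of 1 0] V_one by simp
  fix x y assume "x \<in> chart t e" "y \<in> chart t e"
  then obtain v k v' k' where x: "v \<in> V (e * k)" "x = v / t ^ k" and y: "v' \<in> V (e * k')" "y = v' / t ^ k'"
    by (elim chartE)
  have "v * t ^ k' \<in> V (e * k + e * k')" by (rule V_mult[OF x(1) V_power[OF t(1)]])
  moreover have "t ^ k * v' \<in> V (e * k + e * k')" by (rule V_mult[OF V_power[OF t(1)] y(1)])
  ultimately have "v * t ^ k' - t ^ k * v' \<in> V (e * (k + k'))" using V_diff by (simp add: distrib_left)
  moreover have "x - y = (v * t ^ k' - t ^ k * v') / t ^ (k + k')" unfolding x(2) y(2) using t(2) by (simp add: power_add field_simps)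
  ultimately show "x - y \<in> chart t e" using chartI by simp
  have "v * v' \<in> V (e * (k + k'))" using V_mult[OF x(1) y(1)] by (simp add: distrib_left)
  moreover have "x * y = (v * v') / t ^ (k + k')" using x y by (simp add: power_add)
  ultimately show "x * y \<in> chart t e" using chartI by simp
qed

lemma chart_K: "chart t e \<subseteq> K"
proof
  fix x assume "x \<in> chart t e"
  then obtain v k where v: "v \<in> V (e * k)" "x = v / t ^ k" by (rule chartE)
  then show "x \<in> K" using K_I[OF v(1) V_power[OF t(1)]] t(2) by simp
qed

lemma V_0_chart: "V 0 \<subseteq> chart t e"
  using chartI[of _ 0] by auto

lemma finite_chart_piece: "finite (chart_piece t e k)"
  unfolding chart_piece_def using V_finite by simp

lemma chart_localring:
  assumes P: "graded_prime P" and tP: "t \<notin> P e"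
  shows "chart t e \<subseteq> localring P"
proof
  fix x assume "x \<in> chart t e"
  then obtain v k where v: "v \<in> V (e * k)" "x = v / t ^ k" by (rule chartE)
  have "t ^ k \<notin> P (e * k)" using power_in_prime[OF P t(1)] tP by blast
  then show "x \<in> localring P" unfolding v(2) by (rule localringI[OF v(1) V_power[OF t(1)]])
qed

context
  fixes s :: 'l and k0 :: nat
  assumes s: "s \<in> V e"
    and gen: "\<And>k v. k0 \<le> k \<Longrightarrow> v \<in> V (e * Suc k) \<Longrightarrow> \<exists>a\<in>V (e * k). \<exists>b\<in>V (e * k). v = s * a + t * b"
begin

text \<open>In high degree every form is \<open>s * a + t * b\<close>: the second part has lower
  pole order and the first is a multiple of \<open>s / t\<close>. Descending to \<open>k0\<close>
  leaves finitely many classes modulo \<open>s / t\<close>.\<close>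

lemma chart_piece_step: "x \<in> chart_piece t e k \<Longrightarrow> \<exists>x0\<in>chart_piece t e k0. \<exists>x1\<in>chart t e. x = x0 + (s / t) * x1"
proof (induction k arbitrary: x)
  case 0
  then show ?case using chart_piece_mono[of 0 k0] subring_of_zero[OF chart_subring] by force
next
  case (Suc k)
  show ?case
  proof (cases "Suc k \<le> k0")
    case True
    then show ?thesis using Suc.prems chart_piece_mono[of "Suc k" k0] subring_of_zero[OF chart_subring] by force
  next
    case False
    obtain v where v: "v \<in> V (e * Suc k)" "x = v / t ^ Suc k" using Suc.prems unfolding chart_piece_def by blast
    obtain a b where ab: "a \<in> V (e * k)" "b \<in> V (e * k)" "v = s * a + t * b" using gen[OF _ v(1)] False by force
    obtain x0 x1 where x: "x0 \<in> chart_piece t e k0" "x1 \<in> chart t e" "b / t ^ k = x0 + (s / t) * x1"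
      using Suc.IH[OF chart_pieceI[OF ab(2)]] by blast
    have "x = (s / t) * (a / t ^ k) + b / t ^ k" unfolding v(2) ab(3) using t(2) by (simp add: add_divide_distrib)
    also have "\<dots> = x0 + (s / t) * (x1 + a / t ^ k)" unfolding x(3) by (simp add: algebra_simps)
    finally show ?thesis using x(1) subring_of_add[OF chart_subring x(2) chartI[OF ab(1)]] by blast
  qed
qed

text \<open>Each further factor \<open>s / t\<close> multiplies the remainder of the previous step,
  which raises the degree of the finite part by one; hence \<open>k0 + m\<close>.\<close>

lemma chart_decomposition:
  "x \<in> chart t e \<Longrightarrow> \<exists>x0\<in>chart_piece t e (k0 + m). \<exists>x1\<in>chart t e. x = x0 + (s / t) ^ m * x1"
proof (induction m)
  case 0
  then obtain k where "x \<in> chart_piece t e k" unfolding chart_def by blast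
  obtain y0 y1 where y: "y0 \<in> chart_piece t e k0" "y1 \<in> chart t e" "x = y0 + (s / t) * y1"
    using chart_piece_step[OF \<open>x \<in> chart_piece t e k\<close>] by blast
  have "s / t \<in> chart t e" using chartI[of s 1] s by simp
  then have "(s / t) * y1 \<in> chart t e" using subring_of_mult[OF chart_subring] y(2) by blast
  then show ?case using y by auto
next
  case (Suc m)
  then obtain x0 x1 where x: "x0 \<in> chart_piece t e (k0 + m)" "x1 \<in> chart t e" "x = x0 + (s / t) ^ m * x1" by blast
  obtain k where "x1 \<in> chart_piece t e k" using x(2) unfolding chart_def by blast
  then obtain y0 y1 where y: "y0 \<in> chart_piece t e k0" "y1 \<in> chart t e" "x1 = y0 + (s / t) * y1"
    using chart_piece_step by blast
  obtain v0 where v0: "v0 \<in> V (e * (k0 + m))" "x0 = v0 / t ^ (k0 + m)" using x(1) unfolding chart_piece_def by blast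
  obtain w where w: "w \<in> V (e * k0)" "y0 = w / t ^ k0" using y(1) unfolding chart_piece_def by blast
  have "w * s ^ m \<in> V (e * (k0 + m))" using V_mult[OF w(1) V_power[OF s, of m]] by (simp add: distrib_left)
  then have vw: "v0 + w * s ^ m \<in> V (e * (k0 + m))" using v0(1) V_add by blast
  have "x0 + (s / t) ^ m * y0 = (v0 + w * s ^ m) / t ^ (k0 + m)"
    unfolding v0(2) w(2) using t(2) by (simp add: power_add power_divide field_simps)
  then have "x0 + (s / t) ^ m * y0 \<in> chart_piece t e (k0 + m)" using chart_pieceI[OF vw] by simp
  then have "x0 + (s / t) ^ m * y0 \<in> chart_piece t e (k0 + Suc m)" using chart_piece_mono[of "k0 + m" "k0 + Suc m"] by auto
  moreover have "x = (x0 + (s / t) ^ m * y0) + (s / t) ^ Suc m * y1" using x(3) y(3) by (simp add: algebra_simps)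
  ultimately show ?case using y(2) by blast
qed

text \<open>The chart ring is finite modulo \<open>(s / t) ^ m\<close>, so powers of
  \<open>b\<close> become periodic. At a zero of \<open>s\<close> where \<open>b\<close> is a unit,
  \<open>b ^ M\<close> is 1 to the order of \<open>(s / t) ^ m\<close>; at one where
  \<open>b\<close> vanishes, \<open>b ^ i\<close> is divisible by
  \<open>(s / t) ^ m\<close>.\<close>

lemma chart_powers:
  assumes b: "b \<in> chart t e"
  shows "\<exists>i M. 1 \<le> M \<and> (\<exists>w\<in>chart t e. b ^ i * (1 - b ^ M) = (s / t) ^ m * w)"
proof -
  have "\<exists>i M. 1 \<le> M \<and> b ^ i - b ^ (i + M) \<in> (*) ((s / t) ^ m) ` chart t e"
  proof (rule powers_congruent[OF finite_chart_piece])
    fix k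
    obtain x0 x1 where "x0 \<in> chart_piece t e (k0 + m)" "x1 \<in> chart t e" "b ^ k = x0 + (s / t) ^ m * x1"
      using chart_decomposition[OF subring_of_power[OF chart_subring b]] by blast
    then show "\<exists>w\<in>chart_piece t e (k0 + m). b ^ k - w \<in> (*) ((s / t) ^ m) ` chart t e" by force
  next
    fix x z assume "x \<in> (*) ((s / t) ^ m) ` chart t e" "z \<in> (*) ((s / t) ^ m) ` chart t e"
    then show "x - z \<in> (*) ((s / t) ^ m) ` chart t e"
      using subring_of_diff[OF chart_subring] by (auto simp: right_diff_distrib[symmetric])
  qed
  then obtain i M w where "1 \<le> M" "w \<in> chart t e" "b ^ i - b ^ (i + M) = (s / t) ^ m * w" by auto
  then show ?thesis by (intro exI[of _ i] exI[of _ M]) (auto simp: power_add right_diff_distrib)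
qed

end

text \<open>The prime ideal of the chart ring at the point \<open>P\<close>; when \<open>t\<close>
  does not vanish at \<open>P\<close>, membership is independent of the representation
  \<open>v / t ^ k\<close>.\<close>

definition chart_ideal :: "(nat \<Rightarrow> 'l set) \<Rightarrow> 'l set" where
  "chart_ideal P = {v / t ^ k | v k. v \<in> P (e * k)}"

context
  fixes P assumes P: "graded_prime P" and tP: "t \<notin> P e"
begin

lemma chart_ideal_iff:
  assumes v: "v \<in> V (e * k)" shows "v / t ^ k \<in> chart_ideal P \<longleftrightarrow> v \<in> P (e * k)"
proof
  assume "v / t ^ k \<in> chart_ideal P"
  then obtain v' k' where v': "v' \<in> P (e * k')" "v / t ^ k = v' / t ^ k'" unfolding chart_ideal_def by blast
  have eq: "v * t ^ k' = t ^ k * v'" using v'(2) t(2) by (simp add: field_simps)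
  have "t ^ k * v' \<in> P (e * k + e * k')" by (rule graded_idealD(4)[OF graded_primeD(1)[OF P] V_power[OF t(1)] v'(1)])
  then have "v \<in> P (e * k) \<or> t ^ k' \<in> P (e * k')"
    unfolding eq[symmetric] by (rule graded_primeD(3)[OF P v V_power[OF t(1)]])
  then show "v \<in> P (e * k)" using power_in_prime[OF P t(1)] tP by blast
qed (auto simp: chart_ideal_def)

lemma chart_ideal_prime:
  assumes "x \<in> chart t e" "y \<in> chart t e" "x * y \<in> chart_ideal P"
  shows "x \<in> chart_ideal P \<or> y \<in> chart_ideal P"
proof -
  obtain v k v' k' where x: "v \<in> V (e * k)" "x = v / t ^ k" and y: "v' \<in> V (e * k')" "y = v' / t ^ k'"
    using assms(1,2) by (elim chartE)
  have vv: "v * v' \<in> V (e * k + e * k')" by (rule V_mult[OF x(1) y(1)])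
  then have "v * v' \<in> V (e * (k + k'))" by (simp add: distrib_left)
  moreover have "x * y = (v * v') / t ^ (k + k')" using x y by (simp add: power_add)
  ultimately have "v * v' \<in> P (e * k + e * k')" using assms(3) chart_ideal_iff by (simp add: distrib_left)
  then show ?thesis using graded_primeD(3)[OF P x(1) y(1)] unfolding x(2) y(2) chart_ideal_iff[OF x(1)] chart_ideal_iff[OF y(1)] by blast
qed

lemma chart_ideal_mult:
  assumes "x \<in> chart t e" "y \<in> chart_ideal P" shows "x * y \<in> chart_ideal P"
proof -
  obtain v k where x: "v \<in> V (e * k)" "x = v / t ^ k" using assms(1) by (elim chartE)
  obtain v' k' where y: "v' \<in> P (e * k')" "y = v' / t ^ k'" using assms(2) unfolding chart_ideal_def by blast
  have "v * v' \<in> P (e * (k + k'))" using graded_idealD(4)[OF graded_primeD(1)[OF P] x(1) y(1)] by (simp add: distrib_left)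
  moreover have "x * y = (v * v') / t ^ (k + k')" using x y by (simp add: power_add)
  ultimately show ?thesis unfolding chart_ideal_def by blast
qed

lemma chart_ideal_diff:
  assumes "x \<in> chart_ideal P" "y \<in> chart_ideal P" shows "x - y \<in> chart_ideal P"
proof -
  obtain v k v' k' where x: "v \<in> P (e * k)" "x = v / t ^ k" and y: "v' \<in> P (e * k')" "y = v' / t ^ k'"
    using assms unfolding chart_ideal_def by blast
  note I = graded_idealD[OF graded_primeD(1)[OF P]]
  have "t ^ k' * v \<in> P (e * k' + e * k)" by (rule I(4)[OF V_power[OF t(1)] x(1)])
  moreover have "t ^ k * v' \<in> P (e * k + e * k')" by (rule I(4)[OF V_power[OF t(1)] y(1)])
  ultimately have "t ^ k' * v - t ^ k * v' \<in> P (e * (k + k'))" using I(6) by (simp add: distrib_left add.commute)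
  moreover have "x - y = (t ^ k' * v - t ^ k * v') / t ^ (k + k')" unfolding x(2) y(2) using t(2) by (simp add: power_add field_simps)
  ultimately show ?thesis unfolding chart_ideal_def by blast
qed

lemma one_notin_chart_ideal: "1 \<notin> chart_ideal P"
  using chart_ideal_iff[of 1 0] V_one one_notin_prime[OF P] by simp

lemma chart_ideal_power: "x \<in> chart t e \<Longrightarrow> x ^ m \<in> chart_ideal P \<Longrightarrow> x \<in> chart_ideal P"
proof (induction m)
  case 0
  then show ?case using one_notin_chart_ideal by simp
next
  case (Suc m)
  then show ?case using chart_ideal_prime[of x "x ^ m"] subring_of_power[OF chart_subring, of x m] by auto
qed

lemma inverse_localring:
  assumes "x \<in> chart t e" "x \<notin> chart_ideal P" shows "inverse x \<in> localring P"
proof -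
  obtain v k where x: "v \<in> V (e * k)" "x = v / t ^ k" using assms(1) by (elim chartE)
  then have "v \<notin> P (e * k)" using assms(2) chart_ideal_iff by simp
  then have "t ^ k / v \<in> localring P" by (rule localringI[OF V_power[OF t(1)] x(1)])
  then show ?thesis using x(2) by simp
qed

end

end

end

section \<open>Two forms without common zero\<close>

context valued_field
begin

lemma unit_power:
  assumes x: "x \<noteq> 0" "\<nu> x = 0" and d: "x ^ i * y \<in> D j"
  shows "y \<in> D j"
  using d D_scale[of "x ^ i" y j] val_power[OF x(1), of i] x by simp

lemma one_minus_power: "1 - x \<in> D j \<Longrightarrow> x \<in> D 0 \<Longrightarrow> 1 - x ^ m \<in> D j"
proof (induction m)
  case (Suc m)
  have "x * (1 - x ^ m) \<in> D (0 + j)" using Suc D_mult by blast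
  then have "(1 - x) + x * (1 - x ^ m) \<in> D j" using Suc.prems(1) D_add by simp
  then show ?case by (simp add: algebra_simps)
qed simp

lemma finite_residue_fieldI:
  assumes F: "finite F" "\<And>x. x \<in> D 0 \<Longrightarrow> \<exists>f\<in>F. x - f \<in> D 1"
  shows "\<exists>Q. finite_residue_field \<nu> Q"
proof -
  let ?c = "\<lambda>f. {y. y - f \<in> D 1}"
  obtain R where R: "R \<subseteq> F \<inter> D 0" "inj_on ?c R" "?c ` (F \<inter> D 0) = ?c ` R"
    using subset_image_inj[of "?c ` (F \<inter> D 0)" ?c "F \<inter> D 0"] by auto
  have "\<exists>r\<in>R. x - r \<in> D 1" if x: "x \<in> D 0" for x
  proof -
    obtain f where f: "f \<in> F" "x - f \<in> D 1" using F(2)[OF x] by blast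
    have "x - f \<in> D 0" using f(2) D_mono[of 0 1] by auto
    then have "x - (x - f) \<in> D 0" by (rule D_diff[OF x])
    then have "f \<in> F \<inter> D 0" using f(1) by simp
    then have "?c f \<in> ?c ` R" unfolding R(3)[symmetric] by (rule imageI)
    then obtain r where r: "r \<in> R" "?c f = ?c r" by blast
    have "x \<in> ?c f" using f(2) by simp
    then have "x \<in> ?c r" unfolding r(2) .
    then show ?thesis using r(1) by blast
  qed
  moreover have "r = r'" if "r \<in> R" "r' \<in> R" "r - r' \<in> D 1" for r r'
  proof -
    have "?c r = ?c r'" using that(3) D_trans D_diff_commute by blast
    then show ?thesis using inj_onD[OF R(2)] that by blast
  qed
  ultimately have "finite_residue_field \<nu> (card R)"
    using R(1) F(1) by unfold_locales (intro exI[of _ R], auto intro: finite_subset)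
  then show ?thesis by blast
qed

lemma finite_subset_D: "finite S \<Longrightarrow> \<exists>N::nat. S \<subseteq> D (- int N)"
proof (induction S rule: finite_induct)
  case (insert x S)
  then obtain N where N: "S \<subseteq> D (- int N)" by blast
  have "x \<in> D (- int (max N (nat (- \<nu> x))))" by (auto simp: D_def)
  moreover have "S \<subseteq> D (- int (max N (nat (- \<nu> x))))" using N D_mono[of "- int (max N (nat (- \<nu> x)))" "- int N"] by auto
  ultimately show ?case by blast
qed simp

end

section \<open>The curve at its completed place: units and forms vanishing there\<close>

locale curve_completion = graded_ring V n \<xi> + valued_field \<nu>
  for V :: "nat \<Rightarrow> 'l::field set" and n \<xi> and \<nu> :: "'l \<Rightarrow> int" +
  fixes Z :: "nat \<Rightarrow> 'l set"
  assumes Z_closed: "graded_closed Z"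
    and val_localring: "x \<in> K \<Longrightarrow> x \<noteq> 0 \<Longrightarrow> 0 \<le> \<nu> x \<longleftrightarrow> x \<in> localring Z"
    and K_dense: "\<exists>y\<in>K. x - y \<in> D j"
    and K_algebraic: "y \<in> K \<Longrightarrow> z \<in> K \<Longrightarrow> \<exists>c B a1 b1. (\<forall>a b. c a b \<in> V 0) \<and> a1 \<le> B \<and> b1 \<le> B \<and> c a1 b1 \<noteq> 0 \<and>
      (\<Sum>b\<le>B. \<Sum>a\<le>B. c a b * y ^ a * z ^ b) = 0"
begin

definition A :: "'l set" where
  "A = {x \<in> K. \<forall>P. graded_closed P \<longrightarrow> P \<noteq> Z \<longrightarrow> x \<in> localring P}"

lemma closed_prime: "graded_closed P \<Longrightarrow> graded_prime P"
  unfolding graded_closed_def by blast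

lemmas Z_prime = closed_prime[OF Z_closed]

lemma A_subring: "subring_of A"
  using K_subring localring_subring[OF closed_prime] unfolding A_def subring_of_def by blast

text \<open>\<open>J\<close> is the ideal of denominators of \<open>a\<close>. Being integral,
  \<open>a\<close> is regular at \<open>Z\<close> too, so every closed point has a denominator of
  \<open>a\<close> outside it; by the Nullstellensatz \<open>J\<close> fills some degree, and
  multiplication by \<open>a\<close> acts there.\<close>

lemma A_units:
  assumes a: "a \<in> A" "a \<noteq> 0" "0 \<le> \<nu> a"
  shows "\<nu> a = 0"
proof -
  define J where "J k = {v \<in> V k. v * a \<in> V k}" for k
  have J: "graded_ideal J"
    unfolding graded_ideal_def J_def
    using V_zero V_add V_mult by (auto simp: distrib_right mult.assoc)
  have aK: "a \<in> K" using a(1) unfolding A_def by blast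
  have loc: "a \<in> localring P" if "graded_closed P" for P
    using that a(1) val_localring[OF aK a(2)] a(3) unfolding A_def by blast
  have "\<exists>k. J k = V k"
  proof (rule ccontr)
    assume "\<not> ?thesis"
    then obtain P where P: "graded_closed P" "\<And>k. J k \<subseteq> P k" using graded_ideal_in_closed[OF J] by metis
    obtain b c k where bc: "a = b / c" "b \<in> V k" "c \<in> V k" "c \<notin> P k" using loc[OF P(1)] by (rule localringE)
    have "c * a = b" using bc(1) prime_nonzero[OF closed_prime[OF P(1)] bc(4)] by simp
    then have "c \<in> J k" unfolding J_def using bc by simp
    then show False using P(2) bc(4) by blast
  qed
  then obtain k where k: "J k = V k" by blast
  obtain i where i: "i \<le> n" "\<xi> i \<noteq> 0" using coord_nonzero by blast
  let ?v = "\<xi> i ^ k"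
  have v: "?v \<in> V k" "?v \<noteq> 0" using V_power[OF coord[OF i(1)], of k] i by auto
  have av: "a ^ m * ?v \<in> V k" for m
  proof (induction m)
    case (Suc m)
    then have "a ^ m * ?v \<in> J k" using k by simp
    then show ?case unfolding J_def by (simp add: mult_ac)
  qed (use v in simp)
  have "\<exists>i M. 1 \<le> M \<and> a ^ i - a ^ (i + M) \<in> {0}"
  proof (rule powers_congruent[of "(\<lambda>x. x / ?v) ` V k"])
    show "finite ((\<lambda>x. x / ?v) ` V k)" using V_finite by simp
    show "\<exists>w\<in>(\<lambda>x. x / ?v) ` V k. a ^ m - w \<in> {0}" for m
      using av[of m] v(2) by (intro bexI[of _ "(a ^ m * ?v) / ?v"] image_eqI[of _ _ "a ^ m * ?v"]) auto
  qed simp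
  then obtain i M where "1 \<le> M" "a ^ i = a ^ (i + M)" by auto
  then have "int i * \<nu> a = int (i + M) * \<nu> a" using val_power[OF a(2)] by metis
  then show ?thesis using \<open>1 \<le> M\<close> by (simp add: algebra_simps)
qed

text \<open>The valuation is known on \<open>K\<close> only through its ring
  \<open>localring Z\<close>; positivity is detected by asking whether the inverse
  \<open>w / v\<close> also belongs to that ring.\<close>

lemma val_notin_Z:
  assumes "v \<in> V k" "w \<in> V k" "w \<notin> Z k" "v \<noteq> 0"
  shows "0 \<le> \<nu> (v / w)" "0 < \<nu> (v / w) \<longleftrightarrow> v \<in> Z k"
proof -
  have w0: "w \<noteq> 0" using prime_nonzero[OF Z_prime assms(3)] .
  have K: "v / w \<in> K" "w / v \<in> K" using K_I assms w0 by auto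
  have ne: "v / w \<noteq> 0" "w / v \<noteq> 0" using assms w0 by auto
  have neg: "\<nu> (w / v) = - \<nu> (v / w)" using val_divide assms(4) w0 by simp
  have "v / w \<in> localring Z" by (rule localringI[where P = Z, OF assms(1-3)])
  then show nn: "0 \<le> \<nu> (v / w)" using val_localring[OF K(1) ne(1)] by simp
  show "0 < \<nu> (v / w) \<longleftrightarrow> v \<in> Z k"
  proof
    assume pos: "0 < \<nu> (v / w)"
    show "v \<in> Z k"
    proof (rule ccontr)
      assume "v \<notin> Z k"
      then have "w / v \<in> localring Z" by (rule localringI[where P = Z, OF assms(2,1)])
      then show False using val_localring[OF K(2) ne(2)] neg pos by simp
    qed
  next
    assume vZ: "v \<in> Z k"
    show "0 < \<nu> (v / w)"
    proof (rule ccontr)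
      assume "\<not> 0 < \<nu> (v / w)"
      then have "0 \<le> \<nu> (w / v)" using neg by simp
      then have "w / v \<in> localring Z" using val_localring[OF K(2) ne(2)] by simp
      then obtain a c j where ac: "w / v = a / c" "a \<in> V j" "c \<in> V j" "c \<notin> Z j" by (rule localringE)
      have "w * c = a * v" using ac(1) assms(4) prime_nonzero[OF Z_prime ac(4)] by (simp add: field_simps)
      moreover have "a * v \<in> Z (j + k)" by (rule graded_idealD(4)[OF graded_primeD(1)[OF Z_prime] ac(2) vZ])
      ultimately have "w * c \<in> Z (k + j)" by (simp add: add.commute)
      then show False using graded_primeD(3)[OF Z_prime assms(2) ac(3)] assms(3) ac(4) by blast
    qed
  qed
qed

text \<open>Otherwise \<open>Z\<close> is the generic point, its local ring is all of
  \<open>K\<close>, and \<open>\<nu>\<close> is nonnegative on \<open>K\<close>, against density and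
  surjectivity.\<close>

lemma exists_form_vanishing_at_Z: "\<exists>k. \<exists>s\<in>Z k. s \<noteq> 0"
proof (rule ccontr)
  assume "\<not> ?thesis"
  then have "Z = (\<lambda>k. {0})" using graded_idealD(2)[OF graded_primeD(1)[OF Z_prime]] by blast
  then have loc: "localring Z = K" unfolding K_def by simp
  obtain x where x: "x \<noteq> 0" "\<nu> x = - 1" using val_surj by blast
  obtain y where y: "y \<in> K" "x - y \<in> D (\<nu> x + 1)" using K_dense by blast
  have "y \<noteq> 0 \<and> \<nu> y = \<nu> x" using val_eq_of_diff[OF x(1) y(2)] .
  then show False using val_localring[OF y(1)] loc y(1) x(2) by simp
qed

lemma power_diff_in_ideal:
  assumes J: "graded_ideal J" and x: "x \<in> V 1" and y: "y \<in> V 1" and d: "x ^ N - y ^ N \<in> J N"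
  shows "x ^ (N * c) - y ^ (N * c) \<in> J (N * c)"
proof (induction c)
  case 0
  then show ?case using graded_idealD(2)[OF J] by simp
next
  case (Suc c)
  have 1: "x ^ N * (x ^ (N * c) - y ^ (N * c)) \<in> J (N + N * c)"
    using graded_idealD(4)[OF J _ Suc, of "x ^ N" N] V_power[OF x, of N] by simp
  have 2: "y ^ (N * c) * (x ^ N - y ^ N) \<in> J (N * c + N)"
    using graded_idealD(4)[OF J _ d, of "y ^ (N * c)" "N * c"] V_power[OF y, of "N * c"] by simp
  have "x ^ (N * Suc c) - y ^ (N * Suc c) = x ^ N * (x ^ (N * c) - y ^ (N * c)) + y ^ (N * c) * (x ^ N - y ^ N)"
    by (simp add: power_add algebra_simps)
  then show ?case using graded_idealD(3)[OF J 1, of "y ^ (N * c) * (x ^ N - y ^ N)"] 2 by (simp add: add.commute)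
qed

text \<open>Transcendence degree one makes the ratios of the coordinates algebraic over the finite constant
  field modulo a nonzero form \<open>s\<close>, so at the zeros of \<open>s\<close> they are \<open>0\<close>, \<open>\<infinity>\<close> or roots of unity of bounded order.\<close>

lemma coordinate_powers_pair:
  assumes s: "s \<in> V e0" "s \<noteq> 0" and ij: "i \<le> n" "j \<le> n"
  shows "\<exists>N\<ge>1. \<forall>P. graded_prime P \<longrightarrow> s \<in> P e0 \<longrightarrow> \<xi> i \<in> P 1 \<or> \<xi> j \<in> P 1 \<or> \<xi> i ^ N - \<xi> j ^ N \<in> P N"
proof (cases "\<xi> j = 0")
  case True
  then show ?thesis using graded_idealD(2)[OF graded_primeD(1)] by (intro exI[of _ 1]) auto
next
  case False
  let ?x = "\<xi> i" and ?t = "\<xi> j"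
  have t: "?t \<in> V 1" "?t \<noteq> 0" and x: "?x \<in> V 1" using coord ij False by auto
  let ?y = "?x / ?t" and ?z = "s / ?t ^ e0"
  have yz: "?y \<in> chart ?t 1" "?z \<in> chart ?t 1" "?z \<noteq> 0"
    using chartI[OF t, of ?x 1] chartI[OF t, of s e0] x s t by auto
  obtain c B a1 b1 where c: "\<forall>a b. c a b \<in> V 0" "a1 \<le> B" "b1 \<le> B" "c a1 b1 \<noteq> 0"
    "(\<Sum>b\<le>B. \<Sum>a\<le>B. c a b * ?y ^ a * ?z ^ b) = 0"
    using K_algebraic[OF subsetD[OF chart_K[OF t] yz(1)] subsetD[OF chart_K[OF t] yz(2)]]
    by (elim exE conjE) (rule that; assumption)
  have "\<exists>i M. 1 \<le> M \<and> ?y ^ i - ?y ^ (i + M) \<in> (*) ?z ` chart ?t 1"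
    by (rule algebraic_powers_congruent[OF chart_subring[OF t] V_0_subring V_0_chart[OF t] V_finite V_inverse yz
      c(1)[rule_format] c(2,3,4,5)])
  then obtain a M r where M: "1 \<le> M" "r \<in> chart ?t 1" "?y ^ a - ?y ^ (a + M) = ?z * r" by auto
  obtain v l where v: "v \<in> V (1 * l)" "r = v / ?t ^ l" using chartE[OF t M(2)] .
  \<comment> \<open>The congruence for \<open>?y\<close> modulo \<open>?z\<close> with denominators
    cleared. The right side is a multiple of \<open>s\<close>, so at a zero of \<open>s\<close> one
    of the three factors on the left vanishes.\<close>
  have key: "?x ^ a * ((?t ^ M - ?x ^ M) * ?t ^ (e0 + l)) = (v * ?t ^ (a + M)) * s"
  proof -
    have "(?y ^ a - ?y ^ (a + M)) * ?t ^ (a + M + e0 + l) = (?z * r) * ?t ^ (a + M + e0 + l)" using M(3) by simp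
    moreover have "(?y ^ a - ?y ^ (a + M)) * ?t ^ (a + M + e0 + l) = ?x ^ a * ((?t ^ M - ?x ^ M) * ?t ^ (e0 + l))"
      using t(2) by (simp add: power_add power_divide field_simps)
    moreover have "(?z * r) * ?t ^ (a + M + e0 + l) = (v * ?t ^ (a + M)) * s"
      unfolding v(2) using t(2) by (simp add: power_add field_simps)
    ultimately show ?thesis by simp
  qed
  have "?x \<in> P 1 \<or> ?t \<in> P 1 \<or> ?x ^ M - ?t ^ M \<in> P M" if P: "graded_prime P" "s \<in> P e0" for P
  proof -
    note I = graded_idealD[OF graded_primeD(1)[OF P(1)]]
    have pw: "?x ^ m \<in> V m" "?t ^ m \<in> V m" for m using V_power[OF x, of m] V_power[OF t(1), of m] by auto
    have "v * ?t ^ (a + M) \<in> V (l + (a + M))" using V_mult[OF v(1) pw(2)[of "a + M"]] by simp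
    then have "(v * ?t ^ (a + M)) * s \<in> P (l + (a + M) + e0)" by (rule I(4)[OF _ P(2)])
    then have "?x ^ a * ((?t ^ M - ?x ^ M) * ?t ^ (e0 + l)) \<in> P (a + (M + (e0 + l)))"
      unfolding key by (simp add: algebra_simps)
    moreover have tx: "?t ^ M - ?x ^ M \<in> V M" using V_diff pw by blast
    moreover have "(?t ^ M - ?x ^ M) * ?t ^ (e0 + l) \<in> V (M + (e0 + l))" by (rule V_mult[OF tx pw(2)])
    ultimately have "?x ^ a \<in> P a \<or> (?t ^ M - ?x ^ M) * ?t ^ (e0 + l) \<in> P (M + (e0 + l))"
      using graded_primeD(3)[OF P(1) pw(1)] by blast
    then have "?x ^ a \<in> P a \<or> ?t ^ M - ?x ^ M \<in> P M \<or> ?t ^ (e0 + l) \<in> P (e0 + l)"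
      using graded_primeD(3)[OF P(1) tx pw(2)] by blast
    then show ?thesis using power_in_prime[OF P(1) x, of a] power_in_prime[OF P(1) t(1), of "e0 + l"] I(5)[of "?t ^ M - ?x ^ M" M] by auto
  qed
  then show ?thesis using M(1) by blast
qed

text \<open>The product of the exponents for all pairs is a common multiple of them, and congruence
  of powers passes to multiples of the exponent.\<close>

lemma coordinate_powers:
  assumes s: "s \<in> V e0" "s \<noteq> 0"
  obtains N where "1 \<le> N" "\<And>P i j. graded_prime P \<Longrightarrow> s \<in> P e0 \<Longrightarrow> i \<le> n \<Longrightarrow> j \<le> n \<Longrightarrow>
      \<xi> i \<in> P 1 \<or> \<xi> j \<in> P 1 \<or> \<xi> i ^ N - \<xi> j ^ N \<in> P N"
proof -
  have "\<forall>i j. \<exists>N. i \<le> n \<longrightarrow> j \<le> n \<longrightarrow> (1 \<le> N \<and> (\<forall>P. graded_prime P \<longrightarrow> s \<in> P e0 \<longrightarrow> \<xi> i \<in> P 1 \<or> \<xi> j \<in> P 1 \<or> \<xi> i ^ N - \<xi> j ^ N \<in> P N))"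
    using coordinate_powers_pair[OF s] by blast
  then obtain M where M: "\<And>i j. i \<le> n \<Longrightarrow> j \<le> n \<Longrightarrow> 1 \<le> M i j"
    "\<And>i j P. i \<le> n \<Longrightarrow> j \<le> n \<Longrightarrow> graded_prime P \<Longrightarrow> s \<in> P e0 \<Longrightarrow> \<xi> i \<in> P 1 \<or> \<xi> j \<in> P 1 \<or> \<xi> i ^ M i j - \<xi> j ^ M i j \<in> P (M i j)"
    by metis
  define N where "N = (\<Prod>i\<le>n. \<Prod>j\<le>n. M i j)"
  have dv: "M i j dvd N" if "i \<le> n" "j \<le> n" for i j
  proof -
    have "M i j dvd (\<Prod>j\<le>n. M i j)" using that by (intro dvd_prodI) auto
    also have "\<dots> dvd N" unfolding N_def using that by (intro dvd_prodI[of _ _ "\<lambda>i. \<Prod>j\<le>n. M i j"]) auto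
    finally show ?thesis .
  qed
  have "M i j \<noteq> 0" if "i \<le> n" "j \<le> n" for i j using M(1)[OF that] by simp
  then have "N \<noteq> 0" unfolding N_def by (simp add: prod_zero_iff)
  show thesis
  proof (rule that[of N])
    show "1 \<le> N" using \<open>N \<noteq> 0\<close> by simp
    fix P i j assume P: "graded_prime P" "s \<in> P e0" and ij: "i \<le> n" "j \<le> n"
    obtain c where c: "N = M i j * c" using dv[OF ij] by blast
    show "\<xi> i \<in> P 1 \<or> \<xi> j \<in> P 1 \<or> \<xi> i ^ N - \<xi> j ^ N \<in> P N"
      using M(2)[OF ij P] power_diff_in_ideal[OF graded_primeD(1)[OF P(1)] coord[OF ij(1)] coord[OF ij(2)], of "M i j" c] unfolding c by blast
  qed
qed

lemma ideal_power_pos: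
  assumes J: "graded_ideal J" and x: "x \<in> J 1" and m: "1 \<le> m"
  shows "x ^ m \<in> J m"
proof -
  have "x ^ (m - 1) \<in> V (m - 1)" using V_power[OF graded_idealD(1)[OF J x], of "m - 1"] by simp
  then have "x ^ (m - 1) * x \<in> J (m - 1 + 1)" by (rule graded_idealD(4)[OF J _ x])
  then show ?thesis using m by (simp add: power_Suc2[symmetric] del: power_Suc)
qed

text \<open>Up to powers the coordinates take only the values \<open>0\<close> and one common value at a zero of \<open>s\<close>.
  The recursion \<open>T (T - c) + c\<^sup>2\<close> preserves this and vanishes only if both \<open>T\<close> and \<open>c\<close> do.\<close>

lemma complementary_form:
  assumes s: "s \<in> V e0" "s \<noteq> 0"
  obtains t d where "1 \<le> d" "t \<in> V d" "\<And>P. graded_prime P \<Longrightarrow> s \<in> P e0 \<Longrightarrow> t \<notin> P d"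
proof -
  obtain N where N: "1 \<le> N" "\<And>P i j. graded_prime P \<Longrightarrow> s \<in> P e0 \<Longrightarrow> i \<le> n \<Longrightarrow> j \<le> n \<Longrightarrow>
      \<xi> i \<in> P 1 \<or> \<xi> j \<in> P 1 \<or> \<xi> i ^ N - \<xi> j ^ N \<in> P N"
    by (rule coordinate_powers[OF s]) blast
  have main: "i \<le> n \<Longrightarrow> \<exists>T\<in>V (N * 2 ^ i). \<forall>P. graded_prime P \<longrightarrow> s \<in> P e0 \<longrightarrow>
      (T \<in> P (N * 2 ^ i) \<longrightarrow> (\<forall>l\<le>i. \<xi> l \<in> P 1)) \<and>
      (T \<notin> P (N * 2 ^ i) \<longrightarrow> (\<forall>j\<le>n. \<xi> j \<notin> P 1 \<longrightarrow> T - \<xi> j ^ (N * 2 ^ i) \<in> P (N * 2 ^ i)))" for i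
  proof (induction i)
    case 0
    have x: "\<xi> 0 \<in> V 1" using coord by simp
    have "\<xi> 0 ^ N \<in> V N" using V_power[OF x, of N] by simp
    moreover have "(\<xi> 0 ^ N \<in> P N \<longrightarrow> \<xi> 0 \<in> P 1) \<and> (\<xi> 0 ^ N \<notin> P N \<longrightarrow> (\<forall>j\<le>n. \<xi> j \<notin> P 1 \<longrightarrow> \<xi> 0 ^ N - \<xi> j ^ N \<in> P N))"
      if P: "graded_prime P" "s \<in> P e0" for P
      using power_in_prime[OF P(1) x, of N] ideal_power_pos[OF graded_primeD(1)[OF P(1)] _ N(1), of "\<xi> 0"] N(2)[OF P, of 0] by auto
    ultimately show ?case by (intro bexI[of _ "\<xi> 0 ^ N"]) auto
  next
    case (Suc i)
    let ?d = "N * 2 ^ i" and ?x = "\<xi> (Suc i)"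
    obtain T where T: "T \<in> V ?d" "\<And>P. graded_prime P \<Longrightarrow> s \<in> P e0 \<Longrightarrow> T \<in> P ?d \<Longrightarrow> (\<forall>l\<le>i. \<xi> l \<in> P 1)"
      "\<And>P j. graded_prime P \<Longrightarrow> s \<in> P e0 \<Longrightarrow> T \<notin> P ?d \<Longrightarrow> j \<le> n \<Longrightarrow> \<xi> j \<notin> P 1 \<Longrightarrow> T - \<xi> j ^ ?d \<in> P ?d"
      using Suc by force
    have x: "?x \<in> V 1" using coord Suc.prems by blast
    let ?c = "?x ^ ?d"
    have c: "?c \<in> V ?d" using V_power[OF x, of ?d] by simp
    have dd: "N * 2 ^ Suc i = ?d + ?d" by simp
    have d1: "1 \<le> ?d" using N(1) by simp
    let ?T = "T * (T - ?c) + ?c * ?c"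
    have Tc: "T - ?c \<in> V ?d" using V_diff T(1) c by blast
    have T': "?T \<in> V (?d + ?d)" using V_add V_mult T(1) Tc c by blast
    have pw2: "\<xi> j ^ (?d + ?d) = \<xi> j ^ ?d * \<xi> j ^ ?d" for j by (rule power_add)
    \<comment> \<open>If \<open>?x\<close> vanishes at \<open>P\<close>, the new form is the square
      of \<open>T\<close> there. If not, \<open>T\<close> is 0 or the common value
      \<open>?c\<close>, so \<open>T * (T - ?c)\<close> vanishes and the new form is the square of
      \<open>?c\<close>, which is nonzero.\<close>
    have "(?T \<in> P (?d + ?d) \<longrightarrow> (\<forall>l\<le>Suc i. \<xi> l \<in> P 1)) \<and>
      (?T \<notin> P (?d + ?d) \<longrightarrow> (\<forall>j\<le>n. \<xi> j \<notin> P 1 \<longrightarrow> ?T - \<xi> j ^ (?d + ?d) \<in> P (?d + ?d)))"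
      if P: "graded_prime P" "s \<in> P e0" for P
    proof (cases "?x \<in> P 1")
      case True
      note I = graded_idealD[OF graded_primeD(1)[OF P(1)]]
      have cP: "?c \<in> P ?d" by (rule ideal_power_pos[OF graded_primeD(1)[OF P(1)] True d1])
      have "(?c - T) * ?c \<in> P (?d + ?d)" by (rule I(4)[OF V_diff[OF c T(1)] cP])
      then have e: "?T - T * T \<in> P (?d + ?d)" by (simp add: algebra_simps)
      have "?T \<in> P (?d + ?d) \<longrightarrow> (\<forall>l\<le>Suc i. \<xi> l \<in> P 1)"
      proof
        assume "?T \<in> P (?d + ?d)"
        then have "?T - (?T - T * T) \<in> P (?d + ?d)" using I(6) e by blast
        then have "T * T \<in> P (?d + ?d)" by simp
        then have "T \<in> P ?d" using graded_primeD(3)[OF P(1) T(1) T(1)] by blast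
        then show "\<forall>l\<le>Suc i. \<xi> l \<in> P 1" using T(2)[OF P] True by (auto simp: le_Suc_eq)
      qed
      moreover have "?T - \<xi> j ^ (?d + ?d) \<in> P (?d + ?d)" if nT: "?T \<notin> P (?d + ?d)" and j: "j \<le> n" "\<xi> j \<notin> P 1" for j
      proof -
        have "T \<notin> P ?d"
        proof
          assume "T \<in> P ?d"
          then have "T * T \<in> P (?d + ?d)" by (rule I(4)[OF T(1)])
          then have "(?T - T * T) + T * T \<in> P (?d + ?d)" by (rule I(3)[OF e])
          then show False using nT by simp
        qed
        then have "T - \<xi> j ^ ?d \<in> P ?d" using T(3)[OF P] j by blast
        moreover have "T + \<xi> j ^ ?d \<in> V ?d" using V_add[OF T(1)] V_power[OF coord[OF j(1)], of ?d] by simp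
        ultimately have "(T + \<xi> j ^ ?d) * (T - \<xi> j ^ ?d) \<in> P (?d + ?d)" using I(4) by blast
        then have "(?T - T * T) + (T + \<xi> j ^ ?d) * (T - \<xi> j ^ ?d) \<in> P (?d + ?d)" by (rule I(3)[OF e])
        then show ?thesis unfolding pw2 by (simp add: algebra_simps)
      qed
      ultimately show ?thesis by blast
    next
      case False
      note I = graded_idealD[OF graded_primeD(1)[OF P(1)]]
      have "T * (T - ?c) \<in> P (?d + ?d)"
      proof (cases "T \<in> P ?d")
        case True
        have "(T - ?c) * T \<in> P (?d + ?d)" by (rule I(4)[OF Tc True])
        then show ?thesis by (simp add: mult.commute)
      next
        case nT: False
        show ?thesis by (rule I(4)[OF T(1) T(3)[OF P nT Suc.prems False]])
      qed
      then have e: "?T - ?c * ?c \<in> P (?d + ?d)" by simp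
      have "?c \<notin> P ?d" using power_in_prime[OF P(1) x, of ?d] False by auto
      then have cc: "?c * ?c \<notin> P (?d + ?d)" by (rule prime_mult_notin[OF P(1) c c]) fact
      have "?T \<notin> P (?d + ?d)"
      proof
        assume "?T \<in> P (?d + ?d)"
        then have "?T - (?T - ?c * ?c) \<in> P (?d + ?d)" using I(6) e by blast
        then show False using cc by simp
      qed
      moreover have "?T - \<xi> j ^ (?d + ?d) \<in> P (?d + ?d)" if j: "j \<le> n" "\<xi> j \<notin> P 1" for j
      proof -
        have "?x ^ N - \<xi> j ^ N \<in> P N" using N(2)[OF P Suc.prems j(1)] False j(2) by blast
        then have "?x ^ (N * 2 ^ Suc i) - \<xi> j ^ (N * 2 ^ Suc i) \<in> P (N * 2 ^ Suc i)"
          by (rule power_diff_in_ideal[OF graded_primeD(1)[OF P(1)] x coord[OF j(1)]])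
        then have "?c * ?c - \<xi> j ^ (?d + ?d) \<in> P (?d + ?d)" unfolding dd by (simp only: power_add)
        then have "(?T - ?c * ?c) + (?c * ?c - \<xi> j ^ (?d + ?d)) \<in> P (?d + ?d)" by (rule I(3)[OF e])
        then show ?thesis by (simp add: algebra_simps)
      qed
      ultimately show ?thesis by blast
    qed
    then show ?case unfolding dd using T' by blast
  qed
  obtain T where T: "T \<in> V (N * 2 ^ n)" and T0: "\<forall>P. graded_prime P \<longrightarrow> s \<in> P e0 \<longrightarrow>
      (T \<in> P (N * 2 ^ n) \<longrightarrow> (\<forall>l\<le>n. \<xi> l \<in> P 1)) \<and>
      (T \<notin> P (N * 2 ^ n) \<longrightarrow> (\<forall>j\<le>n. \<xi> j \<notin> P 1 \<longrightarrow> T - \<xi> j ^ (N * 2 ^ n) \<in> P (N * 2 ^ n)))"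
    by (rule bexE[OF main[OF order_refl]])
  show thesis
  proof (rule that[of "N * 2 ^ n" T])
    show "1 \<le> N * 2 ^ n" using N(1) by simp
    show "T \<in> V (N * 2 ^ n)" by (rule T)
    fix P assume P: "graded_prime P" "s \<in> P e0"
    obtain l where "l \<le> n" "\<xi> l \<notin> P 1" using graded_primeD(2)[OF P(1)] by blast
    then show "T \<notin> P (N * 2 ^ n)" using T0[rule_format, OF P, THEN conjunct1] by blast
  qed
qed

text \<open>The powers \<open>s ^ d\<close> and \<open>t ^ e0\<close> have equal degree and the same
  zeros as \<open>s\<close> and \<open>t\<close>. Having no common zero, they generate all forms of
  high degree by the Nullstellensatz.\<close>

lemma two_forms:
  obtains \<sigma> \<tau> e k0 where "\<sigma> \<in> Z e" "\<sigma> \<noteq> 0" "\<tau> \<in> V e" "\<tau> \<noteq> 0"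
    "\<And>P. graded_prime P \<Longrightarrow> \<sigma> \<in> P e \<Longrightarrow> \<tau> \<notin> P e" "1 \<le> e"
    "\<And>k v. k0 \<le> k \<Longrightarrow> v \<in> V (e * Suc k) \<Longrightarrow> \<exists>a\<in>V (e * k). \<exists>b\<in>V (e * k). v = \<sigma> * a + \<tau> * b"
proof -
  note ZI = graded_idealD[OF graded_primeD(1)[OF Z_prime]]
  obtain e0 s where s: "s \<in> Z e0" "s \<noteq> 0" using exists_form_vanishing_at_Z by blast
  have sV: "s \<in> V e0" using ZI(1) s(1) by blast
  \<comment> \<open>\<open>V 0\<close> is a field, so a nonzero element of degree 0 in
    \<open>Z\<close> would put 1 into \<open>Z\<close>.\<close>
  have e0: "1 \<le> e0"
  proof (rule ccontr)
    assume "\<not> 1 \<le> e0"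
    then have "e0 = 0" by simp
    then have "inverse s * s \<in> Z (0 + 0)" using ZI(4)[OF V_inverse, of s s 0] s(1) sV by simp
    then show False using s(2) one_notin_prime[OF Z_prime] by simp
  qed
  obtain t d where t: "1 \<le> d" "t \<in> V d" "\<And>P. graded_prime P \<Longrightarrow> s \<in> P e0 \<Longrightarrow> t \<notin> P d"
    by (rule complementary_form[OF sV s(2)]) blast
  define e where "e = e0 * d"
  define \<sigma> where "\<sigma> = s ^ d"
  define \<tau> where "\<tau> = t ^ e0"
  have e1: "1 \<le> e" unfolding e_def using e0 t(1) by simp
  have \<sigma>V: "\<sigma> \<in> V e" unfolding \<sigma>_def e_def by (rule V_power[OF sV])
  have \<tau>V: "\<tau> \<in> V e" unfolding \<tau>_def e_def using V_power[OF t(2), of e0] by (simp add: mult.commute)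
  have \<sigma>Z: "\<sigma> \<in> Z e"
  proof -
    have "s ^ (d - 1) \<in> V (e0 * (d - 1))" by (rule V_power[OF sV])
    then have "s ^ (d - 1) * s \<in> Z (e0 * (d - 1) + e0)" by (rule ZI(4)[OF _ s(1)])
    moreover have "e0 * (d - 1) + e0 = e" unfolding e_def using t(1) by (cases d) auto
    moreover have "s ^ (d - 1) * s = \<sigma>" unfolding \<sigma>_def using t(1) by (simp add: power_Suc2[symmetric] del: power_Suc)
    ultimately show ?thesis by simp
  qed
  have disj: "\<tau> \<notin> P e" if P: "graded_prime P" "\<sigma> \<in> P e" for P
  proof
    assume "\<tau> \<in> P e"
    then have "t \<in> P d" using power_in_prime[OF P(1) t(2), of e0] unfolding \<tau>_def e_def by (simp add: mult.commute)
    moreover have "s \<in> P e0" using power_in_prime[OF P(1) sV, of d] P(2) unfolding \<sigma>_def e_def by simp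
    ultimately show False using t(3)[OF P(1)] by blast
  qed
  have \<tau>0: "\<tau> \<noteq> 0" using prime_nonzero[OF Z_prime disj[OF Z_prime \<sigma>Z]] .
  define J where "J k = {\<sigma> * a + \<tau> * b | a b. (e \<le> k \<and> a \<in> V (k - e) \<and> b \<in> V (k - e)) \<or> (a = 0 \<and> b = 0)}" for k
  have JI: "\<sigma> * a + \<tau> * b \<in> J k" if "(e \<le> k \<and> a \<in> V (k - e) \<and> b \<in> V (k - e)) \<or> (a = 0 \<and> b = 0)" for a b k
    unfolding J_def using that by blast
  have J: "graded_ideal J"
    unfolding graded_ideal_def
  proof (intro conjI allI ballI subsetI)
    fix k
    show "0 \<in> J k" using JI[of k 0 0] by simp
    {
      fix x assume "x \<in> J k"
      then obtain a b where x: "x = \<sigma> * a + \<tau> * b" "(e \<le> k \<and> a \<in> V (k - e) \<and> b \<in> V (k - e)) \<or> (a = 0 \<and> b = 0)"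
        unfolding J_def by blast
      then show "x \<in> V k"
      proof (cases "a = 0 \<and> b = 0")
        case True
        then show ?thesis using x(1) V_zero by simp
      next
        case False
        then have ab: "e \<le> k" "a \<in> V (k - e)" "b \<in> V (k - e)" using x(2) by auto
        show ?thesis unfolding x(1) using V_add V_mult[OF \<sigma>V ab(2)] V_mult[OF \<tau>V ab(3)] ab(1) by simp
      qed
    }
    fix x y assume "x \<in> J k" "y \<in> J k"
    then obtain a b a' b' where x: "x = \<sigma> * a + \<tau> * b" "(e \<le> k \<and> a \<in> V (k - e) \<and> b \<in> V (k - e)) \<or> (a = 0 \<and> b = 0)"
      and y: "y = \<sigma> * a' + \<tau> * b'" "(e \<le> k \<and> a' \<in> V (k - e) \<and> b' \<in> V (k - e)) \<or> (a' = 0 \<and> b' = 0)"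
      unfolding J_def by blast
    have "(e \<le> k \<and> a + a' \<in> V (k - e) \<and> b + b' \<in> V (k - e)) \<or> (a + a' = 0 \<and> b + b' = 0)"
      using x(2) y(2) V_add by auto
    then have "\<sigma> * (a + a') + \<tau> * (b + b') \<in> J k" by (rule JI)
    then show "x + y \<in> J k" unfolding x(1) y(1) by (simp add: algebra_simps)
  next
    fix j k c x assume c: "c \<in> V j" and "x \<in> J k"
    then obtain a b where x: "x = \<sigma> * a + \<tau> * b" "(e \<le> k \<and> a \<in> V (k - e) \<and> b \<in> V (k - e)) \<or> (a = 0 \<and> b = 0)"
      unfolding J_def by blast
    have "(e \<le> j + k \<and> c * a \<in> V (j + k - e) \<and> c * b \<in> V (j + k - e)) \<or> (c * a = 0 \<and> c * b = 0)"
      using x(2) V_mult[OF c, of a "k - e"] V_mult[OF c, of b "k - e"] by auto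
    then have "\<sigma> * (c * a) + \<tau> * (c * b) \<in> J (j + k)" by (rule JI)
    then show "c * x \<in> J (j + k)" unfolding x(1) by (simp add: algebra_simps)
  qed
  have "\<exists>k. J k = V k"
  proof (rule ccontr)
    assume "\<not> ?thesis"
    then obtain P where P: "graded_closed P" "\<And>k. J k \<subseteq> P k" using graded_ideal_in_closed[OF J] by metis
    have "\<sigma> \<in> J e" "\<tau> \<in> J e" using JI[of e 1 0] JI[of e 0 1] V_one V_zero by simp_all
    then show False using P(2) disj[OF closed_prime[OF P(1)]] by blast
  qed
  then obtain k1 where k1: "J k1 = V k1" by blast
  show thesis
  proof (rule that[of \<sigma> e \<tau> k1])
    show "\<sigma> \<in> Z e" "\<tau> \<in> V e" "\<tau> \<noteq> 0" "1 \<le> e" by fact+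
    show "\<And>P. graded_prime P \<Longrightarrow> \<sigma> \<in> P e \<Longrightarrow> \<tau> \<notin> P e" by (rule disj)
    show "\<sigma> \<noteq> 0" unfolding \<sigma>_def using s(2) by simp
    fix k v assume k: "k1 \<le> k" and v: "v \<in> V (e * Suc k)"
    have "k1 \<le> e * Suc k" using k e1 by (metis One_nat_def le_SucI mult_le_mono nat_mult_1)
    then have "v \<in> J (e * Suc k)" using graded_ideal_full[OF J k1] v by simp
    then obtain a b where ab: "v = \<sigma> * a + \<tau> * b" "(e \<le> e * Suc k \<and> a \<in> V (e * Suc k - e) \<and> b \<in> V (e * Suc k - e)) \<or> (a = 0 \<and> b = 0)"
      unfolding J_def by blast
    then have "a \<in> V (e * k) \<and> b \<in> V (e * k)" using V_zero by auto
    then show "\<exists>a\<in>V (e * k). \<exists>b\<in>V (e * k). v = \<sigma> * a + \<tau> * b" using ab(1) by blast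
  qed
qed

end

section \<open>Cocompactness\<close>

context curve_completion
begin

context
  fixes \<sigma> \<tau> :: 'l and e k0 :: nat
  assumes \<sigma>Z: "\<sigma> \<in> Z e" and \<sigma>0: "\<sigma> \<noteq> 0" and \<tau>V: "\<tau> \<in> V e" and \<tau>0: "\<tau> \<noteq> 0"
    and disj: "\<And>P. graded_prime P \<Longrightarrow> \<sigma> \<in> P e \<Longrightarrow> \<tau> \<notin> P e" and e1: "1 \<le> e"
    and gen: "\<And>k v. k0 \<le> k \<Longrightarrow> v \<in> V (e * Suc k) \<Longrightarrow> \<exists>a\<in>V (e * k). \<exists>b\<in>V (e * k). v = \<sigma> * a + \<tau> * b"
begin

abbreviation (input) "chart_ring \<equiv> chart \<tau> e"
abbreviation (input) "u \<equiv> \<sigma> / \<tau>"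

lemma \<sigma>V: "\<sigma> \<in> V e" using graded_idealD(1)[OF graded_primeD(1)[OF Z_prime] \<sigma>Z] .

lemma \<tau>Z: "\<tau> \<notin> Z e" using disj[OF Z_prime \<sigma>Z] .

lemma gen': "k0 \<le> k \<Longrightarrow> v \<in> V (e * Suc k) \<Longrightarrow> \<exists>a\<in>V (e * k). \<exists>b\<in>V (e * k). v = \<tau> * a + \<sigma> * b"
  using gen[of k v] by (metis add.commute)

lemmas B_subring = chart_subring[OF \<tau>V \<tau>0]

lemma B_powers:
  assumes b: "b \<in> chart_ring"
  shows "\<exists>i M. 1 \<le> M \<and> (\<exists>w\<in>chart_ring. b ^ i * (1 - b ^ M) = u ^ m * w)"
proof (rule chart_powers[OF \<tau>V \<tau>0 \<sigma>V _ b, of k0])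
  show "\<And>k v. k0 \<le> k \<Longrightarrow> v \<in> V (e * Suc k) \<Longrightarrow> \<exists>a\<in>V (e * k). \<exists>b\<in>V (e * k). v = \<sigma> * a + \<tau> * b" by (rule gen)
qed

lemma B_decomposition:
  assumes x: "x \<in> chart_ring"
  shows "\<exists>x0\<in>chart_piece \<tau> e (k0 + m). \<exists>x1\<in>chart_ring. x = x0 + u ^ m * x1"
proof (rule chart_decomposition[OF \<tau>V \<tau>0 \<sigma>V _ x, of k0])
  show "\<And>k v. k0 \<le> k \<Longrightarrow> v \<in> V (e * Suc k) \<Longrightarrow> \<exists>a\<in>V (e * k). \<exists>b\<in>V (e * k). v = \<sigma> * a + \<tau> * b" by (rule gen)
qed

lemma R_decomposition:
  assumes x: "x \<in> chart \<sigma> e"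
  shows "\<exists>x0\<in>chart_piece \<sigma> e (k0 + m). \<exists>x1\<in>chart \<sigma> e. x = x0 + (\<tau> / \<sigma>) ^ m * x1"
proof (rule chart_decomposition[OF \<sigma>V \<sigma>0 \<tau>V _ x, of k0])
  show "\<And>k v. k0 \<le> k \<Longrightarrow> v \<in> V (e * Suc k) \<Longrightarrow> \<exists>a\<in>V (e * k). \<exists>b\<in>V (e * k). v = \<tau> * a + \<sigma> * b" by (rule gen')
qed

lemma B_val:
  assumes "x \<in> chart_ring" shows "x \<in> D 0" "x \<in> D 1 \<longleftrightarrow> x \<in> chart_ideal \<tau> e Z"
proof -
  obtain v k where v: "v \<in> V (e * k)" "x = v / \<tau> ^ k" by (rule chartE[OF \<tau>V \<tau>0 assms])
  have tk: "\<tau> ^ k \<in> V (e * k)" "\<tau> ^ k \<notin> Z (e * k)"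
    using V_power[OF \<tau>V] power_in_prime[OF Z_prime \<tau>V] \<tau>Z by blast+
  have "x \<in> D 0 \<and> (x \<in> D 1 \<longleftrightarrow> v \<in> Z (e * k))"
  proof (cases "v = 0")
    case True
    then show ?thesis using v(2) graded_idealD(2)[OF graded_primeD(1)[OF Z_prime]] by simp
  next
    case False
    have "x \<noteq> 0" using v(2) False \<tau>0 by simp
    moreover have "0 \<le> \<nu> x" "0 < \<nu> x \<longleftrightarrow> v \<in> Z (e * k)"
      unfolding v(2) by (rule val_notin_Z[OF v(1) tk False])+
    ultimately show ?thesis by (auto simp: D_def)
  qed
  then show "x \<in> D 0" "x \<in> D 1 \<longleftrightarrow> x \<in> chart_ideal \<tau> e Z"
    using chart_ideal_iff[OF \<tau>V \<tau>0 Z_prime \<tau>Z v(1)] v(2) by auto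
qed

lemma u_B: "u \<in> chart_ring"
  using chartI[OF \<tau>V \<tau>0, of \<sigma> 1] \<sigma>V by simp

lemma u_val: "1 \<le> \<nu> u"
proof -
  have "\<sigma> / \<tau> ^ 1 \<in> chart_ideal \<tau> e Z"
    using chart_ideal_iff[OF \<tau>V \<tau>0 Z_prime \<tau>Z, of \<sigma> 1] \<sigma>V \<sigma>Z by simp
  then have "u \<in> chart_ideal \<tau> e Z" by simp
  then have "u \<in> D 1" using B_val(2)[OF u_B] by blast
  then show ?thesis using \<sigma>0 \<tau>0 by (simp add: D_def)
qed

lemma u_power_D:
  assumes "x \<in> D 0" shows "u ^ m * x \<in> D (int m)"
proof -
  have u0: "u \<noteq> 0" using \<sigma>0 \<tau>0 by simp
  have "int m \<le> int m * \<nu> u" using u_val by (simp add: mult_le_cancel_left1)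
  then have "u ^ m \<in> D (int m)" unfolding D_def using val_power[OF u0, of m] by simp
  then show ?thesis using D_mult[OF _ assms] by fastforce
qed

lemma B_localring: "graded_prime P \<Longrightarrow> \<sigma> \<in> P e \<Longrightarrow> chart_ring \<subseteq> localring P"
  using chart_localring[OF \<tau>V \<tau>0] disj by blast

text \<open>An integral element of \<open>K\<close> is a quotient \<open>\<alpha> / \<beta>\<close>
  of chart functions with \<open>\<beta>\<close> a unit at \<open>Z\<close>. Some power
  \<open>\<beta> ^ M\<close> is 1 to order \<open>m\<close>, so \<open>\<beta> ^ (M - 1)\<close>
  serves as the inverse.\<close>

lemma B_approx:
  assumes y: "y \<in> D 0" shows "\<exists>x\<in>chart_ring. y - x \<in> D (int m)"
proof -
  obtain y' where y': "y' \<in> K" "y - y' \<in> D (int m)" using K_dense by blast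
  have "y - y' \<in> D 0" using y'(2) D_mono[of 0 "int m"] by auto
  then have "y - (y - y') \<in> D 0" by (rule D_diff[OF y])
  then have y'0: "y' \<in> D 0" by simp
  have "\<exists>x\<in>chart_ring. y' - x \<in> D (int m)"
  proof (cases "y' = 0")
    case True
    then show ?thesis using subring_of_zero[OF B_subring] by (intro bexI[of _ 0]) simp_all
  next
    case False
    then have "y' \<in> localring Z" using val_localring[OF y'(1) False] y'0 by (simp add: D_def)
    then obtain a c j where ac: "y' = a / c" "a \<in> V j" "c \<in> V j" "c \<notin> Z j" by (rule localringE)
    have c0: "c \<noteq> 0" using prime_nonzero[OF Z_prime ac(4)] .
    \<comment> \<open>Numerator and denominator are multiplied by \<open>c ^ (e - 1)\<close> to
      reach a degree divisible by \<open>e\<close>.\<close>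
    define \<alpha> where "\<alpha> = a * c ^ (e - 1) / \<tau> ^ j"
    define \<beta> where "\<beta> = c ^ e / \<tau> ^ j"
    have "a * c ^ (e - 1) \<in> V (j + j * (e - 1))" by (rule V_mult[OF ac(2) V_power[OF ac(3)]])
    moreover have "j + j * (e - 1) = e * j" using e1 by (cases e) (auto simp: mult.commute)
    ultimately have av: "a * c ^ (e - 1) \<in> V (e * j)" by simp
    have cv: "c ^ e \<in> V (e * j)" using V_power[OF ac(3), of e] by (simp add: mult.commute)
    have \<alpha>B: "\<alpha> \<in> chart_ring" unfolding \<alpha>_def by (rule chartI[OF \<tau>V \<tau>0 av])
    have \<beta>B: "\<beta> \<in> chart_ring" unfolding \<beta>_def by (rule chartI[OF \<tau>V \<tau>0 cv])
    have "c ^ e \<notin> Z (e * j)" using power_in_prime[OF Z_prime ac(3), of e] ac(4) by (auto simp: mult.commute)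
    then have "\<beta> \<notin> chart_ideal \<tau> e Z" unfolding \<beta>_def using chart_ideal_iff[OF \<tau>V \<tau>0 Z_prime \<tau>Z cv] by blast
    then have \<beta>1: "\<beta> \<notin> D 1" using B_val(2)[OF \<beta>B] by blast
    have \<beta>D: "\<beta> \<in> D 0" by (rule B_val(1)[OF \<beta>B])
    have \<beta>0: "\<beta> \<noteq> 0" using \<beta>1 by auto
    have \<beta>\<nu>: "\<nu> \<beta> = 0" using \<beta>1 \<beta>D \<beta>0 by (simp add: D_def)
    have "c ^ e = c * c ^ (e - 1)" using e1 by (cases e) auto
    then have y\<beta>: "y' = \<alpha> / \<beta>" unfolding ac(1) \<alpha>_def \<beta>_def using c0 \<tau>0 by (simp add: field_simps)
    obtain i M w where M: "1 \<le> M" "w \<in> chart_ring" "\<beta> ^ i * (1 - \<beta> ^ M) = u ^ m * w"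
      using B_powers[OF \<beta>B, of m] by blast
    have "\<beta> ^ i * (1 - \<beta> ^ M) \<in> D (int m)" unfolding M(3) by (rule u_power_D[OF B_val(1)[OF M(2)]])
    then have "1 - \<beta> ^ M \<in> D (int m)" by (rule unit_power[OF \<beta>0 \<beta>\<nu>])
    then have "y' * (1 - \<beta> ^ M) \<in> D (0 + int m)" by (rule D_mult[OF y'0])
    moreover have "\<beta> ^ M = \<beta> * \<beta> ^ (M - 1)" using M(1) by (cases M) auto
    then have "y' * (1 - \<beta> ^ M) = y' - \<alpha> * \<beta> ^ (M - 1)" unfolding y\<beta> using \<beta>0 by (simp add: field_simps)
    ultimately have "y' - \<alpha> * \<beta> ^ (M - 1) \<in> D (int m)" by simp
    then show ?thesis using subring_of_mult[OF B_subring \<alpha>B subring_of_power[OF B_subring \<beta>B]] by blast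
  qed
  then show ?thesis using D_trans[OF y'(2)] by blast
qed

text \<open>The witness is a product of factors \<open>1 - b\<^sup>M\<close>; at each zero of \<open>\<sigma>\<close> such a factor is \<open>1\<close> or \<open>0\<close>
  according as \<open>b\<close> vanishes there or not.\<close>

lemma separating_element:
  obtains \<epsilon> where "\<epsilon> \<in> chart_ring" "1 - \<epsilon> \<in> D 1"
    "\<And>P. graded_closed P \<Longrightarrow> P \<noteq> Z \<Longrightarrow> \<sigma> \<in> P e \<Longrightarrow> \<epsilon> \<in> chart_ideal \<tau> e P"
proof -
  \<comment> \<open>A finite set that represents, modulo \<open>u\<close>, every chart function
    vanishing at \<open>Z\<close>.\<close>
  define F where "F = {b \<in> chart_piece \<tau> e (k0 + 1). b \<in> D 1}"
  have finF: "finite F" unfolding F_def using finite_chart_piece[OF \<tau>V \<tau>0] by simp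
  have FB: "b \<in> chart_ring" if "b \<in> F" for b using that unfolding F_def chart_def by blast
  have "\<forall>b. \<exists>i M w. b \<in> F \<longrightarrow> 1 \<le> M \<and> w \<in> chart_ring \<and> b ^ i * (1 - b ^ M) = u ^ 1 * w"
    using B_powers[of _ 1] FB by blast
  then obtain i M w where M: "\<And>b. b \<in> F \<Longrightarrow> 1 \<le> M b" "\<And>b. b \<in> F \<Longrightarrow> w b \<in> chart_ring"
    "\<And>b. b \<in> F \<Longrightarrow> b ^ i b * (1 - b ^ M b) = u ^ 1 * w b" by metis
  define \<epsilon> where "\<epsilon> = (\<Prod>b\<in>F. 1 - b ^ M b)"
  have fB: "1 - b ^ M b \<in> chart_ring" if "b \<in> F" for b
    using subring_of_diff[OF B_subring subring_of_one[OF B_subring] subring_of_power[OF B_subring FB[OF that]]] .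
  have "1 - (\<Prod>b\<in>G. 1 - b ^ M b) \<in> D 1" if "finite G" "G \<subseteq> F" for G
    using that
  proof (induction G)
    case (insert b G)
    let ?p = "\<Prod>b\<in>G. 1 - b ^ M b"
    have "?p \<in> D 0" using subring_of_prod[OF B_subring, of G "\<lambda>b. 1 - b ^ M b"] fB insert.prems B_val(1) by blast
    moreover have "b ^ M b \<in> D 1"
    proof -
      have b: "b \<in> F" using insert.prems by blast
      have "b * b ^ (M b - 1) \<in> D (1 + 0)"
        by (rule D_mult) (use b D_power[OF B_val(1)[OF FB[OF b]]] in \<open>auto simp: F_def\<close>)
      moreover have "b ^ M b = b * b ^ (M b - 1)" using M(1)[OF b] by (cases "M b") auto
      ultimately show ?thesis by simp
    qed
    ultimately have "b ^ M b * ?p \<in> D (1 + 0)" using D_mult by blast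
    then have "(1 - ?p) + b ^ M b * ?p \<in> D 1" using insert D_add by simp
    then show ?case using insert by (simp add: algebra_simps)
  qed simp
  then have 1: "1 - \<epsilon> \<in> D 1" unfolding \<epsilon>_def using finF by blast
  have \<epsilon>B: "\<epsilon> \<in> chart_ring" unfolding \<epsilon>_def by (rule subring_of_prod[OF B_subring fB])
  have "\<epsilon> \<in> chart_ideal \<tau> e P" if P: "graded_closed P" "P \<noteq> Z" "\<sigma> \<in> P e" for P
  proof -
    note Pp = closed_prime[OF P(1)]
    note tP = disj[OF Pp P(3)]
    note cp = chart_ideal_prime[OF \<tau>V \<tau>0 Pp tP]
    \<comment> \<open>Distinct closed points: some form vanishes at \<open>Z\<close> but not at
      \<open>P\<close>. Its chart function \<open>b0\<close> may be replaced by a member of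
      \<open>F\<close>, because the difference is a multiple of \<open>u\<close>, which vanishes at
      both points.\<close>
    have "\<not> (\<forall>k. Z k \<subseteq> P k)" using Z_closed Pp P(2) unfolding graded_closed_def by blast
    then obtain k p where p: "p \<in> Z k" "p \<notin> P k" by blast
    note ZI = graded_idealD[OF graded_primeD(1)[OF Z_prime]]
    have pV: "p \<in> V k" by (rule ZI(1)[OF p(1)])
    have peV: "p ^ e \<in> V (e * k)" using V_power[OF pV, of e] by (simp add: mult.commute)
    define b0 where "b0 = p ^ e / \<tau> ^ k"
    have b0B: "b0 \<in> chart_ring" unfolding b0_def by (rule chartI[OF \<tau>V \<tau>0 peV])
    have "p ^ (e - 1) * p \<in> Z (k * (e - 1) + k)" by (rule ZI(4)[OF V_power[OF pV] p(1)])
    moreover have "k * (e - 1) + k = e * k" "p ^ (e - 1) * p = p ^ e" using e1 by (cases e; auto simp: mult.commute)+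
    ultimately have "p ^ e \<in> Z (e * k)" by simp
    then have "b0 \<in> chart_ideal \<tau> e Z" unfolding b0_def by (rule chart_ideal_iff[OF \<tau>V \<tau>0 Z_prime \<tau>Z peV, THEN iffD2])
    then have b0D: "b0 \<in> D 1" using B_val(2)[OF b0B] by blast
    have "p ^ e \<notin> P (e * k)" using power_in_prime[OF Pp pV, of e] p(2) by (auto simp: mult.commute)
    then have b0P: "b0 \<notin> chart_ideal \<tau> e P" unfolding b0_def using chart_ideal_iff[OF \<tau>V \<tau>0 Pp tP peV] by blast
    obtain b z where bz: "b \<in> chart_piece \<tau> e (k0 + 1)" "z \<in> chart_ring" "b0 = b + u ^ 1 * z" using B_decomposition[OF b0B, of 1] by blast
    have "u ^ 1 * z \<in> D (int 1)" by (rule u_power_D[OF B_val(1)[OF bz(2)]])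
    then have "b0 - u ^ 1 * z \<in> D 1" using D_diff[OF b0D] by simp
    then have bF: "b \<in> F" unfolding F_def using bz(1,3) by simp
    have "\<sigma> / \<tau> ^ 1 \<in> chart_ideal \<tau> e P"
      using chart_ideal_iff[OF \<tau>V \<tau>0 Pp tP, of \<sigma> 1] \<sigma>V P(3) by simp
    then have uP: "u \<in> chart_ideal \<tau> e P" by simp
    have uzP: "u ^ 1 * z' \<in> chart_ideal \<tau> e P" if "z' \<in> chart_ring" for z'
      using chart_ideal_mult[OF \<tau>V \<tau>0 Pp tP that uP] by (simp add: mult.commute)
    have bP: "b \<notin> chart_ideal \<tau> e P"
    proof
      assume "b \<in> chart_ideal \<tau> e P"
      moreover have "0 - u ^ 1 * z \<in> chart_ideal \<tau> e P"
        using uzP[OF subring_of_minus[OF B_subring bz(2)]] by simp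
      ultimately have "b - (0 - u ^ 1 * z) \<in> chart_ideal \<tau> e P" by (rule chart_ideal_diff[OF \<tau>V \<tau>0 Pp tP])
      then show False using b0P bz(3) by simp
    qed
    have "b ^ i b * (1 - b ^ M b) \<in> chart_ideal \<tau> e P" unfolding M(3)[OF bF] by (rule uzP[OF M(2)[OF bF]])
    then have "b ^ i b \<in> chart_ideal \<tau> e P \<or> 1 - b ^ M b \<in> chart_ideal \<tau> e P"
      by (rule cp[OF subring_of_power[OF B_subring FB[OF bF]] fB[OF bF]])
    then have "1 - b ^ M b \<in> chart_ideal \<tau> e P" using chart_ideal_power[OF \<tau>V \<tau>0 Pp tP FB[OF bF]] bP by blast
    moreover have "(\<Prod>b\<in>F - {b}. 1 - b ^ M b) \<in> chart_ring" by (rule subring_of_prod[OF B_subring fB]) blast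
    ultimately have "(\<Prod>b\<in>F - {b}. 1 - b ^ M b) * (1 - b ^ M b) \<in> chart_ideal \<tau> e P"
      using chart_ideal_mult[OF \<tau>V \<tau>0 Pp tP] by blast
    then show ?thesis unfolding \<epsilon>_def using prod.remove[OF finF bF, of "\<lambda>b. 1 - b ^ M b"] by (simp add: mult.commute)
  qed
  then show thesis using that \<epsilon>B 1 by blast
qed

text \<open>The power \<open>\<epsilon> ^ (M * i)\<close> acts as an idempotent. At \<open>Z\<close>
  it is 1 to order \<open>m\<close>; at the other zeros of \<open>\<sigma>\<close> the factor
  \<open>1 - \<epsilon> ^ M\<close> is a unit, so \<open>\<epsilon> ^ i\<close> is divisible by
  \<open>u ^ m\<close>.\<close>

lemma simultaneous_approx:
  assumes y: "y \<in> D 0"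
  shows "\<exists>x\<in>chart_ring. y - x \<in> D (int m) \<and>
    (\<forall>P. graded_closed P \<longrightarrow> P \<noteq> Z \<longrightarrow> \<sigma> \<in> P e \<longrightarrow> (\<exists>z\<in>localring P. x = u ^ m * z))"
proof -
  obtain \<epsilon> where \<epsilon>: "\<epsilon> \<in> chart_ring" "1 - \<epsilon> \<in> D 1"
    "\<And>P. graded_closed P \<Longrightarrow> P \<noteq> Z \<Longrightarrow> \<sigma> \<in> P e \<Longrightarrow> \<epsilon> \<in> chart_ideal \<tau> e P"
    by (rule separating_element) blast
  obtain yB where yB: "yB \<in> chart_ring" "y - yB \<in> D (int m)" using B_approx[OF y] by blast
  obtain i M w where M: "1 \<le> M" "w \<in> chart_ring" "\<epsilon> ^ i * (1 - \<epsilon> ^ M) = u ^ m * w"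
    using B_powers[OF \<epsilon>(1), of m] by blast
  have "\<epsilon> \<noteq> 0 \<and> \<nu> \<epsilon> = \<nu> 1" using val_eq_of_diff[of 1 \<epsilon>] \<epsilon>(2) by simp
  then have \<epsilon>0: "\<epsilon> \<noteq> 0" "\<nu> \<epsilon> = 0" by auto
  have "\<epsilon> ^ i * (1 - \<epsilon> ^ M) \<in> D (int m)" unfolding M(3) by (rule u_power_D[OF B_val(1)[OF M(2)]])
  then have "1 - \<epsilon> ^ M \<in> D (int m)" by (rule unit_power[OF \<epsilon>0])
  then have "1 - (\<epsilon> ^ M) ^ i \<in> D (int m)" by (rule one_minus_power) (rule D_power[OF B_val(1)[OF \<epsilon>(1)]])
  then have "yB * (1 - (\<epsilon> ^ M) ^ i) \<in> D (0 + int m)" by (rule D_mult[OF B_val(1)[OF yB(1)]])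
  then have "(y - yB) + yB * (1 - (\<epsilon> ^ M) ^ i) \<in> D (int m)" using D_add[OF yB(2)] by simp
  then have 1: "y - yB * (\<epsilon> ^ M) ^ i \<in> D (int m)" by (simp add: algebra_simps)
  have 2: "yB * (\<epsilon> ^ M) ^ i \<in> chart_ring"
    by (intro subring_of_mult[OF B_subring] subring_of_power[OF B_subring] yB(1) \<epsilon>(1))
  have "\<exists>z\<in>localring P. yB * (\<epsilon> ^ M) ^ i = u ^ m * z" if P: "graded_closed P" "P \<noteq> Z" "\<sigma> \<in> P e" for P
  proof -
    note Pp = closed_prime[OF P(1)]
    note tP = disj[OF Pp P(3)]
    note L = localring_subring[OF Pp]
    have BL: "x \<in> localring P" if "x \<in> chart_ring" for x using B_localring[OF Pp P(3)] that by blast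
    have "1 - \<epsilon> ^ M \<in> chart_ring" by (intro subring_of_diff[OF B_subring] subring_of_one[OF B_subring] subring_of_power[OF B_subring] \<epsilon>(1))
    moreover have nz: "1 - \<epsilon> ^ M \<notin> chart_ideal \<tau> e P"
    proof
      assume a: "1 - \<epsilon> ^ M \<in> chart_ideal \<tau> e P"
      have "\<epsilon> ^ (M - 1) * \<epsilon> \<in> chart_ideal \<tau> e P"
        by (rule chart_ideal_mult[OF \<tau>V \<tau>0 Pp tP subring_of_power[OF B_subring \<epsilon>(1)] \<epsilon>(3)[OF P]])
      moreover have "\<epsilon> ^ (M - 1) * \<epsilon> = \<epsilon> ^ M" using M(1) by (cases M) auto
      ultimately have "\<epsilon> ^ M \<in> chart_ideal \<tau> e P" by simp
      moreover have "0 \<in> chart_ideal \<tau> e P" using chart_ideal_diff[OF \<tau>V \<tau>0 Pp tP a a] by simp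
      ultimately have "0 - \<epsilon> ^ M \<in> chart_ideal \<tau> e P" by (intro chart_ideal_diff[OF \<tau>V \<tau>0 Pp tP])
      then have "(1 - \<epsilon> ^ M) - (0 - \<epsilon> ^ M) \<in> chart_ideal \<tau> e P" by (rule chart_ideal_diff[OF \<tau>V \<tau>0 Pp tP a])
      then show False using one_notin_chart_ideal[OF \<tau>V \<tau>0 Pp tP] by simp
    qed
    ultimately have inv: "inverse (1 - \<epsilon> ^ M) \<in> localring P" by (rule inverse_localring[OF \<tau>V \<tau>0 Pp tP])
    have "1 - \<epsilon> ^ M \<noteq> 0"
    proof
      assume z: "1 - \<epsilon> ^ M = 0"
      have "0 = 0 / \<tau> ^ 0" by simp
      moreover have "0 / \<tau> ^ 0 \<in> chart_ideal \<tau> e P" unfolding chart_ideal_def[OF \<tau>V \<tau>0]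
        using graded_idealD(2)[OF graded_primeD(1)[OF Pp]] by blast
      ultimately show False using nz z by simp
    qed
    then have "\<epsilon> ^ i = (\<epsilon> ^ i * (1 - \<epsilon> ^ M)) * inverse (1 - \<epsilon> ^ M)"
      by (simp only: mult.assoc right_inverse mult_1_right not_False_eq_True)
    then have "\<epsilon> ^ i = u ^ m * (w * inverse (1 - \<epsilon> ^ M))" unfolding M(3) by (simp only: mult.assoc)
    moreover have "(\<epsilon> ^ M) ^ i = \<epsilon> ^ i * \<epsilon> ^ (M * i - i)"
    proof -
      have "M * i = i + (M * i - i)" using M(1) by simp
      then show ?thesis by (metis power_add power_mult)
    qed
    ultimately have "yB * (\<epsilon> ^ M) ^ i = u ^ m * (yB * \<epsilon> ^ (M * i - i) * (w * inverse (1 - \<epsilon> ^ M)))" by (simp only: mult_ac)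
    moreover have "yB * \<epsilon> ^ (M * i - i) * (w * inverse (1 - \<epsilon> ^ M)) \<in> localring P"
      by (intro subring_of_mult[OF L] BL yB(1) M(2) inv subring_of_power[OF B_subring] \<epsilon>(1))
    ultimately show ?thesis by blast
  qed
  then show ?thesis using 1 2 by blast
qed

lemma residue_cover: "x \<in> D 0 \<Longrightarrow> \<exists>f\<in>chart_piece \<tau> e (k0 + 1). x - f \<in> D 1"
proof -
  assume "x \<in> D 0"
  then obtain y where y: "y \<in> chart_ring" "x - y \<in> D (int 1)" using B_approx by blast
  obtain f z where f: "f \<in> chart_piece \<tau> e (k0 + 1)" "z \<in> chart_ring" "y = f + u ^ 1 * z" using B_decomposition[OF y(1), of 1] by blast
  have "u ^ 1 * z \<in> D (int 1)" by (rule u_power_D[OF B_val(1)[OF f(2)]])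
  then have "(x - y) + u ^ 1 * z \<in> D 1" using D_add[OF y(2)] by simp
  then show ?thesis using f by (intro bexI[of _ f]) (simp_all add: algebra_simps)
qed

text \<open>Finiteness of the first cohomology in elementary form, with the charts of
  \<open>\<sigma>\<close> and \<open>\<tau>\<close>. Near every \<open>x\<close> there is a function
  with the required behaviour at the zeros of \<open>\<sigma>\<close>, but with bounded poles along
  \<open>\<tau> = 0\<close>. These poles fall into finitely many classes, and each is cancelled by
  one fixed function.\<close>

lemma cocompact: "\<exists>N::nat. \<forall>x. \<exists>a\<in>A. x - a \<in> D (- int N)"
proof -
  let ?R = "chart \<sigma> e"
  note R_subring = chart_subring[OF \<sigma>V \<sigma>0]
  have u0: "u \<noteq> 0" using \<sigma>0 \<tau>0 by simp
  \<comment> \<open>Functions that are regular at the zeros of \<open>\<sigma>\<close> other than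
    \<open>Z\<close> and whose poles along \<open>\<tau> = 0\<close> are at most those of
    \<open>u ^ k0\<close>.\<close>
  define A' where "A' = {a. (\<exists>r\<in>?R. a = u ^ k0 * r) \<and> (\<forall>P. graded_closed P \<longrightarrow> P \<noteq> Z \<longrightarrow> \<sigma> \<in> P e \<longrightarrow> a \<in> localring P)}"
  have approx: "\<exists>a\<in>A'. x - a \<in> D 0" for x
  proof -
    define m where "m = nat (- \<nu> x)"
    have "x * u ^ m \<in> D 0"
    proof (cases "x = 0")
      case False
      have "int m \<le> int m * \<nu> u" using u_val by (simp add: mult_le_cancel_left1)
      moreover have "\<nu> (x * u ^ m) = \<nu> x + int m * \<nu> u" using val_mult[OF False] val_power[OF u0] u0 by simp
      ultimately show ?thesis unfolding D_def m_def by auto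
    qed simp
    \<comment> \<open>The later division by \<open>u ^ m\<close> costs exactly
      \<open>m * \<nu> u\<close> in precision.\<close>
    define m2 where "m2 = m * nat (\<nu> u)"
    have m2: "m \<le> m2" "int m2 = int m * \<nu> u" unfolding m2_def using u_val by auto
    obtain x1 where x1: "x1 \<in> chart_ring" "x * u ^ m - x1 \<in> D (int m2)"
      "\<And>P. graded_closed P \<Longrightarrow> P \<noteq> Z \<Longrightarrow> \<sigma> \<in> P e \<Longrightarrow> \<exists>z\<in>localring P. x1 = u ^ m2 * z"
      using simultaneous_approx[OF \<open>x * u ^ m \<in> D 0\<close>, of m2] by blast
    \<comment> \<open>Dropping \<open>u ^ m * z\<close> lowers the degree of the numerator to
      \<open>k0 + m\<close>, so after division by \<open>u ^ m\<close> only the poles of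
      \<open>u ^ k0\<close> remain along \<open>\<tau> = 0\<close>. The discarded \<open>z\<close>
      is regular at all zeros of \<open>\<sigma>\<close>.\<close>
    obtain x' z where x': "x' \<in> chart_piece \<tau> e (k0 + m)" "z \<in> chart_ring" "x1 = x' + u ^ m * z" using B_decomposition[OF x1(1), of m] by blast
    obtain v where v: "v \<in> V (e * (k0 + m))" "x' = v / \<tau> ^ (k0 + m)" using x'(1) unfolding chart_piece_def by blast
    let ?a = "x' / u ^ m"
    have um: "u ^ m \<noteq> 0" using u0 by simp
    have a2: "?a = x1 / u ^ m - z" unfolding x'(3) using um by (simp add: add_divide_distrib)
    have "(x * u ^ m - x1) / u ^ m \<in> D 0" using x1(2) D_divide[OF um, of "x * u ^ m - x1" 0] val_power[OF u0, of m] m2(2) by simp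
    then have "(x * u ^ m - x1) / u ^ m + z \<in> D 0" using D_add B_val(1)[OF x'(2)] by blast
    moreover have "x - ?a = (x * u ^ m - x1) / u ^ m + z" unfolding a2 using um by (simp add: diff_divide_distrib)
    ultimately have "x - ?a \<in> D 0" by simp
    moreover have "?a \<in> A'" unfolding A'_def
    proof (intro CollectI conjI allI impI)
      have "?a = u ^ k0 * (v / \<sigma> ^ (k0 + m))" unfolding v(2) using \<sigma>0 \<tau>0 by (simp add: power_add power_divide field_simps)
      then show "\<exists>r\<in>?R. ?a = u ^ k0 * r" using chartI[OF \<sigma>V \<sigma>0 v(1)] by blast
      fix P assume P: "graded_closed P" "P \<noteq> Z" "\<sigma> \<in> P e"
      note Pp = closed_prime[OF P(1)]
      note L = localring_subring[OF Pp]
      have BL: "x \<in> localring P" if "x \<in> chart_ring" for x using B_localring[OF Pp P(3)] that by blast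
      obtain z2 where z2: "z2 \<in> localring P" "x1 = u ^ m2 * z2" using x1(3)[OF P] by blast
      have "u ^ m2 = u ^ m * u ^ (m2 - m)" using m2(1) by (simp add: power_add[symmetric] del: power_divide)
      then have "x1 = u ^ m * (u ^ (m2 - m) * z2)" unfolding z2(2) by (simp only: mult.assoc)
      then have "x1 / u ^ m = u ^ (m2 - m) * z2" by (simp only: nonzero_mult_div_cancel_left[OF um])
      moreover have "u ^ (m2 - m) * z2 \<in> localring P"
        by (intro subring_of_mult[OF L] z2(1) BL subring_of_power[OF B_subring] u_B)
      ultimately show "?a \<in> localring P" unfolding a2 using subring_of_diff[OF L] BL[OF x'(2)] by simp
    qed
    ultimately show ?thesis by blast
  qed
  \<comment> \<open>Modulo the chart ring of \<open>\<sigma>\<close>, every element of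
    \<open>A'\<close> is \<open>u ^ k0 * w\<close> with \<open>w\<close> in this finite set, since
    \<open>u ^ k0\<close> cancels \<open>(\<tau> / \<sigma>) ^ k0\<close>.\<close>
  define W where "W = chart_piece \<sigma> e (k0 + k0)"
  have finW: "finite W" unfolding W_def by (rule finite_chart_piece[OF \<sigma>V \<sigma>0])
  have WR: "\<exists>w\<in>W. a - u ^ k0 * w \<in> ?R" if "a \<in> A'" for a
  proof -
    obtain r where r: "r \<in> ?R" "a = u ^ k0 * r" using \<open>a \<in> A'\<close> unfolding A'_def by blast
    obtain w r' where w: "w \<in> W" "r' \<in> ?R" "r = w + (\<tau> / \<sigma>) ^ k0 * r'" unfolding W_def using R_decomposition[OF r(1), of k0] by blast
    have "a - u ^ k0 * w = (u * (\<tau> / \<sigma>)) ^ k0 * r'" unfolding r(2) w(3) by (simp add: power_mult_distrib algebra_simps del: power_divide times_divide_times_eq times_divide_eq_right times_divide_eq_left)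
    also have "u * (\<tau> / \<sigma>) = 1" using \<sigma>0 \<tau>0 by simp
    finally have "a - u ^ k0 * w = r'" by simp
    then show ?thesis using w by auto
  qed
  \<comment> \<open>One fixed element of \<open>A'\<close> in each attained class, and an arbitrary
    value otherwise. There are finitely many values on \<open>W\<close>, which gives the bound
    \<open>N\<close>.\<close>
  define \<rho> where "\<rho> w = (SOME a. a \<in> A' \<and> a - u ^ k0 * w \<in> ?R)" for w
  have \<rho>: "\<rho> w \<in> A' \<and> \<rho> w - u ^ k0 * w \<in> ?R" if "a \<in> A'" "a - u ^ k0 * w \<in> ?R" for a w
    unfolding \<rho>_def by (rule someI[of _ a]) (use that in blast)
  obtain N :: nat where N: "\<rho> ` W \<subseteq> D (- int N)" using finite_subset_D[of "\<rho> ` W"] finW by auto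
  have "\<exists>a\<in>A. x - a \<in> D (- int N)" for x
  proof -
    obtain a' where a': "a' \<in> A'" "x - a' \<in> D 0" using approx by blast
    obtain w where w: "w \<in> W" "a' - u ^ k0 * w \<in> ?R" using WR[OF a'(1)] by blast
    note \<rho>w = \<rho>[OF a'(1) w(2)]
    let ?a = "a' - \<rho> w"
    have "(a' - u ^ k0 * w) - (\<rho> w - u ^ k0 * w) \<in> ?R" using subring_of_diff[OF R_subring w(2)] \<rho>w by blast
    then have aR: "?a \<in> ?R" by simp
    have "?a \<in> A" unfolding A_def
    proof (intro CollectI conjI allI impI)
      show "?a \<in> K" using chart_K[OF \<sigma>V \<sigma>0] aR by blast
      fix P assume P: "graded_closed P" "P \<noteq> Z"
      show "?a \<in> localring P"
      proof (cases "\<sigma> \<in> P e")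
        case True
        have "a' \<in> localring P" "\<rho> w \<in> localring P" using a'(1) \<rho>w P True unfolding A'_def by auto
        then show ?thesis by (rule subring_of_diff[OF localring_subring[OF closed_prime[OF P(1)]]])
      next
        case False
        then show ?thesis using chart_localring[OF \<sigma>V \<sigma>0 closed_prime[OF P(1)] False] aR by blast
      qed
    qed
    moreover have "x - ?a \<in> D (- int N)"
    proof -
      have "x - a' \<in> D (- int N)" using a'(2) D_mono[of "- int N" 0] by auto
      moreover have "\<rho> w \<in> D (- int N)" using N w(1) by blast
      ultimately have "(x - a') + \<rho> w \<in> D (- int N)" by (rule D_add)
      then show ?thesis by (simp add: algebra_simps)
    qed
    ultimately show ?thesis by blast
  qed
  then show ?thesis by blast
qed

end

lemma A_discrete_cocompact: "\<exists>Q N. discrete_cocompact_ring \<nu> Q A N"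
proof -
  obtain \<sigma> \<tau> e k0 where *: "\<sigma> \<in> Z e" "\<sigma> \<noteq> 0" "\<tau> \<in> V e" "\<tau> \<noteq> 0"
    "\<And>P. graded_prime P \<Longrightarrow> \<sigma> \<in> P e \<Longrightarrow> \<tau> \<notin> P e" "1 \<le> e"
    "\<And>k v. k0 \<le> k \<Longrightarrow> v \<in> V (e * Suc k) \<Longrightarrow> \<exists>a\<in>V (e * k). \<exists>b\<in>V (e * k). v = \<sigma> * a + \<tau> * b"
    by (rule two_forms) blast
  have "\<exists>N::nat. \<forall>x. \<exists>a\<in>A. x - a \<in> D (- int N)" by (rule cocompact[of \<sigma> e \<tau> k0]) (fact *)+
  then obtain N :: nat where N: "\<And>x. \<exists>a\<in>A. x - a \<in> D (- int N)" by blast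
  have cover: "\<exists>f\<in>chart_piece \<tau> e (k0 + 1). x - f \<in> D 1" if x: "x \<in> D 0" for x
    by (rule residue_cover[of \<sigma> e \<tau> k0]) (fact * x)+
  obtain Q where Q: "finite_residue_field \<nu> Q"
    using finite_residue_fieldI[OF finite_chart_piece[OF *(3,4)] cover] by blast
  interpret finite_residue_field \<nu> Q by (rule Q)
  have "discrete_cocompact_ring \<nu> Q A N"
  proof
    show "1 \<in> A" "\<And>x y. x \<in> A \<Longrightarrow> y \<in> A \<Longrightarrow> x - y \<in> A" "\<And>x y. x \<in> A \<Longrightarrow> y \<in> A \<Longrightarrow> x * y \<in> A"
      using A_subring unfolding subring_of_def by blast+
    show "\<nu> x \<le> 0" if "x \<in> A" "x \<noteq> 0" for x using A_units[OF that] by linarith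
    show "\<exists>a\<in>A. x - a \<in> D (- int N)" for x by (rule N)
  qed
  then show ?thesis by blast
qed

end

section \<open>Forms and their values at the generic point\<close>

lemma mpoly_sum_single:
  fixes p :: "'a::comm_monoid_add mpoly"
  shows "p = (\<Sum>m\<in>Poly_Mapping.keys p. Poly_Mapping.single m (Poly_Mapping.lookup p m))"
proof (rule poly_mapping_eqI)
  fix k
  have "(\<Sum>m\<in>Poly_Mapping.keys p. Poly_Mapping.lookup (Poly_Mapping.single m (Poly_Mapping.lookup p m)) k)
      = (\<Sum>m\<in>Poly_Mapping.keys p. if m = k then Poly_Mapping.lookup p m else 0)"
    by (intro sum.cong refl) (simp add: lookup_single when_def)
  also have "\<dots> = Poly_Mapping.lookup p k" by (simp add: in_keys_iff)
  finally show "Poly_Mapping.lookup p k = Poly_Mapping.lookup (\<Sum>m\<in>Poly_Mapping.keys p. Poly_Mapping.single m (Poly_Mapping.lookup p m)) k"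
    by (simp add: lookup_sum)
qed

lemma lookup_hom_part:
  "Poly_Mapping.lookup (hom_part d p) m = (if mdeg m = d then Poly_Mapping.lookup p m else 0)"
proof -
  have "Poly_Mapping.lookup (hom_part d p) m
      = (\<Sum>m'\<in>{m \<in> Poly_Mapping.keys p. mdeg m = d}. if m' = m then Poly_Mapping.lookup p m' else 0)"
    unfolding hom_part_def lookup_sum by (intro sum.cong refl) (simp add: lookup_single when_def)
  also have "\<dots> = (if mdeg m = d then Poly_Mapping.lookup p m else 0)"
    by (auto simp: in_keys_iff)
  finally show ?thesis .
qed

lemma keys_hom_part: "Poly_Mapping.keys (hom_part d p) = {m \<in> Poly_Mapping.keys p. mdeg m = d}"
  by (auto simp: in_keys_iff lookup_hom_part split: if_splits)

lemma homogeneous_hom_part: "homogeneous d (hom_part d p)"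
  unfolding homogeneous_def keys_hom_part by simp

lemma hom_part_polys: "p \<in> polys N \<Longrightarrow> hom_part d p \<in> polys N"
  unfolding polys_def by (auto simp: keys_hom_part)

lemma hom_part_homogeneous: "homogeneous k p \<Longrightarrow> hom_part d p = (if d = k then p else 0)"
  by (rule poly_mapping_eqI) (auto simp: lookup_hom_part homogeneous_def in_keys_iff)

lemma hom_part_add: "hom_part d (p + q) = hom_part d p + hom_part d q"
  by (rule poly_mapping_eqI) (simp add: lookup_hom_part lookup_add)

lemma hom_part_zero [simp]: "hom_part d 0 = 0"
  by (rule poly_mapping_eqI) (simp add: lookup_hom_part)

lemma hom_part_sum: "hom_part d (sum f S) = (\<Sum>i\<in>S. hom_part d (f i))"
  by (induction S rule: infinite_finite_induct) (auto simp: hom_part_add)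

lemma sum_hom_part:
  obtains B where "\<And>D. B \<le> D \<Longrightarrow> p = (\<Sum>d\<le>D. hom_part d p)" "\<And>d. B < d \<Longrightarrow> hom_part d p = 0"
proof -
  define B where "B = Max (insert 0 (mdeg ` Poly_Mapping.keys p))"
  have B: "mdeg m \<le> B" if "m \<in> Poly_Mapping.keys p" for m
    unfolding B_def using that by (intro Max_ge) auto
  show thesis
  proof (rule that[of B])
    fix D assume D: "B \<le> D"
    show "p = (\<Sum>d\<le>D. hom_part d p)"
    proof (rule poly_mapping_eqI)
      fix m
      have "Poly_Mapping.lookup (\<Sum>d\<le>D. hom_part d p) m = (if mdeg m \<le> D then Poly_Mapping.lookup p m else 0)"
        by (simp add: lookup_sum lookup_hom_part)
      also have "\<dots> = Poly_Mapping.lookup p m" using B[of m] D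
        by (cases "Poly_Mapping.lookup p m = 0") (auto simp: in_keys_iff)
      finally show "Poly_Mapping.lookup p m = Poly_Mapping.lookup (\<Sum>d\<le>D. hom_part d p) m" by simp
    qed
  next
    fix d assume "B < d"
    then show "hom_part d p = 0" using B
      by (intro poly_mapping_eqI) (fastforce simp: lookup_hom_part in_keys_iff)
  qed
qed

lemma polys_zero: "0 \<in> polys N"
  unfolding polys_def by simp

lemma polys_one: "(1 :: 'a::comm_ring_1 mpoly) \<in> polys N"
  unfolding polys_def by auto

lemma polys_add: "p \<in> polys N \<Longrightarrow> q \<in> polys N \<Longrightarrow> p + q \<in> polys N"
  unfolding polys_def using keys_add[of p q] by blast

lemma polys_uminus: "p \<in> polys N \<Longrightarrow> - p \<in> polys N"
  unfolding polys_def by simp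

lemma polys_mult:
  fixes p q :: "'a::comm_ring_1 mpoly"
  assumes "p \<in> polys N" "q \<in> polys N" shows "p * q \<in> polys N"
  unfolding polys_def
proof (intro CollectI ballI)
  fix m assume "m \<in> Poly_Mapping.keys (p * q)"
  then obtain a b where ab: "a \<in> Poly_Mapping.keys p" "b \<in> Poly_Mapping.keys q" "m = a + b" using keys_mult[of p q] by blast
  have "Poly_Mapping.keys m \<subseteq> Poly_Mapping.keys a \<union> Poly_Mapping.keys b" unfolding ab(3) by (rule keys_add)
  then show "Poly_Mapping.keys m \<subseteq> {..<N}" using assms ab(1,2) unfolding polys_def by blast
qed

lemma polys_single: "Poly_Mapping.keys m \<subseteq> {..<N} \<Longrightarrow> Poly_Mapping.single m c \<in> polys N"
  unfolding polys_def by simp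

lemma polys_var: "i < N \<Longrightarrow> (var i :: 'a::comm_ring_1 mpoly) \<in> polys N"
  unfolding var_def by (rule polys_single) simp

lemma mdeg_superset: "finite S \<Longrightarrow> Poly_Mapping.keys m \<subseteq> S \<Longrightarrow> mdeg m = (\<Sum>i\<in>S. Poly_Mapping.lookup m i)"
  unfolding mdeg_def by (rule sum.mono_neutral_left) (auto simp: in_keys_iff)

lemma mdeg_add: "mdeg (m + m') = mdeg m + mdeg m'"
proof -
  let ?S = "Poly_Mapping.keys m \<union> Poly_Mapping.keys m'"
  have "mdeg (m + m') = (\<Sum>i\<in>?S. Poly_Mapping.lookup (m + m') i)" by (rule mdeg_superset) (simp_all add: keys_add)
  also have "\<dots> = (\<Sum>i\<in>?S. Poly_Mapping.lookup m i) + (\<Sum>i\<in>?S. Poly_Mapping.lookup m' i)"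
    by (simp add: lookup_add sum.distrib)
  also have "\<dots> = mdeg m + mdeg m'" using mdeg_superset[of ?S m] mdeg_superset[of ?S m'] by simp
  finally show ?thesis .
qed

lemma mdeg_single [simp]: "mdeg (Poly_Mapping.single i k) = k"
  unfolding mdeg_def by (cases "k = 0") simp_all

lemma mdeg_eq_zero: "mdeg m = 0 \<longleftrightarrow> m = 0"
  unfolding mdeg_def by (auto simp: in_keys_iff intro!: poly_mapping_eqI)

lemma homogeneous_zero [simp]: "homogeneous d 0"
  unfolding homogeneous_def by simp

lemma homogeneous_add: "homogeneous d p \<Longrightarrow> homogeneous d q \<Longrightarrow> homogeneous d (p + q)"
  unfolding homogeneous_def using keys_add[of p q] by blast

lemma homogeneous_uminus: "homogeneous d p \<Longrightarrow> homogeneous d (- p)"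
  unfolding homogeneous_def by simp

lemma homogeneous_mult:
  fixes p q :: "'a::comm_ring_1 mpoly"
  assumes "homogeneous d p" "homogeneous e q" shows "homogeneous (d + e) (p * q)"
  using assms keys_mult[of p q] unfolding homogeneous_def by (fastforce simp: mdeg_add)

lemma homogeneous_single: "homogeneous (mdeg m) (Poly_Mapping.single m c)"
  unfolding homogeneous_def by simp

lemma homogeneous_var: "homogeneous 1 (var i)"
  unfolding var_def using homogeneous_single[of "Poly_Mapping.single i 1"] by simp

lemma homogeneous_one: "homogeneous 0 (1 :: 'a::comm_ring_1 mpoly)"
  unfolding homogeneous_def by (simp add: mdeg_def)

definition monomial_value :: "(nat \<Rightarrow> 'l::comm_ring_1) \<Rightarrow> (nat \<Rightarrow>\<^sub>0 nat) \<Rightarrow> 'l" where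
  "monomial_value x m = (\<Prod>i \<in> Poly_Mapping.keys m. x i ^ Poly_Mapping.lookup m i)"

lemma monomial_value_superset:
  "finite S \<Longrightarrow> Poly_Mapping.keys m \<subseteq> S \<Longrightarrow> monomial_value x m = (\<Prod>i\<in>S. x i ^ Poly_Mapping.lookup m i)"
  unfolding monomial_value_def by (rule prod.mono_neutral_left) (auto simp: in_keys_iff)

lemma monomial_value_add: "monomial_value x (m + m') = monomial_value x m * monomial_value x m'"
proof -
  let ?S = "Poly_Mapping.keys m \<union> Poly_Mapping.keys m'"
  have "monomial_value x (m + m') = (\<Prod>i\<in>?S. x i ^ Poly_Mapping.lookup (m + m') i)"
    by (rule monomial_value_superset) (simp_all add: keys_add)
  also have "\<dots> = (\<Prod>i\<in>?S. x i ^ Poly_Mapping.lookup m i) * (\<Prod>i\<in>?S. x i ^ Poly_Mapping.lookup m' i)"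
    by (simp add: lookup_add power_add prod.distrib)
  also have "\<dots> = monomial_value x m * monomial_value x m'"
    using monomial_value_superset[of ?S m x] monomial_value_superset[of ?S m' x] by simp
  finally show ?thesis .
qed

lemma monomial_value_zero [simp]: "monomial_value x 0 = 1"
  unfolding monomial_value_def by simp

lemma monomial_value_single [simp]: "monomial_value x (Poly_Mapping.single i k) = x i ^ k"
  unfolding monomial_value_def by (cases "k = 0") simp_all

context comm_ring_hom
begin

lemma peval_superset:
  "finite S \<Longrightarrow> Poly_Mapping.keys p \<subseteq> S \<Longrightarrow> peval hom x p = (\<Sum>m\<in>S. hom (Poly_Mapping.lookup p m) * monomial_value x m)"
  unfolding peval_def monomial_value_def[symmetric] by (rule sum.mono_neutral_left) (auto simp: in_keys_iff)

lemma peval_zero [simp]: "peval hom x 0 = 0"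
  unfolding peval_def by simp

lemma peval_add: "peval hom x (p + q) = peval hom x p + peval hom x q"
proof -
  let ?S = "Poly_Mapping.keys p \<union> Poly_Mapping.keys q"
  have "peval hom x (p + q) = (\<Sum>m\<in>?S. hom (Poly_Mapping.lookup (p + q) m) * monomial_value x m)"
    by (rule peval_superset) (simp_all add: keys_add)
  also have "\<dots> = (\<Sum>m\<in>?S. hom (Poly_Mapping.lookup p m) * monomial_value x m) + (\<Sum>m\<in>?S. hom (Poly_Mapping.lookup q m) * monomial_value x m)"
    by (simp add: lookup_add hom_add distrib_right sum.distrib)
  also have "\<dots> = peval hom x p + peval hom x q"
    using peval_superset[of ?S p x] peval_superset[of ?S q x] by simp
  finally show ?thesis .
qed

lemma peval_uminus: "peval hom x (- p) = - peval hom x p"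
  using peval_add[of x p "- p"] by (simp add: eq_neg_iff_add_eq_0 add.commute)

lemma peval_diff: "peval hom x (p - q) = peval hom x p - peval hom x q"
  using peval_add[of x p "- q"] peval_uminus[of x q] by simp

lemma peval_sum: "peval hom x (sum f S) = (\<Sum>i\<in>S. peval hom x (f i))"
  by (induction S rule: infinite_finite_induct) (auto simp: peval_add)

lemma peval_single: "peval hom x (Poly_Mapping.single m c) = hom c * monomial_value x m"
  by (subst peval_superset[of "{m}"]) auto

lemma peval_mult: "peval hom x (p * q) = peval hom x p * peval hom x q"
proof -
  let ?s = "\<lambda>p m. Poly_Mapping.single m (Poly_Mapping.lookup p m)"
  have "p * q = (\<Sum>m\<in>Poly_Mapping.keys p. ?s p m) * (\<Sum>m\<in>Poly_Mapping.keys q. ?s q m)"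
    using mpoly_sum_single[of p] mpoly_sum_single[of q] by simp
  also have "\<dots> = (\<Sum>m\<in>Poly_Mapping.keys p. \<Sum>m'\<in>Poly_Mapping.keys q. ?s p m * ?s q m')"
    by (rule sum_product)
  finally have "peval hom x (p * q) = (\<Sum>m\<in>Poly_Mapping.keys p. \<Sum>m'\<in>Poly_Mapping.keys q. peval hom x (?s p m * ?s q m'))"
    by (simp add: peval_sum)
  also have "\<dots> = (\<Sum>m\<in>Poly_Mapping.keys p. \<Sum>m'\<in>Poly_Mapping.keys q. peval hom x (?s p m) * peval hom x (?s q m'))"
    by (simp add: mult_single peval_single monomial_value_add hom_mult mult_ac)
  also have "\<dots> = (\<Sum>m\<in>Poly_Mapping.keys p. peval hom x (?s p m)) * (\<Sum>m\<in>Poly_Mapping.keys q. peval hom x (?s q m))"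
    by (rule sum_product[symmetric])
  also have "\<dots> = peval hom x p * peval hom x q"
    using mpoly_sum_single[of p] mpoly_sum_single[of q] by (simp add: peval_sum[symmetric])
  finally show ?thesis .
qed

lemma peval_one: "peval hom x 1 = 1"
  using peval_single[of x 0 1] by simp

lemma peval_var: "peval hom x (var i) = x i"
  unfolding var_def by (simp add: peval_single)

end

section \<open>Prime ideals of the polynomial ring in elementary terms\<close>

lemma cring_poly_ring: "cring (poly_ring N :: 'a::comm_ring_1 mpoly ring)"
proof (rule cringI)
  show "abelian_group (poly_ring N :: 'a mpoly ring)"
  proof (rule abelian_groupI)
    fix x :: "'a mpoly" assume "x \<in> carrier (poly_ring N)"
    then show "\<exists>y\<in>carrier (poly_ring N). y \<oplus>\<^bsub>poly_ring N\<^esub> x = \<zero>\<^bsub>poly_ring N\<^esub>"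
      by (intro bexI[of _ "- x"]) (auto simp: poly_ring_def polys_uminus)
  qed (auto simp: poly_ring_def polys_zero polys_add add_ac)
  show "comm_monoid (poly_ring N :: 'a mpoly ring)"
    by (rule comm_monoidI) (auto simp: poly_ring_def polys_one polys_mult mult_ac)
qed (auto simp: poly_ring_def distrib_right)

lemma primeideal_poly_ringI:
  fixes P :: "'a::comm_ring_1 mpoly set"
  assumes "P \<subseteq> polys N" "0 \<in> P" "\<And>p q. p \<in> P \<Longrightarrow> q \<in> P \<Longrightarrow> p + q \<in> P"
    "\<And>a p. a \<in> polys N \<Longrightarrow> p \<in> P \<Longrightarrow> a * p \<in> P" "1 \<notin> P"
    "\<And>p q. p \<in> polys N \<Longrightarrow> q \<in> polys N \<Longrightarrow> p * q \<in> P \<Longrightarrow> p \<in> P \<or> q \<in> P"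
  shows "primeideal P (poly_ring N)"
proof (rule primeidealI)
  interpret cring "poly_ring N :: 'a mpoly ring" by (rule cring_poly_ring)
  have uminus: "- p \<in> P" if "p \<in> P" for p
    using assms(4)[OF polys_uminus[OF polys_one] that] by simp
  have inv: "\<ominus>\<^bsub>poly_ring N\<^esub> p = - p" if "p \<in> polys N" for p :: "'a mpoly"
    by (rule minus_equality) (use that polys_uminus in \<open>auto simp: poly_ring_def\<close>)
  show "ideal P (poly_ring N)"
  proof (rule idealI)
    show "ring (poly_ring N)" by (rule cring.axioms(1)[OF cring_poly_ring])
    show "subgroup P (add_monoid (poly_ring N))"
    proof (rule group.subgroupI)
      show "group (add_monoid (poly_ring N))" by (rule abelian_group.a_group[OF ring.axioms(1)[OF cring.axioms(1)[OF cring_poly_ring]]])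
      show "P \<subseteq> carrier (add_monoid (poly_ring N))" using assms(1) by (simp add: poly_ring_def)
      show "P \<noteq> {}" using assms(2) by blast
      show "inv\<^bsub>add_monoid (poly_ring N)\<^esub> p \<in> P" if "p \<in> P" for p
        using inv[of p] uminus[OF that] assms(1) that unfolding a_inv_def by auto
      show "p \<otimes>\<^bsub>add_monoid (poly_ring N)\<^esub> q \<in> P" if "p \<in> P" "q \<in> P" for p q
        using assms(3)[OF that] by (simp add: poly_ring_def)
    qed
    show "x \<otimes>\<^bsub>poly_ring N\<^esub> a \<in> P" if "a \<in> P" "x \<in> carrier (poly_ring N)" for a x
      using assms(4) that by (simp add: poly_ring_def)
    show "a \<otimes>\<^bsub>poly_ring N\<^esub> x \<in> P" if "a \<in> P" "x \<in> carrier (poly_ring N)" for a x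
      using assms(4)[of x a] that by (simp add: poly_ring_def mult.commute)
  qed
  show "cring (poly_ring N)" by (rule cring_poly_ring)
  show "carrier (poly_ring N) \<noteq> P" using assms(5) polys_one by (auto simp: poly_ring_def)
  show "a \<in> P \<or> b \<in> P" if "a \<in> carrier (poly_ring N)" "b \<in> carrier (poly_ring N)" "a \<otimes>\<^bsub>poly_ring N\<^esub> b \<in> P" for a b
    using assms(6)[of a b] that by (simp add: poly_ring_def)
qed

lemma
  fixes P :: "'a::comm_ring_1 mpoly set"
  assumes P: "primeideal P (poly_ring N)"
  shows prime_poly_subset: "P \<subseteq> polys N" and prime_poly_zero: "0 \<in> P"
    and prime_poly_add: "p \<in> P \<Longrightarrow> q \<in> P \<Longrightarrow> p + q \<in> P"
    and prime_poly_mult: "a \<in> polys N \<Longrightarrow> p \<in> P \<Longrightarrow> a * p \<in> P"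
    and prime_poly_prime: "p \<in> polys N \<Longrightarrow> q \<in> polys N \<Longrightarrow> p * q \<in> P \<Longrightarrow> p \<in> P \<or> q \<in> P"
proof -
  interpret primeideal P "poly_ring N" by (rule P)
  show "P \<subseteq> polys N" using a_subset by (simp add: poly_ring_def)
  show "0 \<in> P" using additive_subgroup.zero_closed[OF additive_subgroup_axioms] by (simp add: poly_ring_def)
  show "p \<in> P \<Longrightarrow> q \<in> P \<Longrightarrow> p + q \<in> P" using additive_subgroup.a_closed[OF additive_subgroup_axioms, of p q] by (simp add: poly_ring_def)
  show "a \<in> polys N \<Longrightarrow> p \<in> P \<Longrightarrow> a * p \<in> P" using I_l_closed[of p a] by (simp add: poly_ring_def)
  show "p \<in> polys N \<Longrightarrow> q \<in> polys N \<Longrightarrow> p * q \<in> P \<Longrightarrow> p \<in> P \<or> q \<in> P"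
    using I_prime[of p q] by (simp add: poly_ring_def)
qed

section \<open>The curve\<close>

lemma monomial_two:
  assumes "Poly_Mapping.keys m \<subseteq> {..<2::nat}"
  shows "m = Poly_Mapping.single 0 (Poly_Mapping.lookup m 0) + Poly_Mapping.single 1 (Poly_Mapping.lookup m 1)"
proof (rule poly_mapping_eqI)
  fix i
  have "Poly_Mapping.lookup m i = 0" if "2 \<le> i" using assms that by (auto simp: in_keys_iff subset_iff)
  moreover have "i = 0 \<or> i = 1 \<or> 2 \<le> i" by linarith
  ultimately show "Poly_Mapping.lookup m i
      = Poly_Mapping.lookup (Poly_Mapping.single 0 (Poly_Mapping.lookup m 0) + Poly_Mapping.single 1 (Poly_Mapping.lookup m 1)) i"
    by (auto simp: lookup_add lookup_single)
qed

locale projective_curve =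
  fixes n :: nat and I :: "'f::{finite,field} mpoly set" and \<phi> :: "'f \<Rightarrow> 'l::field" and \<xi> :: "nat \<Rightarrow> 'l"
  assumes I_point: "I \<in> proj_points n {0}"
    and generic: "generic_coordinates n I \<phi> \<xi>"
    and trdeg: "has_trdeg \<phi> (function_field n I \<phi> \<xi>) 1"
begin

sublocale hom: comm_ring_hom \<phi>
  using generic unfolding generic_coordinates_def by blast

abbreviation ev :: "'f mpoly \<Rightarrow> 'l" where "ev \<equiv> peval \<phi> \<xi>"
abbreviation Pol :: "'f mpoly set" where "Pol \<equiv> polys (Suc n)"

lemma ev_zero_iff: "p \<in> Pol \<Longrightarrow> homogeneous d p \<Longrightarrow> ev p = 0 \<longleftrightarrow> p \<in> I"
  using generic unfolding generic_coordinates_def by blast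

definition V :: "nat \<Rightarrow> 'l set" where
  "V k = {ev p | p. p \<in> Pol \<and> homogeneous k p}"

text \<open>\<open>gr\<close> and \<open>ungr\<close> are inverse translations between the
  homogeneous primes containing \<open>I\<close> and the graded primes of the coordinate ring,
  realized through values at \<open>\<xi>\<close>.\<close>

definition gr :: "'f mpoly set \<Rightarrow> nat \<Rightarrow> 'l set" where
  "gr P k = {ev p | p. p \<in> P \<and> p \<in> Pol \<and> homogeneous k p}"

text \<open>Membership is tested on homogeneous parts, because vanishing at \<open>\<xi>\<close> is
  tied to \<open>I\<close> only for forms.\<close>

definition ungr :: "(nat \<Rightarrow> 'l set) \<Rightarrow> 'f mpoly set" where
  "ungr Q = {p \<in> Pol. \<forall>d. ev (hom_part d p) \<in> Q d}"

lemma VI: "p \<in> Pol \<Longrightarrow> homogeneous k p \<Longrightarrow> ev p \<in> V k"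
  unfolding V_def by blast

lemma VE: assumes "v \<in> V k" obtains p where "v = ev p" "p \<in> Pol" "homogeneous k p"
  using assms unfolding V_def by blast

lemma monomial_in_V:
  "Poly_Mapping.keys m \<subseteq> {..<Suc n} \<Longrightarrow> mdeg m = k \<Longrightarrow> \<phi> c * monomial_value \<xi> m \<in> V k"
  using VI[OF polys_single homogeneous_single, of m c] by (simp add: hom.peval_single)

lemma V_add': "x \<in> V k \<Longrightarrow> y \<in> V k \<Longrightarrow> x + y \<in> V k"
  by (elim VE) (metis VI polys_add homogeneous_add hom.peval_add)

lemma V_zero': "0 \<in> V k"
  using VI[OF polys_zero homogeneous_zero] by simp

lemma V_sum': "(\<And>i. i \<in> S \<Longrightarrow> f i \<in> V k) \<Longrightarrow> sum f S \<in> V k"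
  by (induction S rule: infinite_finite_induct) (auto intro: V_zero' V_add')

lemma V_0: "V 0 = range \<phi>"
proof (intro equalityI subsetI)
  fix v assume "v \<in> V 0"
  then obtain p where p: "v = ev p" "p \<in> Pol" "homogeneous 0 p" by (rule VE)
  have "Poly_Mapping.keys p \<subseteq> {0}" using p(3) unfolding homogeneous_def by (auto simp: mdeg_eq_zero)
  then have "v = \<phi> (Poly_Mapping.lookup p 0)" unfolding p(1) by (subst hom.peval_superset[of "{0}"]) auto
  then show "v \<in> range \<phi>" by blast
next
  fix v assume "v \<in> range \<phi>"
  then obtain c where "v = \<phi> c" by blast
  then show "v \<in> V 0" using monomial_in_V[of 0 0 c] by (simp add: mdeg_def)
qed

text \<open>Each monomial is divided by one of its variables, chosen by \<open>h\<close>, and the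
  quotients are collected by that variable.\<close>

lemma V_gen':
  assumes v: "v \<in> V (Suc k)"
  shows "\<exists>w. (\<forall>i\<le>n. w i \<in> V k) \<and> v = (\<Sum>i\<le>n. \<xi> i * w i)"
proof -
  obtain p where p: "v = ev p" "p \<in> Pol" "homogeneous (Suc k) p" using v by (rule VE)
  have keys: "Poly_Mapping.keys m \<subseteq> {..<Suc n}" "mdeg m = Suc k" if "m \<in> Poly_Mapping.keys p" for m
    using that p(2,3) unfolding polys_def homogeneous_def by auto
  have "\<exists>i. i \<in> Poly_Mapping.keys m" if "m \<in> Poly_Mapping.keys p" for m
  proof (rule ccontr)
    assume "\<not> ?thesis"
    then have "mdeg m = 0" unfolding mdeg_def by simp
    then show False using keys(2)[OF that] by simp
  qed
  then obtain h where h: "\<And>m. m \<in> Poly_Mapping.keys p \<Longrightarrow> h m \<in> Poly_Mapping.keys m" by metis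
  have hn: "h m \<le> n" if "m \<in> Poly_Mapping.keys p" for m using h[OF that] keys(1)[OF that] by auto
  let ?r = "\<lambda>m. m - Poly_Mapping.single (h m) 1"
  have split: "m = Poly_Mapping.single (h m) 1 + ?r m" if "m \<in> Poly_Mapping.keys p" for m
  proof (rule poly_mapping_eqI)
    fix i
    have "Poly_Mapping.lookup m (h m) \<noteq> 0" using h[OF that] by (simp add: in_keys_iff)
    then show "Poly_Mapping.lookup m i = Poly_Mapping.lookup (Poly_Mapping.single (h m) 1 + ?r m) i"
      by (cases "h m = i") (auto simp: lookup_add lookup_minus lookup_single when_def)
  qed
  have rdeg: "mdeg (?r m) = k" if "m \<in> Poly_Mapping.keys p" for m
    using arg_cong[OF split[OF that], of mdeg] keys(2)[OF that] by (simp add: mdeg_add)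
  have rkeys: "Poly_Mapping.keys (?r m) \<subseteq> {..<Suc n}" if "m \<in> Poly_Mapping.keys p" for m
    using keys(1)[OF that] by (auto simp: in_keys_iff lookup_minus subset_iff)
  define w where "w i = (\<Sum>m\<in>{m \<in> Poly_Mapping.keys p. h m = i}. \<phi> (Poly_Mapping.lookup p m) * monomial_value \<xi> (?r m))" for i
  have "w i \<in> V k" for i unfolding w_def by (rule V_sum') (use monomial_in_V rkeys rdeg in auto)
  moreover have "v = (\<Sum>i\<le>n. \<xi> i * w i)"
  proof -
    have mv: "monomial_value \<xi> m = \<xi> (h m) * monomial_value \<xi> (?r m)" if "m \<in> Poly_Mapping.keys p" for m
      using arg_cong[OF split[OF that], of "monomial_value \<xi>"] by (simp add: monomial_value_add)
    have "v = (\<Sum>m\<in>Poly_Mapping.keys p. \<phi> (Poly_Mapping.lookup p m) * monomial_value \<xi> m)"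
      unfolding p(1) by (rule hom.peval_superset) auto
    also have "\<dots> = (\<Sum>m\<in>Poly_Mapping.keys p. \<xi> (h m) * (\<phi> (Poly_Mapping.lookup p m) * monomial_value \<xi> (?r m)))"
      by (rule sum.cong) (use mv in \<open>auto simp: mult_ac\<close>)
    also have "\<dots> = (\<Sum>i\<le>n. \<Sum>m\<in>{m \<in> Poly_Mapping.keys p. h m = i}. \<xi> (h m) * (\<phi> (Poly_Mapping.lookup p m) * monomial_value \<xi> (?r m)))"
      by (rule sum.group[symmetric]) (use hn in auto)
    also have "\<dots> = (\<Sum>i\<le>n. \<xi> i * w i)"
      unfolding w_def sum_distrib_left by (intro sum.cong refl) auto
    finally show ?thesis .
  qed
  ultimately show ?thesis by (intro exI[of _ w]) simp
qed

lemma I_prime: "primeideal I (poly_ring (Suc n))"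
  using I_point unfolding proj_points_def by blast

lemma pointD:
  assumes "P \<in> proj_points n I"
  shows "primeideal P (poly_ring (Suc n))" "\<And>p d. p \<in> P \<Longrightarrow> hom_part d p \<in> P" "I \<subseteq> P" "\<exists>i\<le>n. var i \<notin> P"
  using assms unfolding proj_points_def by blast+

lemma I_in_points: "I \<in> proj_points n I"
  using I_point unfolding proj_points_def by blast

sublocale graded_ring V n \<xi>
proof
  show "1 \<in> V 0" using VI[OF polys_one homogeneous_one] by (simp add: hom.peval_one)
  show "x - y \<in> V k" if "x \<in> V k" "y \<in> V k" for x y k
  proof -
    have "- y \<in> V k" using that(2) by (elim VE) (metis VI polys_uminus homogeneous_uminus hom.peval_uminus)
    then show ?thesis using V_add'[OF that(1), of "- y"] by simp
  qed
  show "x * y \<in> V (j + k)" if "x \<in> V j" "y \<in> V k" for x y j k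
    using that by (elim VE) (metis VI polys_mult homogeneous_mult hom.peval_mult)
  show "inverse c \<in> V 0" if "c \<in> V 0" for c
  proof -
    obtain d where d: "c = \<phi> d" using \<open>c \<in> V 0\<close> V_0 by auto
    have "inverse c = \<phi> (inverse d)"
    proof (cases "d = 0")
      case False
      then have "c * \<phi> (inverse d) = 1" unfolding d by (simp add: hom.hom_mult[symmetric])
      then show ?thesis by (rule inverse_unique)
    qed (simp add: d)
    then show ?thesis using V_0 by auto
  qed
  show gen: "\<exists>w. (\<forall>i\<le>n. w i \<in> V k) \<and> v = (\<Sum>i\<le>n. \<xi> i * w i)" if "v \<in> V (Suc k)" for v k
    by (rule V_gen'[OF that])
  show "finite (V k)" for k
  proof (induction k)
    case 0
    show ?case unfolding V_0 by simp
  next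
    case (Suc k)
    have "V (Suc k) \<subseteq> (\<lambda>w. \<Sum>i\<le>n. \<xi> i * w i) ` PiE {..n} (\<lambda>_. V k)"
    proof
      fix v assume "v \<in> V (Suc k)"
      then obtain w where w: "\<forall>i\<le>n. w i \<in> V k" "v = (\<Sum>i\<le>n. \<xi> i * w i)" using V_gen' by blast
      have "v = (\<Sum>i\<le>n. \<xi> i * restrict w {..n} i)" unfolding w(2) by (intro sum.cong) auto
      moreover have "restrict w {..n} \<in> PiE {..n} (\<lambda>_. V k)" using w(1) by auto
      ultimately show "v \<in> (\<lambda>w. \<Sum>i\<le>n. \<xi> i * w i) ` PiE {..n} (\<lambda>_. V k)" by blast
    qed
    then show ?case
      by (rule finite_subset[OF _ finite_imageI[OF finite_PiE[OF finite_atMost Suc]]])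
  qed
  show "\<xi> i \<in> V 1" if "i \<le> n" for i
    using VI[OF polys_var homogeneous_var, of i] that by (simp add: hom.peval_var)
  obtain i where i: "i \<le> n" "var i \<notin> I" using pointD(4)[OF I_in_points] by blast
  have "ev (var i) \<noteq> 0" using ev_zero_iff[OF polys_var homogeneous_var, of i] i by simp
  then show "\<exists>i\<le>n. \<xi> i \<noteq> 0" using i(1) by (auto simp: hom.peval_var)
qed

context
  fixes P assumes P: "P \<in> proj_points n I"
begin

lemmas Pd = prime_poly_subset[OF pointD(1)[OF P]] prime_poly_zero[OF pointD(1)[OF P]] prime_poly_add[OF pointD(1)[OF P]]
  prime_poly_mult[OF pointD(1)[OF P]] prime_poly_prime[OF pointD(1)[OF P]]

text \<open>Forms of equal degree with the same value differ by an element of \<open>I\<close>,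
  hence of \<open>P\<close>, so membership in \<open>P\<close> depends on the value alone.\<close>

lemma ev_in_gr: 
  assumes p: "p \<in> Pol" "homogeneous k p" shows "ev p \<in> gr P k \<longleftrightarrow> p \<in> P"
proof
  assume "ev p \<in> gr P k"
  then obtain q where q: "ev p = ev q" "q \<in> P" "q \<in> Pol" "homogeneous k q" unfolding gr_def by blast
  have pq: "p + - q \<in> Pol" "homogeneous k (p + - q)"
    using p q polys_add polys_uminus homogeneous_add homogeneous_uminus by blast+
  have "ev (p + - q) = 0" using q(1) by (simp add: hom.peval_diff)
  then have "p + - q \<in> P" using ev_zero_iff[OF pq] pointD(3)[OF P] by blast
  then have "(p + - q) + q \<in> P" using Pd(3) q(2) by blast
  then show "p \<in> P" by simp
qed (use p in \<open>auto simp: gr_def\<close>)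

lemma gr_graded_prime: "graded_prime (gr P)"
  unfolding graded_prime_def graded_ideal_def
proof (intro conjI allI ballI impI)
  fix k
  show "gr P k \<subseteq> V k" unfolding gr_def V_def by blast
  show "0 \<in> gr P k" unfolding gr_def using Pd(2) polys_zero homogeneous_zero hom.peval_zero by (intro CollectI exI[of _ 0]) simp
  fix x y assume "x \<in> gr P k" "y \<in> gr P k"
  then obtain p q where pq: "x = ev p" "p \<in> P" "p \<in> Pol" "homogeneous k p" "y = ev q" "q \<in> P" "q \<in> Pol" "homogeneous k q"
    unfolding gr_def by blast
  show "x + y \<in> gr P k" unfolding gr_def
    using pq(1,5) Pd(3)[OF pq(2,6)] polys_add[OF pq(3,7)] homogeneous_add[OF pq(4,8)] hom.peval_add[of \<xi> p q]
    by (intro CollectI exI[of _ "p + q"]) simp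
next
  fix j k c x assume "c \<in> V j" "x \<in> gr P k"
  then obtain p q where pq: "c = ev p" "p \<in> Pol" "homogeneous j p" "x = ev q" "q \<in> P" "q \<in> Pol" "homogeneous k q"
    unfolding gr_def V_def by blast
  show "c * x \<in> gr P (j + k)" unfolding gr_def
    using pq(1,4) Pd(4)[OF pq(2,5)] polys_mult[OF pq(2,6)] homogeneous_mult[OF pq(3,7)] hom.peval_mult[of \<xi> p q]
    by (intro CollectI exI[of _ "p * q"]) simp
next
  obtain i where i: "i \<le> n" "var i \<notin> P" using pointD(4)[OF P] by blast
  have "ev (var i) \<notin> gr P 1" using ev_in_gr[OF polys_var homogeneous_var, of i] i by simp
  then show "\<exists>i\<le>n. \<xi> i \<notin> gr P 1" using i(1) by (auto simp: hom.peval_var)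
next
  fix j k x y assume "x \<in> V j" "y \<in> V k" and xy: "x * y \<in> gr P (j + k)"
  then obtain p q where p: "x = ev p" "p \<in> Pol" "homogeneous j p" and q: "y = ev q" "q \<in> Pol" "homogeneous k q" by (elim VE)
  have "ev (p * q) \<in> gr P (j + k)" using xy p(1) q(1) by (simp add: hom.peval_mult)
  then have "p * q \<in> P" using ev_in_gr[OF polys_mult homogeneous_mult] p q by blast
  then have "p \<in> P \<or> q \<in> P" using Pd(5) p q by blast
  then show "x \<in> gr P j \<or> y \<in> gr P k" using ev_in_gr p q by blast
qed

lemma ungr_gr: "ungr (gr P) = P"
proof (intro equalityI subsetI)
  fix p assume "p \<in> ungr (gr P)"
  then have p: "p \<in> Pol" "\<And>d. ev (hom_part d p) \<in> gr P d" unfolding ungr_def by auto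
  have hp: "hom_part d p \<in> P" for d using ev_in_gr[OF hom_part_polys[OF p(1)] homogeneous_hom_part] p(2) by blast
  have "(\<Sum>d\<le>D. hom_part d p) \<in> P" for D by (induction D) (use hp Pd(3) in auto)
  moreover obtain B where "\<And>D. B \<le> D \<Longrightarrow> p = (\<Sum>d\<le>D. hom_part d p)" using sum_hom_part[of p] by metis
  ultimately show "p \<in> P" by (metis order_refl)
next
  fix p assume p: "p \<in> P"
  then have "p \<in> Pol" using Pd(1) by blast
  then show "p \<in> ungr (gr P)" unfolding ungr_def
    using ev_in_gr[OF hom_part_polys homogeneous_hom_part] pointD(2)[OF P p] by blast
qed

lemma local_ring_gr: "local_ring n \<phi> \<xi> P = localring (gr P)"
proof (intro equalityI subsetI)
  fix x assume "x \<in> local_ring n \<phi> \<xi> P"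
  then obtain a b d where ab: "x = ev a / ev b" "a \<in> Pol" "b \<in> Pol" "homogeneous d a" "homogeneous d b" "b \<notin> P"
    unfolding local_ring_def by blast
  then have "ev b \<notin> gr P d" using ev_in_gr by blast
  then show "x \<in> localring (gr P)" unfolding ab(1) using localringI[where P = "gr P" and k = d] VI ab by blast
next
  fix x assume "x \<in> localring (gr P)"
  then obtain a c k where x: "x = a / c" "a \<in> V k" "c \<in> V k" "c \<notin> gr P k" by (rule localringE)
  obtain p where p: "a = ev p" "p \<in> Pol" "homogeneous k p" using x(2) by (rule VE)
  obtain q where q: "c = ev q" "q \<in> Pol" "homogeneous k q" using x(3) by (rule VE)
  have "q \<notin> P" using ev_in_gr[OF q(2,3)] x(4) q(1) by blast
  then show "x \<in> local_ring n \<phi> \<xi> P" unfolding local_ring_def x(1) p(1) q(1) using p q by blast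
qed

end

lemma gr_I: "gr I = (\<lambda>k. {0})"
proof
  fix k
  have "0 \<in> gr I k" using graded_idealD(2)[OF graded_primeD(1)[OF gr_graded_prime[OF I_in_points]]] .
  moreover have "x = 0" if "x \<in> gr I k" for x using that ev_zero_iff unfolding gr_def by blast
  ultimately show "gr I k = {0}" by blast
qed

lemma function_field_K: "function_field n I \<phi> \<xi> = K"
  unfolding function_field_def K_def local_ring_gr[OF I_in_points] gr_I ..

context
  fixes R assumes R: "graded_prime R"
begin

lemmas Rd = graded_idealD[OF graded_primeD(1)[OF R]]

lemma homogeneous_ungr:
  assumes "p \<in> Pol" "homogeneous k p" shows "p \<in> ungr R \<longleftrightarrow> ev p \<in> R k"
proof -
  have "ev (hom_part d p) \<in> R d \<longleftrightarrow> (d = k \<longrightarrow> ev p \<in> R k)" for d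
    using Rd(2) hom_part_homogeneous[OF assms(2), of d] by auto
  then show ?thesis unfolding ungr_def using assms(1) by auto
qed

lemma hom_part_mult_in:
  assumes p: "p \<in> Pol" and q: "q \<in> Pol"
  shows "ev (hom_part d (p * q)) = (\<Sum>i\<le>d. ev (hom_part i p) * ev (hom_part (d - i) q))"
proof -
  obtain B where B: "\<And>D. B \<le> D \<Longrightarrow> p = (\<Sum>i\<le>D. hom_part i p)" using sum_hom_part[of p] by metis
  obtain C where C: "\<And>D. C \<le> D \<Longrightarrow> q = (\<Sum>i\<le>D. hom_part i q)" using sum_hom_part[of q] by metis
  define D where "D = max d (max B C)"
  have "p * q = (\<Sum>i\<le>D. hom_part i p) * (\<Sum>j\<le>D. hom_part j q)"
    using B[of D] C[of D] unfolding D_def by simp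
  also have "\<dots> = (\<Sum>i\<le>D. \<Sum>j\<le>D. hom_part i p * hom_part j q)" by (rule sum_product)
  finally have "hom_part d (p * q) = (\<Sum>i\<le>D. \<Sum>j\<le>D. hom_part d (hom_part i p * hom_part j q))"
    by (simp add: hom_part_sum)
  also have "\<dots> = (\<Sum>i\<le>D. \<Sum>j\<le>D. if d = i + j then hom_part i p * hom_part j q else 0)"
    by (intro sum.cong refl hom_part_homogeneous homogeneous_mult homogeneous_hom_part)
  also have "\<dots> = (\<Sum>i\<le>D. if i \<le> d then hom_part i p * hom_part (d - i) q else 0)"
  proof (rule sum.cong[OF refl])
    fix i
    have "(\<Sum>j\<le>D. if d = i + j then hom_part i p * hom_part j q else 0)
        = (\<Sum>j\<le>D. if j = d - i then (if i \<le> d then hom_part i p * hom_part j q else 0) else 0)"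
      by (intro sum.cong refl) auto
    also have "\<dots> = (if i \<le> d then hom_part i p * hom_part (d - i) q else 0)"
      unfolding D_def by (auto simp: sum.delta)
    finally show "(\<Sum>j\<le>D. if d = i + j then hom_part i p * hom_part j q else 0) = (if i \<le> d then hom_part i p * hom_part (d - i) q else 0)" .
  qed
  also have "\<dots> = (\<Sum>i\<in>{..D} \<inter> {i. i \<le> d}. hom_part i p * hom_part (d - i) q)"
    by (simp add: sum.inter_restrict)
  also have "{..D} \<inter> {i. i \<le> d} = {..d}" unfolding D_def by auto
  finally show ?thesis by (simp add: hom.peval_sum hom.peval_mult)
qed

lemma sum_in_R: "(\<And>i. i \<in> S \<Longrightarrow> f i \<in> R d) \<Longrightarrow> sum f S \<in> R d"
  by (induction S rule: infinite_finite_induct) (auto intro: Rd(2,3))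

lemma hom_part_V: "p \<in> Pol \<Longrightarrow> ev (hom_part d p) \<in> V d"
  by (rule VI[OF hom_part_polys homogeneous_hom_part])

lemma ungr_point: "ungr R \<in> proj_points n I"
  unfolding proj_points_def
proof (intro CollectI conjI ballI allI)
  show "primeideal (ungr R) (poly_ring (Suc n))"
  proof (rule primeideal_poly_ringI)
    show "ungr R \<subseteq> Pol" unfolding ungr_def by blast
    show "0 \<in> ungr R" unfolding ungr_def using polys_zero Rd(2) by simp
    show "p + q \<in> ungr R" if "p \<in> ungr R" "q \<in> ungr R" for p q
      using that polys_add Rd(3) unfolding ungr_def by (auto simp: hom_part_add hom.peval_add)
    show "a * p \<in> ungr R" if a: "a \<in> Pol" and p: "p \<in> ungr R" for a p
    proof -
      have pP: "p \<in> Pol" "\<And>d. ev (hom_part d p) \<in> R d" using p unfolding ungr_def by auto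
      have "ev (hom_part d (a * p)) \<in> R d" for d
        unfolding hom_part_mult_in[OF a pP(1)]
      proof (rule sum_in_R)
        fix i assume "i \<in> {..d}"
        then show "ev (hom_part i a) * ev (hom_part (d - i) p) \<in> R d"
          using Rd(4)[OF hom_part_V[OF a, of i] pP(2)[of "d - i"]] by simp
      qed
      then show ?thesis unfolding ungr_def using polys_mult[OF a pP(1)] by blast
    qed
    show "1 \<notin> ungr R" using homogeneous_ungr[OF polys_one homogeneous_one] one_notin_prime[OF R] by (simp add: hom.peval_one)
    show "p \<in> ungr R \<or> q \<in> ungr R" if p: "p \<in> Pol" and q: "q \<in> Pol" and pq: "p * q \<in> ungr R" for p q
    proof (rule ccontr)
      assume neg: "\<not> (p \<in> ungr R \<or> q \<in> ungr R)"
      \<comment> \<open>The top-degree argument: let \<open>a\<close> and \<open>b\<close> be the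
        largest degrees in which \<open>p\<close> and \<open>q\<close> have parts outside
        \<open>R\<close>. In degree \<open>a + b\<close> every other product has a factor in
        \<open>R\<close>, so the product of these two parts lies in \<open>R\<close> as
        well.\<close>
      have top: "\<exists>d. ev (hom_part d p) \<notin> R d \<and> (\<forall>i>d. ev (hom_part i p) \<in> R i)" if p: "p \<in> Pol" "p \<notin> ungr R" for p
      proof -
        obtain B where B: "\<And>d. B < d \<Longrightarrow> hom_part d p = 0" using sum_hom_part[of p] by metis
        let ?S = "{d. ev (hom_part d p) \<notin> R d}"
        have "?S \<subseteq> {..B}" using B Rd(2) by (force simp: not_less[symmetric])
        then have fin: "finite ?S" by (rule finite_subset) simp
        have "?S \<noteq> {}" using p unfolding ungr_def by blast
        then have "Max ?S \<in> ?S" using Max_in[OF fin] by blast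
        moreover have "ev (hom_part i p) \<in> R i" if "i > Max ?S" for i
          using Max_ge[OF fin, of i] that by (meson leD mem_Collect_eq)
        ultimately show ?thesis by blast
      qed
      obtain a where a: "ev (hom_part a p) \<notin> R a" "\<And>i. i > a \<Longrightarrow> ev (hom_part i p) \<in> R i" using top[OF p] neg by blast
      obtain b where b: "ev (hom_part b q) \<notin> R b" "\<And>i. i > b \<Longrightarrow> ev (hom_part i q) \<in> R i" using top[OF q] neg by blast
      let ?t = "\<lambda>i. ev (hom_part i p) * ev (hom_part (a + b - i) q)"
      have s1: "(\<Sum>i\<le>a + b. ?t i) \<in> R (a + b)"
        using pq hom_part_mult_in[OF p q, of "a + b"] unfolding ungr_def by (metis (no_types, lifting) mem_Collect_eq)
      have s2: "(\<Sum>i\<le>a + b. ?t i) = ?t a + (\<Sum>i\<in>{..a + b} - {a}. ?t i)"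
        by (rule sum.remove) auto
      have s3: "(\<Sum>i\<in>{..a + b} - {a}. ?t i) \<in> R (a + b)"
      proof (rule sum_in_R)
        fix i assume i: "i \<in> {..a + b} - {a}"
        show "?t i \<in> R (a + b)"
        proof (cases "i < a")
          case True
          then have "ev (hom_part (a + b - i) q) \<in> R (a + b - i)" by (intro b(2)) simp
          then have "?t i \<in> R (i + (a + b - i))" by (rule Rd(4)[OF hom_part_V[OF p]])
          then show ?thesis using i by simp
        next
          case False
          then have "ev (hom_part i p) \<in> R i" using i by (intro a(2)) simp
          then have "ev (hom_part (a + b - i) q) * ev (hom_part i p) \<in> R (a + b - i + i)" by (rule Rd(4)[OF hom_part_V[OF q]])
          then show ?thesis using i by (simp add: mult.commute)
        qed
      qed
      have "?t a \<in> R (a + b)" using Rd(6)[OF s1 s3] unfolding s2 by (simp only: add_diff_cancel_right')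
      then have "ev (hom_part a p) * ev (hom_part b q) \<in> R (a + b)" by simp
      then show False using graded_primeD(3)[OF R hom_part_V[OF p] hom_part_V[OF q]] a(1) b(1) by blast
    qed
  qed
  show "hom_part d p \<in> ungr R" if "p \<in> ungr R" for p d
    using that homogeneous_ungr[OF hom_part_polys homogeneous_hom_part] unfolding ungr_def by blast
  show "I \<subseteq> ungr R"
  proof
    fix p assume p: "p \<in> I"
    have pP: "p \<in> Pol" using prime_poly_subset[OF I_prime] p by blast
    have "ev (hom_part d p) = 0" for d
      using ev_zero_iff[OF hom_part_polys[OF pP] homogeneous_hom_part] pointD(2)[OF I_in_points p] by blast
    then show "p \<in> ungr R" unfolding ungr_def using pP Rd(2) by simp
  qed
  obtain i where i: "i \<le> n" "\<xi> i \<notin> R 1" using graded_primeD(2)[OF R] by blast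
  then have "var i \<notin> ungr R" using homogeneous_ungr[OF polys_var homogeneous_var, of i] by (simp add: hom.peval_var)
  then show "\<exists>i\<le>n. var i \<notin> ungr R" using i(1) by blast
qed

lemma gr_ungr: "gr (ungr R) = R"
proof
  fix k
  show "gr (ungr R) k = R k"
  proof (intro equalityI subsetI)
    fix x assume "x \<in> gr (ungr R) k"
    then obtain p where "x = ev p" "p \<in> ungr R" "p \<in> Pol" "homogeneous k p" unfolding gr_def by blast
    then show "x \<in> R k" using homogeneous_ungr by blast
  next
    fix x assume x: "x \<in> R k"
    then obtain p where p: "x = ev p" "p \<in> Pol" "homogeneous k p" using Rd(1)[OF x] by (elim VE)
    then have "p \<in> ungr R" using homogeneous_ungr x by blast
    then show "x \<in> gr (ungr R) k" unfolding gr_def using p by blast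
  qed
qed

end

lemma gr_mono: "P \<subseteq> P' \<Longrightarrow> gr P k \<subseteq> gr P' k"
  unfolding gr_def by blast

lemma ungr_mono: "(\<And>k. R k \<subseteq> R' k) \<Longrightarrow> ungr R \<subseteq> ungr R'"
  unfolding ungr_def by blast

lemma gr_closed:
  assumes P: "P \<in> closed_points n I" shows "graded_closed (gr P)"
  unfolding graded_closed_def
proof (intro conjI allI impI)
  have PP: "P \<in> proj_points n I" "\<And>Q. Q \<in> proj_points n I \<Longrightarrow> P \<subseteq> Q \<Longrightarrow> Q = P" using P unfolding closed_points_def by blast+
  show "graded_prime (gr P)" by (rule gr_graded_prime[OF PP(1)])
  fix R assume R: "graded_prime R" "\<forall>k. gr P k \<subseteq> R k"
  have "ungr (gr P) \<subseteq> ungr R" using R(2) by (intro ungr_mono) blast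
  then have "ungr R = P" using PP(2)[OF ungr_point[OF R(1)]] ungr_gr[OF PP(1)] by simp
  then show "R = gr P" using gr_ungr[OF R(1)] by simp
qed

lemma ungr_closed:
  assumes R: "graded_closed R" shows "ungr R \<in> closed_points n I"
  unfolding closed_points_def
proof (intro CollectI conjI ballI impI)
  have Rp: "graded_prime R" using R unfolding graded_closed_def by blast
  show "ungr R \<in> proj_points n I" by (rule ungr_point[OF Rp])
  fix Q assume Q: "Q \<in> proj_points n I" "ungr R \<subseteq> Q"
  have "R k \<subseteq> gr Q k" for k using gr_mono[OF Q(2), of k] gr_ungr[OF Rp] by simp
  then have "gr Q = R" using R gr_graded_prime[OF Q(1)] unfolding graded_closed_def by blast
  then show "Q = ungr R" using ungr_gr[OF Q(1)] by simp
qed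

text \<open>Transcendence degree one excludes two independent elements; the resulting relation in
  two variables is rewritten as a double sum with a common bound \<open>B\<close> on the
  exponents.\<close>

lemma K_algebraic':
  assumes y: "y \<in> K" and z: "z \<in> K"
  shows "\<exists>c B a1 b1. (\<forall>a b. c a b \<in> V 0) \<and> a1 \<le> B \<and> b1 \<le> B \<and> c a1 b1 \<noteq> 0 \<and>
      (\<Sum>b\<le>B. \<Sum>a\<le>B. c a b * y ^ a * z ^ b) = 0"
proof -
  let ?x = "\<lambda>i::nat. if i = 0 then y else z"
  have xK: "\<forall>i<Suc 1. ?x i \<in> function_field n I \<phi> \<xi>" using y z function_field_K by simp
  have ind: "\<not> (\<exists>x. (\<forall>i<Suc 1. x i \<in> function_field n I \<phi> \<xi>) \<and> alg_independent \<phi> (Suc 1) x)"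
    using trdeg unfolding has_trdeg_def by (rule conjunct2)
  have "\<not> alg_independent \<phi> (Suc 1) ?x"
  proof
    assume "alg_independent \<phi> (Suc 1) ?x"
    with xK have "(\<forall>i<Suc 1. ?x i \<in> function_field n I \<phi> \<xi>) \<and> alg_independent \<phi> (Suc 1) ?x" by (rule conjI)
    then show False using ind by (rule notE[rotated, OF exI[where x = ?x]])
  qed
  then obtain p where p: "p \<in> polys (Suc 1)" "peval \<phi> ?x p = 0" "p \<noteq> 0"
    unfolding alg_independent_def by blast
  define mono where "mono = (\<lambda>(b, a). Poly_Mapping.single (0::nat) (a::nat) + Poly_Mapping.single 1 (b::nat))"
  have look: "Poly_Mapping.lookup (mono (b, a)) 0 = a" "Poly_Mapping.lookup (mono (b, a)) 1 = b" for a b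
    unfolding mono_def by (simp_all add: lookup_add lookup_single)
  have inj: "inj_on mono S" for S
  proof (rule inj_onI)
    fix u v assume "mono u = mono v"
    then show "u = v" using look by (cases u, cases v) metis
  qed
  have keys: "m = mono (Poly_Mapping.lookup m 1, Poly_Mapping.lookup m 0)" if "m \<in> Poly_Mapping.keys p" for m
    using monomial_two[of m] p(1) that unfolding polys_def mono_def by (auto simp: numeral_2_eq_2)
  define B where "B = (\<Sum>m\<in>Poly_Mapping.keys p. Poly_Mapping.lookup m 0 + Poly_Mapping.lookup m 1)"
  have B: "Poly_Mapping.lookup m 0 \<le> B \<and> Poly_Mapping.lookup m 1 \<le> B" if "m \<in> Poly_Mapping.keys p" for m
    using member_le_sum[OF that, of "\<lambda>m. Poly_Mapping.lookup m 0 + Poly_Mapping.lookup m 1"] unfolding B_def by simp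
  define c where "c a b = \<phi> (Poly_Mapping.lookup p (mono (b, a)))" for a b
  have "Poly_Mapping.keys p \<noteq> {}" using p(3) by simp
  then obtain m1 where m1: "m1 \<in> Poly_Mapping.keys p" by blast
  have "c (Poly_Mapping.lookup m1 0) (Poly_Mapping.lookup m1 1) \<noteq> 0"
  proof -
    let ?l = "Poly_Mapping.lookup p m1"
    have "?l \<noteq> 0" using m1 by (simp add: in_keys_iff)
    then have "\<phi> ?l * \<phi> (inverse ?l) = 1" by (simp add: hom.hom_mult[symmetric])
    then have "\<phi> ?l \<noteq> 0" by auto
    then show ?thesis unfolding c_def using keys[OF m1] by simp
  qed
  moreover have "c a b \<in> V 0" for a b unfolding c_def V_0 by blast
  moreover have "(\<Sum>b\<le>B. \<Sum>a\<le>B. c a b * y ^ a * z ^ b) = 0"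
  proof -
    have "Poly_Mapping.keys p \<subseteq> mono ` ({..B} \<times> {..B})"
    proof
      fix m assume m: "m \<in> Poly_Mapping.keys p"
      show "m \<in> mono ` ({..B} \<times> {..B})" 
        by (rule image_eqI[where f = mono, OF keys[OF m]]) (use B[OF m] in simp)
    qed
    then have "peval \<phi> ?x p = (\<Sum>m\<in>mono ` ({..B} \<times> {..B}). \<phi> (Poly_Mapping.lookup p m) * monomial_value ?x m)"
      by (intro hom.peval_superset) auto
    also have "\<dots> = (\<Sum>u\<in>{..B} \<times> {..B}. \<phi> (Poly_Mapping.lookup p (mono u)) * monomial_value ?x (mono u))"
      by (simp add: sum.reindex[OF inj])
    also have "\<dots> = (\<Sum>b\<le>B. \<Sum>a\<le>B. \<phi> (Poly_Mapping.lookup p (mono (b, a))) * monomial_value ?x (mono (b, a)))"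
      unfolding sum.cartesian_product by (rule sum.cong) auto
    also have "\<dots> = (\<Sum>b\<le>B. \<Sum>a\<le>B. c a b * y ^ a * z ^ b)"
      unfolding c_def by (intro sum.cong refl) (simp add: mono_def monomial_value_add mult.assoc)
    finally show ?thesis using p(2) by simp
  qed
  ultimately show ?thesis using B[OF m1] by blast
qed

text \<open>The correspondence \<open>gr\<close> matches closed points and local rings on both
  sides, so \<open>regular_outside\<close> is the ring \<open>A\<close> of the completed
  curve.\<close>

lemma regular_outside_discrete_cocompact:
  assumes Pinf: "Pinf \<in> closed_points n I" and comp: "completion_at n I \<phi> \<xi> Pinf \<nu>"
  shows "\<exists>Q N. discrete_cocompact_ring \<nu> Q (regular_outside n I \<phi> \<xi> Pinf) N"
proof -
  have Pp: "Pinf \<in> proj_points n I" using Pinf unfolding closed_points_def by blast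
  interpret valued_field \<nu> using comp unfolding completion_at_def by unfold_locales blast
  have card2: "2 \<le> CARD('f)"
  proof -
    have "card {0, 1 :: 'f} \<le> CARD('f)" by (rule card_mono) auto
    then show ?thesis by simp
  qed
  interpret curve_completion V n \<xi> \<nu> "gr Pinf"
  proof
    show "graded_closed (gr Pinf)" by (rule gr_closed[OF Pinf])
    show "0 \<le> \<nu> x \<longleftrightarrow> x \<in> localring (gr Pinf)" if "x \<in> K" "x \<noteq> 0" for x
      using comp that unfolding completion_at_def function_field_K local_ring_gr[OF Pp] by blast
    show "\<exists>y\<in>K. x - y \<in> D j" for x j
      by (rule closure_of_valuation_topology[OF card2
        comp[unfolded completion_at_def function_field_K, THEN conjunct2, THEN conjunct2, THEN conjunct1]])
  qed (rule K_algebraic')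
  have "regular_outside n I \<phi> \<xi> Pinf = A"
  proof (intro equalityI subsetI)
    fix x assume "x \<in> regular_outside n I \<phi> \<xi> Pinf"
    then have x: "x \<in> K" "\<And>P. P \<in> closed_points n I \<Longrightarrow> P \<noteq> Pinf \<Longrightarrow> x \<in> local_ring n \<phi> \<xi> P"
      unfolding regular_outside_def function_field_K by blast+
    have "x \<in> localring R" if R: "graded_closed R" "R \<noteq> gr Pinf" for R
    proof -
      note g = gr_ungr[OF closed_prime[OF R(1)]]
      have "ungr R \<noteq> Pinf" using g R(2) by auto
      then show ?thesis using x(2)[OF ungr_closed[OF R(1)]] local_ring_gr[OF ungr_point[OF closed_prime[OF R(1)]]] g by simp
    qed
    then show "x \<in> A" unfolding A_def using x(1) by blast
  next
    fix x assume "x \<in> A"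
    then have x: "x \<in> K" "\<And>R. graded_closed R \<Longrightarrow> R \<noteq> gr Pinf \<Longrightarrow> x \<in> localring R" unfolding A_def by blast+
    have "x \<in> local_ring n \<phi> \<xi> P" if P: "P \<in> closed_points n I" "P \<noteq> Pinf" for P
    proof -
      have PP: "P \<in> proj_points n I" using P(1) unfolding closed_points_def by blast
      have "gr P \<noteq> gr Pinf" using ungr_gr[OF PP] ungr_gr[OF Pp] P(2) by metis
      then show ?thesis using x(2)[OF gr_closed[OF P(1)]] local_ring_gr[OF PP] by simp
    qed
    then show "x \<in> regular_outside n I \<phi> \<xi> Pinf" unfolding regular_outside_def function_field_K using x(1) by blast
  qed
  then show ?thesis using A_discrete_cocompact by simp
qed

end

theorem theorem1p1:
  fixes n :: nat
    and I Pinf :: "'f::{finite,field} mpoly set"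
    and \<phi> :: "'f \<Rightarrow> 'l::field"
    and \<xi> :: "nat \<Rightarrow> 'l"
    and \<nu> :: "'l \<Rightarrow> int"
    and \<pi> :: 'l
    and \<mu> :: "'l measure"
  assumes "smooth_projective_curve n I \<phi> \<xi>"
    and "Pinf \<in> closed_points n I"
    and "completion_at n I \<phi> \<xi> Pinf \<nu>"
    and "uniformizer \<nu> \<pi>"
    and "haar_measure (valuation_topology (absval CARD('f) \<nu>)) \<mu>"
  shows "(\<forall>M::int. valuation_integers (absval CARD('f) \<nu>)
            - approximable (regular_outside n I \<phi> \<xi> Pinf) (absval CARD('f) \<nu>) \<pi> M \<in> null_sets \<mu>) \<and>
         (\<exists>\<Sigma> \<subseteq> valuation_integers (absval CARD('f) \<nu>).
            valuation_integers (absval CARD('f) \<nu>) - \<Sigma> \<in> null_sets \<mu> \<and>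
            (\<forall>\<alpha> \<in> \<Sigma>. \<exists>f g. (\<forall>k::nat. f k \<in> regular_outside n I \<phi> \<xi> Pinf \<and>
                  g k \<in> regular_outside n I \<phi> \<xi> Pinf \<and> g k \<noteq> 0) \<and>
               limitin (valuation_topology (absval CARD('f) \<nu>)) (\<lambda>k. f k / g k) \<alpha> sequentially \<and>
               (\<lambda>k. absval CARD('f) \<nu> (\<alpha> - f k / g k) * (absval CARD('f) \<nu> (g k))\<^sup>2)
                 \<longlonglongrightarrow> 0))"
proof -
  interpret projective_curve n I \<phi> \<xi>
    using assms(1) unfolding smooth_projective_curve_def by unfold_locales blast+
  obtain Q N where dc: "discrete_cocompact_ring \<nu> Q (regular_outside n I \<phi> \<xi> Pinf) N"
    using regular_outside_discrete_cocompact[OF assms(2,3)] by blast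
  have "card {0, 1 :: 'f} \<le> CARD('f)" by (rule card_mono) auto
  then have "2 \<le> CARD('f)" by simp
  moreover have "Metric_space.mcomplete UNIV (\<lambda>x y. absval CARD('f) \<nu> (x - y))"
    using assms(3) unfolding completion_at_def by blast
  ultimately interpret haar_discrete_cocompact_ring \<nu> Q "regular_outside n I \<phi> \<xi> Pinf" N "CARD('f)" \<mu>
    using dc assms(5) by (intro haar_discrete_cocompact_ring.intro haar_discrete_cocompact_ring_axioms.intro)
  show ?thesis by (rule almost_all_approximable[OF assms(4)])
qed

end
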